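(* Let $\Bbbk=(\Bbbk_\alpha)_{\alpha\in\mathrm{ON}}$ be an ordinal-indexed tower of fields with $\Bbbk_\alpha\subset\Bbbk_\beta$ of infinite degree whenever $\alpha<\beta$, and let $\mathcal{C}_{\Bbbk}$ be the associated category of grounded chains. Then $\mathcal{C}_{\Bbbk}$ is an AB5 abelian category, but it does not have enough injectives.
   Context: Set theory: ZFC (with proper classes treated in the metatheory) or NBG with choice. $\mathrm{ON}$ is the (large) well-ordered class of ordinals. The tower is a functor $\alpha\mapsto\Bbbk_\alpha$ from $(\mathrm{ON},\le)$ to fields, its maps viewed as inclusions $\Bbbk_\alpha\subset\Bbbk_\beta$ for $\alpha\le\beta$, with $\Bbbk_\beta$ of infinite degree over $\Bbbk_\alpha$ whenever $\alpha<\beta$. Let $\overline{\mathcal{C}}_{\Bbbk}$ have as objects families $V=(V_\alpha)_{\alpha\in\mathrm{ON}}$ of $\Bbbk_\alpha$-vector spaces with $\Bbbk_\alpha$-linear maps $\nu_{\beta\alpha}:V_\alpha\to V_\beta$ for $\alpha\le\beta$, satisfying $\nu_{\alpha\alpha}=\mathrm{id}$ and $\nu_{\gamma\beta}\nu_{\beta\alpha}=\nu_{\gamma\alpha}$; morphisms are families of $\Bbbk_\alpha$-linear maps $V_\alpha\to W_\alpha$ commuting with the $\nu$'s. An object is $\alpha$-grounded if for all $\beta>\alpha$, $V_\beta$ is the $\Bbbk_\beta$-span of $\nu_{\beta\alpha}(V_\alpha)$; it is grounded if it is $\alpha$-grounded for some ordinal $\alpha$. $\mathcal{C}_{\Bbbk}$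 is the full subcategory of $\overline{\mathcal{C}}_{\Bbbk}$ on the grounded objects. AB5 means: abelian, cocomplete, with exact (small) filtered colimits. *)

theory Defs
  imports "HOL-Algebra.Embedded_Algebras"
begin

section \<open>The set-theoretic universe\<close>

text \<open>
  A type of class \<open>zfc\<close> is a universe of sets, with \<open>elts x\<close> the collection of members of \<open>x\<close>.
  Values of type \<open>'v set\<close> (and functions on \<open>'v\<close>) play the role of classes, as in NBG; choice,
  even in its global form, is provided by Hilbert's epsilon operator. HOL itself cannot
  exhibit an instance of this class, just as ZFC cannot prove its own consistency.
\<close>

class zfc =
  fixes elts :: "'a \<Rightarrow> 'a set"
  assumes extensionality: "elts x = elts y \<Longrightarrow> x = y"
    and foundation: "wf {(x, y). x \<in> elts y}"
    and pairing: "\<exists>z. elts z = {x, y}"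
    and union: "\<exists>z. elts z = (\<Union>y\<in>elts x. elts y)"
    and power_set: "\<exists>z. elts z = {y. elts y \<subseteq> elts x}"
    and separation: "T \<subseteq> elts x \<Longrightarrow> \<exists>z. elts z = T"
    and replacement: "\<exists>z. elts z = f ` elts x"
    and infinity: "\<exists>x. (\<exists>e\<in>elts x. elts e = {}) \<and>
                       (\<forall>y\<in>elts x. \<exists>z\<in>elts x. elts z = insert y (elts y))"

text \<open>Classes that are sets.\<close>

definition small :: "'v::zfc set \<Rightarrow> bool" where
  "small T \<longleftrightarrow> (\<exists>x. T = elts x)"

definition transitive_set :: "'v::zfc \<Rightarrow> bool" where
  "transitive_set x \<longleftrightarrow> (\<forall>y\<in>elts x. elts y \<subseteq> elts x)"

definition ON :: "'v::zfc set" where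
  "ON = {\<alpha>. transitive_set \<alpha> \<and> (\<forall>\<beta>\<in>elts \<alpha>. transitive_set \<beta>)}"

definition ord_less :: "'v::zfc \<Rightarrow> 'v \<Rightarrow> bool" where
  "ord_less \<alpha> \<beta> \<longleftrightarrow> \<alpha> \<in> ON \<and> \<beta> \<in> ON \<and> \<alpha> \<in> elts \<beta>"

definition ord_le :: "'v::zfc \<Rightarrow> 'v \<Rightarrow> bool" where
  "ord_le \<alpha> \<beta> \<longleftrightarrow> \<alpha> \<in> ON \<and> \<beta> \<in> ON \<and> (\<alpha> \<in> elts \<beta> \<or> \<alpha> = \<beta>)"


section \<open>Categories\<close>

record ('o, 'm) category =
  Ob :: "'o set"
  Hom :: "'o \<Rightarrow> 'o \<Rightarrow> 'm set"
  Ident :: "'o \<Rightarrow> 'm"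
  Comp :: "'m \<Rightarrow> 'm \<Rightarrow> 'm" (infixl \<open>\<cdot>\<index>\<close> 70)

text \<open>\<open>g \<cdot>\<^bsub>C\<^esub> f\<close> is "first \<open>f\<close>, then \<open>g\<close>". Homs between values outside \<open>Ob C\<close> are irrelevant.
  Hom-classes need not be small.\<close>

locale category =
  fixes C :: "('o, 'm) category" (structure)
  assumes Hom_disjoint:
      "\<lbrakk>A \<in> Ob C; B \<in> Ob C; A' \<in> Ob C; B' \<in> Ob C; f \<in> Hom C A B; f \<in> Hom C A' B'\<rbrakk>
        \<Longrightarrow> A = A' \<and> B = B'"
    and Id_Hom: "A \<in> Ob C \<Longrightarrow> Ident C A \<in> Hom C A A"
    and Comp_Hom:
      "\<lbrakk>A \<in> Ob C; B \<in> Ob C; D \<in> Ob C; f \<in> Hom C A B; g \<in> Hom C B D\<rbrakk> \<Longrightarrow> g \<cdot> f \<in> Hom C A D"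
    and Comp_Id: "\<lbrakk>A \<in> Ob C; B \<in> Ob C; f \<in> Hom C A B\<rbrakk> \<Longrightarrow> f \<cdot> Ident C A = f"
    and Id_Comp: "\<lbrakk>A \<in> Ob C; B \<in> Ob C; f \<in> Hom C A B\<rbrakk> \<Longrightarrow> Ident C B \<cdot> f = f"
    and Comp_assoc:
      "\<lbrakk>A \<in> Ob C; B \<in> Ob C; D \<in> Ob C; E \<in> Ob C; f \<in> Hom C A B; g \<in> Hom C B D; h \<in> Hom C D E\<rbrakk>
        \<Longrightarrow> (h \<cdot> g) \<cdot> f = h \<cdot> (g \<cdot> f)"

definition full_subcategory :: "('o, 'm) category \<Rightarrow> ('o \<Rightarrow> bool) \<Rightarrow> ('o, 'm) category" where
  "full_subcategory C P = C\<lparr>Ob := {A \<in> Ob C. P A}\<rparr>"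

definition mono_arrow :: "('o, 'm) category \<Rightarrow> 'o \<Rightarrow> 'o \<Rightarrow> 'm \<Rightarrow> bool" where
  "mono_arrow C A B f \<longleftrightarrow> f \<in> Hom C A B \<and>
     (\<forall>T\<in>Ob C. \<forall>g\<in>Hom C T A. \<forall>h\<in>Hom C T A. f \<cdot>\<^bsub>C\<^esub> g = f \<cdot>\<^bsub>C\<^esub> h \<longrightarrow> g = h)"

definition epi_arrow :: "('o, 'm) category \<Rightarrow> 'o \<Rightarrow> 'o \<Rightarrow> 'm \<Rightarrow> bool" where
  "epi_arrow C A B f \<longleftrightarrow> f \<in> Hom C A B \<and>
     (\<forall>T\<in>Ob C. \<forall>g\<in>Hom C B T. \<forall>h\<in>Hom C B T. g \<cdot>\<^bsub>C\<^esub> f = h \<cdot>\<^bsub>C\<^esub> f \<longrightarrow> g = h)"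

definition zero_object :: "('o, 'm) category \<Rightarrow> 'o \<Rightarrow> bool" where
  "zero_object C Z \<longleftrightarrow> Z \<in> Ob C \<and>
     (\<forall>A\<in>Ob C. (\<exists>!f. f \<in> Hom C Z A) \<and> (\<exists>!f. f \<in> Hom C A Z))"

definition zero_arrow :: "('o, 'm) category \<Rightarrow> 'o \<Rightarrow> 'o \<Rightarrow> 'm \<Rightarrow> bool" where
  "zero_arrow C A B f \<longleftrightarrow>
     (\<exists>Z. zero_object C Z \<and> (\<exists>g\<in>Hom C A Z. \<exists>h\<in>Hom C Z B. f = h \<cdot>\<^bsub>C\<^esub> g))"

definition is_kernel :: "('o, 'm) category \<Rightarrow> 'o \<Rightarrow> 'o \<Rightarrow> 'm \<Rightarrow> 'o \<Rightarrow> 'm \<Rightarrow> bool" where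
  "is_kernel C A B f K k \<longleftrightarrow> K \<in> Ob C \<and> k \<in> Hom C K A \<and> zero_arrow C K B (f \<cdot>\<^bsub>C\<^esub> k) \<and>
     (\<forall>T\<in>Ob C. \<forall>g\<in>Hom C T A. zero_arrow C T B (f \<cdot>\<^bsub>C\<^esub> g) \<longrightarrow>
        (\<exists>!h. h \<in> Hom C T K \<and> k \<cdot>\<^bsub>C\<^esub> h = g))"

definition is_cokernel :: "('o, 'm) category \<Rightarrow> 'o \<Rightarrow> 'o \<Rightarrow> 'm \<Rightarrow> 'o \<Rightarrow> 'm \<Rightarrow> bool" where
  "is_cokernel C A B f Q q \<longleftrightarrow> Q \<in> Ob C \<and> q \<in> Hom C B Q \<and> zero_arrow C A Q (q \<cdot>\<^bsub>C\<^esub> f) \<and>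
     (\<forall>T\<in>Ob C. \<forall>g\<in>Hom C B T. zero_arrow C A T (g \<cdot>\<^bsub>C\<^esub> f) \<longrightarrow>
        (\<exists>!h. h \<in> Hom C Q T \<and> h \<cdot>\<^bsub>C\<^esub> q = g))"

text \<open>\<open>G A B\<close> is the group structure on \<open>Hom C A B\<close>, written multiplicatively.\<close>

definition preadditive :: "('o, 'm) category \<Rightarrow> ('o \<Rightarrow> 'o \<Rightarrow> 'm monoid) \<Rightarrow> bool" where
  "preadditive C G \<longleftrightarrow>
     (\<forall>A\<in>Ob C. \<forall>B\<in>Ob C. comm_group (G A B) \<and> carrier (G A B) = Hom C A B) \<and>
     (\<forall>A\<in>Ob C. \<forall>B\<in>Ob C. \<forall>D\<in>Ob C. \<forall>f\<in>Hom C A B. \<forall>g\<in>Hom C A B. \<forall>h\<in>Hom C B D.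
        h \<cdot>\<^bsub>C\<^esub> (f \<otimes>\<^bsub>G A B\<^esub> g) = (h \<cdot>\<^bsub>C\<^esub> f) \<otimes>\<^bsub>G A D\<^esub> (h \<cdot>\<^bsub>C\<^esub> g)) \<and>
     (\<forall>A\<in>Ob C. \<forall>B\<in>Ob C. \<forall>D\<in>Ob C. \<forall>f\<in>Hom C A B. \<forall>g\<in>Hom C B D. \<forall>h\<in>Hom C B D.
        (g \<otimes>\<^bsub>G B D\<^esub> h) \<cdot>\<^bsub>C\<^esub> f = (g \<cdot>\<^bsub>C\<^esub> f) \<otimes>\<^bsub>G A D\<^esub> (h \<cdot>\<^bsub>C\<^esub> f))"

definition is_biproduct ::
  "('o, 'm) category \<Rightarrow> ('o \<Rightarrow> 'o \<Rightarrow> 'm monoid) \<Rightarrow> 'o \<Rightarrow> 'o \<Rightarrow> 'o \<Rightarrow> 'm \<Rightarrow> 'm \<Rightarrow> 'm \<Rightarrow> 'm \<Rightarrow> bool" where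
  "is_biproduct C G A B S i\<^sub>A i\<^sub>B p\<^sub>A p\<^sub>B \<longleftrightarrow> S \<in> Ob C \<and>
     i\<^sub>A \<in> Hom C A S \<and> i\<^sub>B \<in> Hom C B S \<and> p\<^sub>A \<in> Hom C S A \<and> p\<^sub>B \<in> Hom C S B \<and>
     p\<^sub>A \<cdot>\<^bsub>C\<^esub> i\<^sub>A = Ident C A \<and> p\<^sub>B \<cdot>\<^bsub>C\<^esub> i\<^sub>B = Ident C B \<and>
     p\<^sub>B \<cdot>\<^bsub>C\<^esub> i\<^sub>A = \<one>\<^bsub>G A B\<^esub> \<and> p\<^sub>A \<cdot>\<^bsub>C\<^esub> i\<^sub>B = \<one>\<^bsub>G B A\<^esub> \<and>
     (i\<^sub>A \<cdot>\<^bsub>C\<^esub> p\<^sub>A) \<otimes>\<^bsub>G S S\<^esub> (i\<^sub>B \<cdot>\<^bsub>C\<^esub> p\<^sub>B) = Ident C S"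

definition additive_category :: "('o, 'm) category \<Rightarrow> bool" where
  "additive_category C \<longleftrightarrow> category C \<and> (\<exists>G. preadditive C G \<and> (\<exists>Z. zero_object C Z) \<and>
     (\<forall>A\<in>Ob C. \<forall>B\<in>Ob C. \<exists>S i\<^sub>A i\<^sub>B p\<^sub>A p\<^sub>B. is_biproduct C G A B S i\<^sub>A i\<^sub>B p\<^sub>A p\<^sub>B))"

definition abelian_category :: "('o, 'm) category \<Rightarrow> bool" where
  "abelian_category C \<longleftrightarrow> additive_category C \<and>
     (\<forall>A\<in>Ob C. \<forall>B\<in>Ob C. \<forall>f\<in>Hom C A B.
        (\<exists>K k. is_kernel C A B f K k) \<and> (\<exists>Q q. is_cokernel C A B f Q q)) \<and>
     (\<forall>A\<in>Ob C. \<forall>B\<in>Ob C. \<forall>f. mono_arrow C A B f \<longrightarrow>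
        (\<exists>D\<in>Ob C. \<exists>g\<in>Hom C B D. is_kernel C B D g A f)) \<and>
     (\<forall>A\<in>Ob C. \<forall>B\<in>Ob C. \<forall>f. epi_arrow C A B f \<longrightarrow>
        (\<exists>D\<in>Ob C. \<exists>g\<in>Hom C D A. is_cokernel C D A g B f))"

text \<open>Exactness of \<open>0 \<rightarrow> A \<rightarrow> B \<rightarrow> D \<rightarrow> 0\<close>.\<close>

definition short_exact :: "('o, 'm) category \<Rightarrow> 'o \<Rightarrow> 'o \<Rightarrow> 'o \<Rightarrow> 'm \<Rightarrow> 'm \<Rightarrow> bool" where
  "short_exact C A B D f g \<longleftrightarrow> is_kernel C B D g A f \<and> is_cokernel C A B f D g"


subsection \<open>Diagrams and colimits\<close>

definition small_category :: "('v::zfc, 'v) category \<Rightarrow> bool" where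
  "small_category J \<longleftrightarrow> category J \<and> small (Ob J) \<and> (\<forall>i\<in>Ob J. \<forall>j\<in>Ob J. small (Hom J i j))"

definition filtered :: "('i, 'j) category \<Rightarrow> bool" where
  "filtered J \<longleftrightarrow> Ob J \<noteq> {} \<and>
     (\<forall>i\<in>Ob J. \<forall>j\<in>Ob J. \<exists>l\<in>Ob J. Hom J i l \<noteq> {} \<and> Hom J j l \<noteq> {}) \<and>
     (\<forall>i\<in>Ob J. \<forall>j\<in>Ob J. \<forall>u\<in>Hom J i j. \<forall>v\<in>Hom J i j.
        \<exists>l\<in>Ob J. \<exists>w\<in>Hom J j l. w \<cdot>\<^bsub>J\<^esub> u = w \<cdot>\<^bsub>J\<^esub> v)"

record ('i, 'j, 'o, 'm) diagram =
  dob :: "'i \<Rightarrow> 'o"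
  darr :: "'j \<Rightarrow> 'm"

definition is_diagram ::
  "('i, 'j) category \<Rightarrow> ('o, 'm) category \<Rightarrow> ('i, 'j, 'o, 'm) diagram \<Rightarrow> bool" where
  "is_diagram J C F \<longleftrightarrow>
     (\<forall>i\<in>Ob J. dob F i \<in> Ob C \<and> darr F (Ident J i) = Ident C (dob F i)) \<and>
     (\<forall>i\<in>Ob J. \<forall>j\<in>Ob J. \<forall>u\<in>Hom J i j. darr F u \<in> Hom C (dob F i) (dob F j)) \<and>
     (\<forall>i\<in>Ob J. \<forall>j\<in>Ob J. \<forall>l\<in>Ob J. \<forall>u\<in>Hom J i j. \<forall>v\<in>Hom J j l.
        darr F (v \<cdot>\<^bsub>J\<^esub> u) = darr F v \<cdot>\<^bsub>C\<^esub> darr F u)"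

definition is_nat_trans ::
  "('i, 'j) category \<Rightarrow> ('o, 'm) category \<Rightarrow>
   ('i, 'j, 'o, 'm) diagram \<Rightarrow> ('i, 'j, 'o, 'm) diagram \<Rightarrow> ('i \<Rightarrow> 'm) \<Rightarrow> bool" where
  "is_nat_trans J C F G \<phi> \<longleftrightarrow>
     (\<forall>i\<in>Ob J. \<phi> i \<in> Hom C (dob F i) (dob G i)) \<and>
     (\<forall>i\<in>Ob J. \<forall>j\<in>Ob J. \<forall>u\<in>Hom J i j. \<phi> j \<cdot>\<^bsub>C\<^esub> darr F u = darr G u \<cdot>\<^bsub>C\<^esub> \<phi> i)"

definition is_cocone ::
  "('i, 'j) category \<Rightarrow> ('o, 'm) category \<Rightarrow> ('i, 'j, 'o, 'm) diagram \<Rightarrow> 'o \<Rightarrow> ('i \<Rightarrow> 'm) \<Rightarrow> bool" where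
  "is_cocone J C F L s \<longleftrightarrow> L \<in> Ob C \<and> (\<forall>i\<in>Ob J. s i \<in> Hom C (dob F i) L) \<and>
     (\<forall>i\<in>Ob J. \<forall>j\<in>Ob J. \<forall>u\<in>Hom J i j. s j \<cdot>\<^bsub>C\<^esub> darr F u = s i)"

definition is_colimit ::
  "('i, 'j) category \<Rightarrow> ('o, 'm) category \<Rightarrow> ('i, 'j, 'o, 'm) diagram \<Rightarrow> 'o \<Rightarrow> ('i \<Rightarrow> 'm) \<Rightarrow> bool" where
  "is_colimit J C F L s \<longleftrightarrow> is_cocone J C F L s \<and>
     (\<forall>T t. is_cocone J C F T t \<longrightarrow> (\<exists>!h. h \<in> Hom C L T \<and> (\<forall>i\<in>Ob J. h \<cdot>\<^bsub>C\<^esub> s i = t i)))"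

text \<open>
  The type argument names the universe with respect to which diagrams are small. Every small
  category is isomorphic to one whose objects and arrows are elements of the universe.
\<close>

definition cocomplete :: "'v::zfc itself \<Rightarrow> ('o, 'm) category \<Rightarrow> bool" where
  "cocomplete _ C \<longleftrightarrow>
     (\<forall>(J :: ('v, 'v) category) F. small_category J \<and> is_diagram J C F \<longrightarrow>
        (\<exists>L s. is_colimit J C F L s))"

text \<open>
  The colimit functor on diagrams of a filtered shape \<open>J\<close> preserves short exact sequences, where
  a sequence of diagrams is exact iff it is exact at each object of \<open>J\<close>. The arrows \<open>f\<close> and \<open>g\<close>
  are the values of the colimit functor at \<open>\<phi>\<close> and \<open>\<psi>\<close>.
\<close>

definition exact_filtered_colimits :: "'v::zfc itself \<Rightarrow> ('o, 'm) category \<Rightarrow> bool" where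
  "exact_filtered_colimits _ C \<longleftrightarrow>
     (\<forall>(J :: ('v, 'v) category) F G H \<phi> \<psi> L\<^sub>F L\<^sub>G L\<^sub>H s\<^sub>F s\<^sub>G s\<^sub>H f g.
        small_category J \<and> filtered J \<and>
        is_diagram J C F \<and> is_diagram J C G \<and> is_diagram J C H \<and>
        is_nat_trans J C F G \<phi> \<and> is_nat_trans J C G H \<psi> \<and>
        (\<forall>i\<in>Ob J. short_exact C (dob F i) (dob G i) (dob H i) (\<phi> i) (\<psi> i)) \<and>
        is_colimit J C F L\<^sub>F s\<^sub>F \<and> is_colimit J C G L\<^sub>G s\<^sub>G \<and> is_colimit J C H L\<^sub>H s\<^sub>H \<and>
        f \<in> Hom C L\<^sub>F L\<^sub>G \<and> (\<forall>i\<in>Ob J. f \<cdot>\<^bsub>C\<^esub> s\<^sub>F i = s\<^sub>G i \<cdot>\<^bsub>C\<^esub> \<phi> i) \<and>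
        g \<in> Hom C L\<^sub>G L\<^sub>H \<and> (\<forall>i\<in>Ob J. g \<cdot>\<^bsub>C\<^esub> s\<^sub>G i = s\<^sub>H i \<cdot>\<^bsub>C\<^esub> \<psi> i) \<longrightarrow>
        short_exact C L\<^sub>F L\<^sub>G L\<^sub>H f g)"

definition AB5 :: "'v::zfc itself \<Rightarrow> ('o, 'm) category \<Rightarrow> bool" where
  "AB5 U C \<longleftrightarrow> abelian_category C \<and> cocomplete U C \<and> exact_filtered_colimits U C"


subsection \<open>Injective objects\<close>

definition injective_object :: "('o, 'm) category \<Rightarrow> 'o \<Rightarrow> bool" where
  "injective_object C I \<longleftrightarrow> I \<in> Ob C \<and>
     (\<forall>A\<in>Ob C. \<forall>B\<in>Ob C. \<forall>m. mono_arrow C A B m \<longrightarrow>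
        (\<forall>f\<in>Hom C A I. \<exists>g\<in>Hom C B I. g \<cdot>\<^bsub>C\<^esub> m = f))"

definition enough_injectives :: "('o, 'm) category \<Rightarrow> bool" where
  "enough_injectives C \<longleftrightarrow>
     (\<forall>A\<in>Ob C. \<exists>I m. injective_object C I \<and> mono_arrow C A I m)"


section \<open>Towers of fields and chains of vector spaces\<close>

text \<open>\<open>emb k \<beta> \<alpha>\<close> is the field embedding of \<open>fld k \<alpha>\<close> into \<open>fld k \<beta>\<close> for \<open>\<alpha> \<le> \<beta>\<close>.
  Here and below, values at indices that are not ordinals carry no information.\<close>

record 'v tower =
  fld :: "'v \<Rightarrow> 'v ring"
  emb :: "'v \<Rightarrow> 'v \<Rightarrow> 'v \<Rightarrow> 'v"

definition field_tower :: "'v::zfc tower \<Rightarrow> bool" where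
  "field_tower k \<longleftrightarrow>
     (\<forall>\<alpha>\<in>ON. field (fld k \<alpha>) \<and> small (carrier (fld k \<alpha>))) \<and>
     (\<forall>\<alpha> \<beta>. ord_le \<alpha> \<beta> \<longrightarrow> emb k \<beta> \<alpha> \<in> ring_hom (fld k \<alpha>) (fld k \<beta>)) \<and>
     (\<forall>\<alpha>\<in>ON. \<forall>a\<in>carrier (fld k \<alpha>). emb k \<alpha> \<alpha> a = a) \<and>
     (\<forall>\<alpha> \<beta> \<gamma>. ord_le \<alpha> \<beta> \<and> ord_le \<beta> \<gamma> \<longrightarrow>
        (\<forall>a\<in>carrier (fld k \<alpha>). emb k \<gamma> \<beta> (emb k \<beta> \<alpha> a) = emb k \<gamma> \<alpha> a)) \<and>
     (\<forall>\<alpha> \<beta>. ord_less \<alpha> \<beta> \<longrightarrow>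
        \<not> ring.finite_dimension (fld k \<beta>) (emb k \<beta> \<alpha> ` carrier (fld k \<alpha>)) (carrier (fld k \<beta>)))"

definition linear_maps ::
  "'a ring \<Rightarrow> ('a, 'b) module \<Rightarrow> ('a, 'c) module \<Rightarrow> ('b \<Rightarrow> 'c) set" where
  "linear_maps R M N = {f \<in> hom (add_monoid M) (add_monoid N).
     \<forall>a\<in>carrier R. \<forall>x\<in>carrier M. f (a \<odot>\<^bsub>M\<^esub> x) = a \<odot>\<^bsub>N\<^esub> f x}"

definition restrict_scalars :: "('a \<Rightarrow> 'a) \<Rightarrow> ('a, 'b) module \<Rightarrow> ('a, 'b) module" where
  "restrict_scalars h N = N\<lparr>smult := (\<lambda>a. smult N (h a))\<rparr>"

definition linear_span :: "'a ring \<Rightarrow> ('a, 'b) module \<Rightarrow> 'b set \<Rightarrow> 'b set" where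
  "linear_span R M S = (\<lambda>H. submodule H R M) hull S"

text \<open>\<open>tmap V \<beta> \<alpha>\<close> is the transition map from \<open>vsp V \<alpha>\<close> to \<open>vsp V \<beta>\<close> for \<open>\<alpha> \<le> \<beta>\<close>.
  The ring fields \<open>mult\<close> and \<open>one\<close> of the module record are not used.\<close>

record 'v chain =
  vsp :: "'v \<Rightarrow> ('v, 'v) module"
  tmap :: "'v \<Rightarrow> 'v \<Rightarrow> 'v \<Rightarrow> 'v"

definition is_chain :: "'v::zfc tower \<Rightarrow> 'v chain \<Rightarrow> bool" where
  "is_chain k V \<longleftrightarrow>
     (\<forall>\<alpha>\<in>ON. module (fld k \<alpha>) (vsp V \<alpha>) \<and> small (carrier (vsp V \<alpha>))) \<and>
     (\<forall>\<alpha> \<beta>. ord_le \<alpha> \<beta> \<longrightarrow> tmap V \<beta> \<alpha> \<in>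
        linear_maps (fld k \<alpha>) (vsp V \<alpha>) (restrict_scalars (emb k \<beta> \<alpha>) (vsp V \<beta>))) \<and>
     (\<forall>\<alpha>\<in>ON. \<forall>x\<in>carrier (vsp V \<alpha>). tmap V \<alpha> \<alpha> x = x) \<and>
     (\<forall>\<alpha> \<beta> \<gamma>. ord_le \<alpha> \<beta> \<and> ord_le \<beta> \<gamma> \<longrightarrow>
        (\<forall>x\<in>carrier (vsp V \<alpha>). tmap V \<gamma> \<beta> (tmap V \<beta> \<alpha> x) = tmap V \<gamma> \<alpha> x))"

text \<open>Components of a chain map are \<open>undefined\<close> outside their domains, so that equality of chain
  maps between given chains is equality of all components on the carriers.\<close>

record 'v chain_map =
  src :: "'v chain"
  tgt :: "'v chain"
  component :: "'v \<Rightarrow> 'v \<Rightarrow> 'v"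

definition chain_maps :: "'v::zfc tower \<Rightarrow> 'v chain \<Rightarrow> 'v chain \<Rightarrow> 'v chain_map set" where
  "chain_maps k V W = {f. src f = V \<and> tgt f = W \<and> component f \<in> extensional ON \<and>
     (\<forall>\<alpha>\<in>ON. component f \<alpha> \<in> linear_maps (fld k \<alpha>) (vsp V \<alpha>) (vsp W \<alpha>) \<inter>
                             extensional (carrier (vsp V \<alpha>))) \<and>
     (\<forall>\<alpha> \<beta>. ord_le \<alpha> \<beta> \<longrightarrow> (\<forall>x\<in>carrier (vsp V \<alpha>).
        component f \<beta> (tmap V \<beta> \<alpha> x) = tmap W \<beta> \<alpha> (component f \<alpha> x)))}"

definition all_chains :: "'v::zfc tower \<Rightarrow> ('v chain, 'v chain_map) category" where
  "all_chains k = \<lparr>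
     Ob = {V. is_chain k V},
     Hom = chain_maps k,
     Ident = (\<lambda>V. \<lparr>src = V, tgt = V,
                 component = (\<lambda>\<alpha>\<in>ON. \<lambda>x\<in>carrier (vsp V \<alpha>). x)\<rparr>),
     Comp = (\<lambda>g f. \<lparr>src = src f, tgt = tgt g,
                    component = (\<lambda>\<alpha>\<in>ON. compose (carrier (vsp (src f) \<alpha>))
                                               (component g \<alpha>) (component f \<alpha>))\<rparr>)\<rparr>"

definition grounded_at :: "'v::zfc tower \<Rightarrow> 'v \<Rightarrow> 'v chain \<Rightarrow> bool" where
  "grounded_at k \<alpha> V \<longleftrightarrow> (\<forall>\<beta>. ord_less \<alpha> \<beta> \<longrightarrow>
     carrier (vsp V \<beta>) =
       linear_span (fld k \<beta>) (vsp V \<beta>) (tmap V \<beta> \<alpha> ` carrier (vsp V \<alpha>)))"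

definition grounded :: "'v::zfc tower \<Rightarrow> 'v chain \<Rightarrow> bool" where
  "grounded k V \<longleftrightarrow> (\<exists>\<alpha>\<in>ON. grounded_at k \<alpha> V)"

definition grounded_chains :: "'v::zfc tower \<Rightarrow> ('v chain, 'v chain_map) category" where
  "grounded_chains k = full_subcategory (all_chains k) (grounded k)"

end

theory Submission
  imports Defs
begin

text \<open>
  Kernels, cokernels and colimits of grounded chains are computed stage by stage, so exactness
  statements reduce to vector spaces. The one point that needs care is that a kernel is
  grounded again: every subchain of a grounded chain is grounded, because a strictly
  increasing ordinal-indexed family of subsets of a set must stabilise.

  If \<open>I\<close> is injective, the inclusions between the free chains on one generator at stages \<open>\<beta>\<close> and \<open>0\<close>
  show that \<open>I\<^sub>0 \<rightarrow> I\<^sub>\<beta>\<close> is surjective for every ordinal \<open>\<beta>\<close>. If the tower itself embedded into \<open>I\<close>,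
  the set \<open>I\<^sub>0\<close> would then surject onto arbitrarily large fields of the tower, which is impossible.
\<close>

section \<open>Small classes and ordinals\<close>

text \<open>By Grothendieck's theorem an AB5 category with a generator has enough injectives, so
  there can be no generator here. Its place is taken by a proper class: write P_\<beta> for the free
  chain on one generator at stage \<beta>. Maps from P_\<beta> to V are the elements of V at stage
  \<beta>. The final contradiction is one of size: each stage of a chain is a set, while the class
  of ordinals is not. The obstacle with subchains is that the stage where V is grounded need not
  ground a subchain H. Already P_0 is grounded at 0, but its subchain P_\<beta> at no stage below
  \<beta>. What can be bounded is the set of leading generators of vectors of H, a subset of V at a
  fixed stage. Once it has stopped growing, Gaussian elimination with vectors of H from that stage
  reduces every later vector of H to zero. Infinite degree enters through an element in each field
  of the tower that lies in no earlier one.\<close>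

lemma small_elts [simp, intro]: "small (elts x)"
  by (auto simp: small_def)

lemma small_subset: "small T \<Longrightarrow> S \<subseteq> T \<Longrightarrow> small S"
  unfolding small_def using separation by (blast dest: sym)

lemma small_image:
  fixes f :: "'v::zfc \<Rightarrow> 'v"
  shows "small T \<Longrightarrow> small (f ` T)"
proof -
  assume "small T"
  then obtain x where "T = elts x" unfolding small_def by blast
  then show "small (f ` T)" unfolding small_def using replacement[of f x] by (auto dest: sym)
qed

text \<open>Codes of the classes \<open>A x\<close> are chosen first, so that replacement and the
  union axiom apply to them.\<close>

lemma small_UN:
  fixes A :: "'v::zfc \<Rightarrow> 'v set"
  assumes "small T" "\<And>x. x \<in> T \<Longrightarrow> small (A x)"
  shows "small (\<Union>x\<in>T. A x)"
proof -
  obtain f where f: "\<And>x. x \<in> T \<Longrightarrow> A x = elts (f x)"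
    using assms(2) unfolding small_def by metis
  obtain z where "f ` T = elts z" using small_image[OF assms(1), of f] unfolding small_def by blast
  then have "(\<Union>x\<in>T. A x) = (\<Union>y\<in>elts z. elts y)" using f by force
  then show ?thesis unfolding small_def using union[of z] by metis
qed

lemma small_doubleton: "small {x, y}"
  unfolding small_def using pairing[of x y] by metis

lemma small_singleton: "small {x}"
  using small_doubleton[of x x] by simp

lemma small_Un: "small S \<Longrightarrow> small T \<Longrightarrow> small (S \<union> T)"
  using small_UN[OF small_doubleton, of _ _ "\<lambda>x. elts x"] unfolding small_def by auto

lemma small_empty: "small ({} :: 'v::zfc set)"
  using small_subset[OF small_singleton] by blast

text \<open>On a class that is not small the choice is arbitrary, so each use is paired with a proof
  of smallness.\<close>

definition vset :: "'v::zfc set \<Rightarrow> 'v" where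
  "vset T = (SOME x. elts x = T)"

lemma elts_vset: "small T \<Longrightarrow> elts (vset T) = T"
  unfolding vset_def small_def by (metis (mono_tags, lifting) someI)

section \<open>The ordinals of the universe\<close>

lemma not_in_elts_self: "x \<notin> elts (x :: 'v::zfc)"
  using wf_not_refl[OF foundation] by blast

definition vsucc :: "'v::zfc \<Rightarrow> 'v" where
  "vsucc x = vset (insert x (elts x))"

lemma elts_vsucc [simp]: "elts (vsucc x) = insert x (elts x)"
  using small_Un[OF small_singleton small_elts, of x x] by (simp add: vsucc_def elts_vset)

lemma ON_vset: "T \<subseteq> ON \<Longrightarrow> small T \<Longrightarrow> (\<And>x. x \<in> T \<Longrightarrow> elts x \<subseteq> T) \<Longrightarrow> vset T \<in> ON"
  by (auto simp: ON_def elts_vset transitive_set_def)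

lemma ON_elts: "\<alpha> \<in> ON \<Longrightarrow> \<beta> \<in> elts \<alpha> \<Longrightarrow> \<beta> \<in> ON"
  unfolding ON_def transitive_set_def by blast

lemma ON_trans: "\<alpha> \<in> ON \<Longrightarrow> \<beta> \<in> elts \<alpha> \<Longrightarrow> \<gamma> \<in> elts \<beta> \<Longrightarrow> \<gamma> \<in> elts \<alpha>"
  unfolding ON_def transitive_set_def by blast

lemma ON_vsucc: "\<alpha> \<in> ON \<Longrightarrow> vsucc \<alpha> \<in> ON"
  unfolding vsucc_def
  by (rule ON_vset) (auto intro: ON_elts ON_trans small_Un[OF small_singleton small_elts, simplified])

lemma ON_vset_empty: "vset {} \<in> (ON :: 'v::zfc set)"
  by (rule ON_vset) (auto simp: small_empty)

lemma ord_less_vsucc: "\<alpha> \<in> ON \<Longrightarrow> ord_less \<alpha> (vsucc \<alpha>)"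
  by (simp add: ord_less_def ON_vsucc)

lemma ord_le_ON: "ord_le \<alpha> \<beta> \<Longrightarrow> \<alpha> \<in> ON" "ord_le \<alpha> \<beta> \<Longrightarrow> \<beta> \<in> ON"
  by (auto simp: ord_le_def)

lemma ord_less_ON: "ord_less \<alpha> \<beta> \<Longrightarrow> \<alpha> \<in> ON" "ord_less \<alpha> \<beta> \<Longrightarrow> \<beta> \<in> ON"
  by (auto simp: ord_less_def)

lemma ord_le_refl: "\<alpha> \<in> ON \<Longrightarrow> ord_le \<alpha> \<alpha>"
  by (simp add: ord_le_def)

lemma ord_le_trans: "ord_le \<alpha> \<beta> \<Longrightarrow> ord_le \<beta> \<gamma> \<Longrightarrow> ord_le \<alpha> \<gamma>"
  unfolding ord_le_def by (metis ON_trans)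

lemma ord_less_imp_le: "ord_less \<alpha> \<beta> \<Longrightarrow> ord_le \<alpha> \<beta>"
  by (simp add: ord_le_def ord_less_def)

lemma ord_le_less_trans: "ord_le \<alpha> \<beta> \<Longrightarrow> ord_less \<beta> \<gamma> \<Longrightarrow> ord_less \<alpha> \<gamma>"
  unfolding ord_le_def ord_less_def by (metis ON_trans)

text \<open>\<open>vset {}\<close> is the ordinal zero. Membership induction: a non-empty ordinal
  has a member, and zero already lies below that member.\<close>

lemma vset_empty_le: "\<beta> \<in> ON \<Longrightarrow> ord_le (vset {}) \<beta>"
proof -
  have "\<beta> \<in> ON \<longrightarrow> ord_le (vset {}) \<beta>"
  proof (induction \<beta> rule: wf_induct_rule[OF foundation])
    case (1 \<beta>)
    show ?case
    proof (cases "elts \<beta> = {}")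
      case True
      then have "\<beta> = vset {}" by (intro extensionality) (simp add: elts_vset small_empty)
      then show ?thesis by (simp add: ord_le_def)
    next
      case False
      then obtain \<gamma> where \<gamma>: "\<gamma> \<in> elts \<beta>" by blast
      show ?thesis
      proof
        assume \<beta>: "\<beta> \<in> ON"
        have "ord_le \<gamma> \<beta>" using \<gamma> \<beta> ON_elts by (auto simp: ord_le_def)
        moreover have "ord_le (vset {}) \<gamma>" using 1 \<gamma> ON_elts[OF \<beta> \<gamma>] by blast
        ultimately show "ord_le (vset {}) \<beta>" using ord_le_trans by blast
      qed
    qed
  qed
  then show "\<beta> \<in> ON \<Longrightarrow> ord_le (vset {}) \<beta>" by blast
qed

text \<open>Induction on \<alpha> and inside it on \<beta>: if the two were incomparable, both
  induction hypotheses together with transitivity would give them the same members.\<close>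

lemma ord_linear: "\<alpha> \<in> ON \<Longrightarrow> \<beta> \<in> ON \<Longrightarrow> ord_less \<alpha> \<beta> \<or> \<alpha> = \<beta> \<or> ord_less \<beta> \<alpha>"
proof -
  have "\<forall>\<beta>. \<alpha> \<in> ON \<longrightarrow> \<beta> \<in> ON \<longrightarrow> \<alpha> \<in> elts \<beta> \<or> \<alpha> = \<beta> \<or> \<beta> \<in> elts \<alpha>"
  proof (induction \<alpha> rule: wf_induct_rule[OF foundation])
    case (1 \<alpha>)
    show ?case
    proof
      fix \<beta>
      show "\<alpha> \<in> ON \<longrightarrow> \<beta> \<in> ON \<longrightarrow> \<alpha> \<in> elts \<beta> \<or> \<alpha> = \<beta> \<or> \<beta> \<in> elts \<alpha>"
      proof (induction \<beta> rule: wf_induct_rule[OF foundation])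
        case inner: (1 \<beta>)
        show ?case
        proof (intro impI, rule ccontr)
          assume ON: "\<alpha> \<in> ON" "\<beta> \<in> ON" and neg: "\<not> (\<alpha> \<in> elts \<beta> \<or> \<alpha> = \<beta> \<or> \<beta> \<in> elts \<alpha>)"
          have "elts \<alpha> \<subseteq> elts \<beta>"
          proof
            fix x assume x: "x \<in> elts \<alpha>"
            then have "x \<in> elts \<beta> \<or> x = \<beta> \<or> \<beta> \<in> elts x" using 1 ON ON_elts by blast
            then show "x \<in> elts \<beta>" using neg x ON_trans[OF ON(1) x] by blast
          qed
          moreover have "elts \<beta> \<subseteq> elts \<alpha>"
          proof
            fix x assume x: "x \<in> elts \<beta>"
            then have "\<alpha> \<in> elts x \<or> \<alpha> = x \<or> x \<in> elts \<alpha>" using inner ON ON_elts by blast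
            then show "x \<in> elts \<alpha>" using neg x ON_trans[OF ON(2) x] by blast
          qed
          ultimately show False using extensionality neg by blast
        qed
      qed
    qed
  qed
  then show "\<alpha> \<in> ON \<Longrightarrow> \<beta> \<in> ON \<Longrightarrow> ord_less \<alpha> \<beta> \<or> \<alpha> = \<beta> \<or> ord_less \<beta> \<alpha>"
    by (auto simp: ord_less_def)
qed

text \<open>Burali-Forti: a set of all ordinals would be an ordinal, hence a member of
  itself.\<close>

lemma not_small_ON: "\<not> small (ON :: 'v::zfc set)"
proof
  assume s: "small (ON :: 'v set)"
  have "vset ON \<in> (ON :: 'v set)" by (rule ON_vset[OF _ s]) (auto intro: ON_elts)
  then have "vset ON \<in> elts (vset ON :: 'v)" by (simp add: elts_vset[OF s])
  then show False by (simp add: not_in_elts_self)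
qed

text \<open>The union of the successors is an ordinal, and it is small by replacement. The common
  stages used later, for grounding a colimit and for stabilising a family of subsets, come from this
  bound.\<close>

lemma ord_strict_upper_bound:
  assumes "small T" "T \<subseteq> ON"
  shows "\<exists>\<delta>\<in>ON. \<forall>\<alpha>\<in>T. ord_less \<alpha> \<delta>"
proof -
  let ?D = "\<Union>\<alpha>\<in>T. elts (vsucc \<alpha>)"
  have s: "small ?D" by (rule small_UN[OF assms(1)]) (rule small_elts)
  have "vset ?D \<in> ON" by (rule ON_vset[OF _ s]) (use assms in \<open>auto intro: ON_elts ON_trans\<close>)
  moreover have "\<forall>\<alpha>\<in>T. ord_less \<alpha> (vset ?D)"
    using calculation assms(2) by (auto simp: ord_less_def elts_vset[OF s] simp del: elts_vsucc) auto
  ultimately show ?thesis by blast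
qed

text \<open>The iterated successors of the empty element of an inductive set stay in that set, and
  they are distinct because each belongs to all later ones. This turns unions over
  \<open>nat\<close> into unions over a set.\<close>

lemma small_range_nat: "\<exists>\<nu> :: nat \<Rightarrow> 'v::zfc. inj \<nu> \<and> small (range \<nu>)"
proof -
  obtain x :: 'v where inf: "(\<exists>e\<in>elts x. elts e = {}) \<and>
      (\<forall>y\<in>elts x. \<exists>z\<in>elts x. elts z = insert y (elts y))"
    using infinity by (rule exE)
  then obtain e where e: "e \<in> elts x" "elts e = {}" by (elim conjE bexE)
  have x: "\<exists>z\<in>elts x. elts z = insert y (elts y)" if "y \<in> elts x" for y
    using conjunct2[OF inf] that by (rule bspec)
  define \<nu> :: "nat \<Rightarrow> 'v" where "\<nu> n = (vsucc ^^ n) e" for n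
  have "\<nu> n \<in> elts x" for n
  proof (induction n)
    case (Suc n)
    then obtain z where "z \<in> elts x" "elts z = elts (\<nu> (Suc n))" using x \<nu>_def by fastforce
    then show ?case using extensionality by metis
  qed (simp add: \<nu>_def e)
  then have "small (range \<nu>)" by (intro small_subset[OF small_elts[of x]]) blast
  moreover have less: "m < n \<Longrightarrow> \<nu> m \<in> elts (\<nu> n)" for m n
    by (induction n) (auto simp: \<nu>_def less_Suc_eq)
  have "inj \<nu>" by (rule injI) (metis less linorder_neqE_nat not_in_elts_self)
  ultimately show ?thesis by blast
qed

lemma small_UN_nat:
  fixes A :: "nat \<Rightarrow> 'v::zfc set"
  assumes "\<And>n. small (A n)"
  shows "small (\<Union>n. A n)"
proof -
  obtain \<nu> :: "nat \<Rightarrow> 'v" where \<nu>: "inj \<nu>" "small (range \<nu>)" using small_range_nat by blast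
  have "small (\<Union>x\<in>range \<nu>. A (inv_into UNIV \<nu> x))" by (rule small_UN[OF \<nu>(2)]) (rule assms)
  then show ?thesis using \<nu>(1) by simp
qed

subsection \<open>Encoding lists as sets\<close>

text \<open>Kuratowski's ordered pair.\<close>

definition vpair :: "'v::zfc \<Rightarrow> 'v \<Rightarrow> 'v" where
  "vpair x y = vset {vset {x, x}, vset {x, y}}"

lemma vpair_inject [simp]:
  fixes x y x' y' :: "'v::zfc"
  shows "vpair x y = vpair x' y' \<longleftrightarrow> x = x' \<and> y = y'"
proof -
  have e: "elts (vset {a, b}) = {a, b}" for a b :: 'v by (rule elts_vset[OF small_doubleton])
  have v: "vset {a, b} = vset {c, d} \<longleftrightarrow> {a, b} = {c, d}" for a b c d :: 'v using e by metis
  show ?thesis unfolding vpair_def v doubleton_eq_iff by blast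
qed

lemma vpair_neq_empty: "vpair x y \<noteq> vset {}"
  unfolding vpair_def by (metis elts_vset small_doubleton small_empty insert_not_empty)

text \<open>Carriers of chains consist of elements of the universe, whereas the words from which
  colimits are built are HOL lists; the code brings them back into the universe.\<close>

fun encode :: "('v::zfc \<times> 'v) list \<Rightarrow> 'v" where
  "encode [] = vset {}"
| "encode ((i, x) # w) = vpair (vpair i x) (encode w)"

lemma inj_encode: "inj encode"
proof (rule injI)
  fix w v :: "('v::zfc \<times> 'v) list"
  show "encode w = encode v \<Longrightarrow> w = v"
  proof (induction w arbitrary: v rule: encode.induct)
    case 1
    then show ?case using vpair_neq_empty by (cases v rule: encode.cases) (auto dest: sym)
  next
    case 2
    then show ?case using vpair_neq_empty by (cases v rule: encode.cases) auto
  qed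
qed

text \<open>By length: a word of length n + 1 is a head pair over S followed by a word of length n,
  so replacement and unions settle each length and a countable union all of them.\<close>

lemma small_encode_lists:
  assumes "small S"
  shows "small (encode ` {w. \<forall>(i, x)\<in>set w. i \<in> S \<and> x \<in> S})"
proof -
  let ?A = "\<lambda>n. encode ` {w. length w = n \<and> (\<forall>(i, x)\<in>set w. i \<in> S \<and> x \<in> S)}"
  have "small (?A n)" for n
  proof (induction n)
    case 0
    have "?A 0 \<subseteq> {vset {}}" by auto
    then show ?case using small_singleton small_subset by blast
  next
    case (Suc n)
    have "?A (Suc n) \<subseteq> (\<Union>i\<in>S. \<Union>x\<in>S. vpair (vpair i x) ` ?A n)"
    proof
      fix y assume "y \<in> ?A (Suc n)"
      then obtain i x w where "y = encode ((i, x) # w)" "length w = n" "i \<in> S" "x \<in> S"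
        "\<forall>(i, x)\<in>set w. i \<in> S \<and> x \<in> S"
        by (auto simp: length_Suc_conv)
      then show "y \<in> (\<Union>i\<in>S. \<Union>x\<in>S. vpair (vpair i x) ` ?A n)" by auto
    qed
    moreover have "small (\<Union>i\<in>S. \<Union>x\<in>S. vpair (vpair i x) ` ?A n)"
      by (intro small_UN assms small_image Suc)
    ultimately show ?case using small_subset by blast
  qed
  then have "small (\<Union>n. ?A n)" by (rule small_UN_nat)
  then show ?thesis by (rule small_subset) auto
qed

section \<open>Modules\<close>

lemma (in abelian_group) minus_zero_imp_eq:
  assumes "x \<in> carrier G" "y \<in> carrier G" "x \<ominus> y = \<zero>"
  shows "x = y"
proof -
  have "\<ominus> (\<ominus> y) = x" by (rule minus_equality) (use assms in \<open>auto simp: minus_eq\<close>)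
  then show ?thesis using assms(2) by simp
qed

text \<open>Negatives are multiples by -1, so closure under them is derived.\<close>

lemma (in module) submoduleI':
  assumes "H \<subseteq> carrier M" "\<zero>\<^bsub>M\<^esub> \<in> H"
    and "\<And>x y. x \<in> H \<Longrightarrow> y \<in> H \<Longrightarrow> x \<oplus>\<^bsub>M\<^esub> y \<in> H"
    and "\<And>a x. a \<in> carrier R \<Longrightarrow> x \<in> H \<Longrightarrow> a \<odot>\<^bsub>M\<^esub> x \<in> H"
  shows "submodule H R M"
proof (rule submoduleI[OF assms(1,2) _ assms(3,4)])
  fix x assume "x \<in> H"
  moreover have "(\<ominus> \<one>) \<odot>\<^bsub>M\<^esub> x = \<ominus>\<^bsub>M\<^esub> x"
    using calculation assms(1) smult_l_minus[of \<one> x] by auto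
  ultimately show "\<ominus>\<^bsub>M\<^esub> x \<in> H" using assms(4) by (metis R.a_inv_closed R.one_closed)
qed

lemma submoduleD:
  assumes "submodule H R M"
  shows "H \<subseteq> carrier M" "\<zero>\<^bsub>M\<^esub> \<in> H"
    "x \<in> H \<Longrightarrow> y \<in> H \<Longrightarrow> x \<oplus>\<^bsub>M\<^esub> y \<in> H"
    "a \<in> carrier R \<Longrightarrow> x \<in> H \<Longrightarrow> a \<odot>\<^bsub>M\<^esub> x \<in> H"
  using submodule.axioms(1)[OF assms] submodule.smult_closed[OF assms] unfolding subgroup_def by auto

lemma (in module) submodule_carrier: "submodule (carrier M) R M"
  by (rule submoduleI') auto

lemma (in module) module_submodule:
  assumes "submodule H R M"
  shows "module R (M\<lparr>carrier := H\<rparr>)"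
proof -
  note H = submoduleD[OF assms]
  have cl: "x \<in> H \<Longrightarrow> x \<in> carrier M" for x using H(1) by blast
  have "x \<in> H \<Longrightarrow> \<ominus>\<^bsub>M\<^esub> x \<in> H" for x by (rule submoduleE(3)[OF assms])
  moreover have "x \<in> H \<Longrightarrow> \<ominus>\<^bsub>M\<^esub> x \<oplus>\<^bsub>M\<^esub> x = \<zero>\<^bsub>M\<^esub>" for x by (simp add: cl M.l_neg)
  ultimately have inv: "x \<in> H \<Longrightarrow> \<exists>y\<in>H. y \<oplus>\<^bsub>M\<^esub> x = \<zero>\<^bsub>M\<^esub>" for x by blast
  have "abelian_group (M\<lparr>carrier := H\<rparr>)"
  proof (rule abelian_groupI)
    show "\<exists>y\<in>carrier (M\<lparr>carrier := H\<rparr>). y \<oplus>\<^bsub>M\<lparr>carrier := H\<rparr>\<^esub> x = \<zero>\<^bsub>M\<lparr>carrier := H\<rparr>\<^esub>"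
      if "x \<in> carrier (M\<lparr>carrier := H\<rparr>)" for x using inv that by simp
  qed (auto simp: H cl M.a_ac)
  then show ?thesis
    by (intro moduleI R.is_cring)
       (auto simp: H cl smult_l_distr smult_r_distr smult_assoc1)
qed

lemma (in module) submodule_of_submodule:
  assumes "submodule H R M" "submodule K R (M\<lparr>carrier := H\<rparr>)"
  shows "submodule K R M" "K \<subseteq> H"
  using submoduleD[OF assms(1)] submoduleD[OF assms(2)] by (auto intro!: submoduleI')

lemma linear_span_superset: "A \<subseteq> linear_span R M A"
  unfolding linear_span_def by (rule hull_subset)

lemma linear_span_minimal: "submodule H R M \<Longrightarrow> A \<subseteq> H \<Longrightarrow> linear_span R M A \<subseteq> H"
  unfolding linear_span_def by (rule hull_minimal)

lemma linear_span_mono: "A \<subseteq> B \<Longrightarrow> linear_span R M A \<subseteq> linear_span R M B"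
  unfolding linear_span_def by (rule hull_mono)

lemma submodule_linear_span:
  assumes "module R M" "A \<subseteq> carrier M"
  shows "submodule (linear_span R M A) R M"
proof -
  interpret module R M by fact
  have le: "linear_span R M A \<subseteq> carrier M"
    by (rule linear_span_minimal[OF submodule_carrier assms(2)])
  show ?thesis
    by (rule submoduleI'[OF le]) (unfold linear_span_def hull_def, auto intro: submoduleD)
qed

text \<open>The vectors c x + s make up a submodule that contains \<open>x\<close> and
  \<open>A\<close>. Splitting off the coefficient of a single generator is the step that elimination
  in subchains repeats.\<close>

lemma linear_span_insert:
  fixes R (structure)
  assumes "module R M" "x \<in> carrier M" "A \<subseteq> carrier M" "z \<in> linear_span R M (insert x A)"
  shows "\<exists>c\<in>carrier R. \<exists>s\<in>linear_span R M A. z = c \<odot>\<^bsub>M\<^esub> x \<oplus>\<^bsub>M\<^esub> s"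
proof -
  interpret module R M by fact
  note S = submoduleD[OF submodule_linear_span[OF assms(1,3)]]
  have cl: "s \<in> linear_span R M A \<Longrightarrow> s \<in> carrier M" for s using S(1) by blast
  let ?H = "{z. \<exists>c\<in>carrier R. \<exists>s\<in>linear_span R M A. z = c \<odot>\<^bsub>M\<^esub> x \<oplus>\<^bsub>M\<^esub> s}"
  have "submodule ?H R M"
  proof (rule submoduleI')
    show "?H \<subseteq> carrier M" using assms(2) cl by auto
    show "\<zero>\<^bsub>M\<^esub> \<in> ?H" using assms(2) S(2)
      by (auto intro!: bexI[of _ \<zero>] bexI[of _ "\<zero>\<^bsub>M\<^esub>"])
  next
    fix y z assume "y \<in> ?H" "z \<in> ?H"
    then obtain c s d t where h: "c \<in> carrier R" "d \<in> carrier R"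
      "s \<in> linear_span R M A" "t \<in> linear_span R M A"
      "y = c \<odot>\<^bsub>M\<^esub> x \<oplus>\<^bsub>M\<^esub> s" "z = d \<odot>\<^bsub>M\<^esub> x \<oplus>\<^bsub>M\<^esub> t" by blast
    then have "y \<oplus>\<^bsub>M\<^esub> z = (c \<oplus> d) \<odot>\<^bsub>M\<^esub> x \<oplus>\<^bsub>M\<^esub> (s \<oplus>\<^bsub>M\<^esub> t)"
      using assms(2) cl by (simp add: smult_l_distr M.a_ac)
    then show "y \<oplus>\<^bsub>M\<^esub> z \<in> ?H" using h S(3) by blast
  next
    fix a y assume a: "a \<in> carrier R" and "y \<in> ?H"
    then obtain c s where h: "c \<in> carrier R" "s \<in> linear_span R M A" "y = c \<odot>\<^bsub>M\<^esub> x \<oplus>\<^bsub>M\<^esub> s" by blast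
    then have "a \<odot>\<^bsub>M\<^esub> y = (a \<otimes> c) \<odot>\<^bsub>M\<^esub> x \<oplus>\<^bsub>M\<^esub> a \<odot>\<^bsub>M\<^esub> s"
      using assms(2) cl a by (simp add: smult_r_distr smult_assoc1)
    then show "a \<odot>\<^bsub>M\<^esub> y \<in> ?H" using h S(4) a by blast
  qed
  moreover have "insert x A \<subseteq> ?H"
  proof -
    have "x \<in> ?H" using assms(2) S(2) by (auto intro!: bexI[of _ \<one>] bexI[of _ "\<zero>\<^bsub>M\<^esub>"])
    moreover have "A \<subseteq> ?H"
    proof
      fix y assume "y \<in> A"
      then have "y \<in> linear_span R M A" by (rule subsetD[OF linear_span_superset])
      moreover from this have "y = \<zero> \<odot>\<^bsub>M\<^esub> x \<oplus>\<^bsub>M\<^esub> y" using assms(2) cl[of y] by simp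
      ultimately show "y \<in> ?H" using R.zero_closed by (intro CollectI bexI[of _ \<zero>] bexI[of _ y])
    qed
    ultimately show ?thesis by blast
  qed
  ultimately have "linear_span R M (insert x A) \<subseteq> ?H" by (rule linear_span_minimal)
  then show ?thesis using assms(4) by blast
qed

lemma linear_mapsI:
  assumes "\<And>x. x \<in> carrier M \<Longrightarrow> f x \<in> carrier N"
    and "\<And>x y. x \<in> carrier M \<Longrightarrow> y \<in> carrier M \<Longrightarrow> f (x \<oplus>\<^bsub>M\<^esub> y) = f x \<oplus>\<^bsub>N\<^esub> f y"
    and "\<And>a x. a \<in> carrier R \<Longrightarrow> x \<in> carrier M \<Longrightarrow> f (a \<odot>\<^bsub>M\<^esub> x) = a \<odot>\<^bsub>N\<^esub> f x"
  shows "f \<in> linear_maps R M N"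
  using assms by (auto simp: linear_maps_def hom_def)

lemma linear_mapsD:
  assumes "f \<in> linear_maps R M N"
  shows "x \<in> carrier M \<Longrightarrow> f x \<in> carrier N"
    "x \<in> carrier M \<Longrightarrow> y \<in> carrier M \<Longrightarrow> f (x \<oplus>\<^bsub>M\<^esub> y) = f x \<oplus>\<^bsub>N\<^esub> f y"
    "a \<in> carrier R \<Longrightarrow> x \<in> carrier M \<Longrightarrow> f (a \<odot>\<^bsub>M\<^esub> x) = a \<odot>\<^bsub>N\<^esub> f x"
  using assms by (auto simp: linear_maps_def hom_def)

lemma additive_zero:
  assumes "abelian_group M" "abelian_group N"
    and "\<And>x. x \<in> carrier M \<Longrightarrow> f x \<in> carrier N"
    and "\<And>x y. x \<in> carrier M \<Longrightarrow> y \<in> carrier M \<Longrightarrow> f (x \<oplus>\<^bsub>M\<^esub> y) = f x \<oplus>\<^bsub>N\<^esub> f y"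
  shows "f \<zero>\<^bsub>M\<^esub> = \<zero>\<^bsub>N\<^esub>"
proof -
  interpret M: abelian_group M by fact
  interpret N: abelian_group N by fact
  have "f \<zero>\<^bsub>M\<^esub> \<oplus>\<^bsub>N\<^esub> f \<zero>\<^bsub>M\<^esub> = f \<zero>\<^bsub>M\<^esub>" using assms(4)[of "\<zero>\<^bsub>M\<^esub>" "\<zero>\<^bsub>M\<^esub>"] by simp
  then show ?thesis using assms(3)[OF M.zero_closed] by (metis N.add.r_cancel_one)
qed

section \<open>Chains and chain maps\<close>

abbreviation car where "car V \<alpha> \<equiv> carrier (vsp V \<alpha>)"

definition subchain :: "'v chain \<Rightarrow> ('v \<Rightarrow> 'v set) \<Rightarrow> 'v chain" where
  "subchain V H = V\<lparr>vsp := \<lambda>\<alpha>. (vsp V \<alpha>)\<lparr>carrier := H \<alpha>\<rparr>\<rparr>"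

text \<open>\<open>\<phi>\<close> may be arbitrary off the carriers; the restrictions put in the
  \<open>undefined\<close> values by which \<open>chain_maps\<close> makes equality of maps
  pointwise.\<close>

definition mk_map :: "'v::zfc chain \<Rightarrow> 'v chain \<Rightarrow> ('v \<Rightarrow> 'v \<Rightarrow> 'v) \<Rightarrow> 'v chain_map" where
  "mk_map V W \<phi> = \<lparr>src = V, tgt = W, component = (\<lambda>\<alpha>\<in>ON. \<lambda>x\<in>car V \<alpha>. \<phi> \<alpha> x)\<rparr>"

lemma component_mk_map [simp]:
  "\<alpha> \<in> ON \<Longrightarrow> x \<in> car V \<alpha> \<Longrightarrow> component (mk_map V W \<phi>) \<alpha> x = \<phi> \<alpha> x"
  by (simp add: mk_map_def)

locale tower =
  fixes k :: "'v::zfc tower"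
  assumes field_tower: "field_tower k"
begin

abbreviation grounded_category (\<open>\<C>\<close>) where "\<C> \<equiv> grounded_chains k"

abbreviation maps where "maps \<equiv> chain_maps k"

abbreviation comp (infixl \<open>\<circ>\<^sub>c\<close> 70) where "g \<circ>\<^sub>c f \<equiv> Comp \<C> g f"

abbreviation grchain where "grchain V \<equiv> is_chain k V \<and> grounded k V"

lemma fld_field: "\<alpha> \<in> ON \<Longrightarrow> field (fld k \<alpha>)"
  and small_fld: "\<alpha> \<in> ON \<Longrightarrow> small (carrier (fld k \<alpha>))"
  and emb_hom: "ord_le \<alpha> \<beta> \<Longrightarrow> emb k \<beta> \<alpha> \<in> ring_hom (fld k \<alpha>) (fld k \<beta>)"
  and emb_id: "\<alpha> \<in> ON \<Longrightarrow> a \<in> carrier (fld k \<alpha>) \<Longrightarrow> emb k \<alpha> \<alpha> a = a"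
  and emb_emb: "ord_le \<alpha> \<beta> \<Longrightarrow> ord_le \<beta> \<gamma> \<Longrightarrow> a \<in> carrier (fld k \<alpha>) \<Longrightarrow>
    emb k \<gamma> \<beta> (emb k \<beta> \<alpha> a) = emb k \<gamma> \<alpha> a"
  and infinite_degree: "ord_less \<alpha> \<beta> \<Longrightarrow> \<not> ring.finite_dimension (fld k \<beta>)
    (emb k \<beta> \<alpha> ` carrier (fld k \<alpha>)) (carrier (fld k \<beta>))"
  using field_tower unfolding field_tower_def by blast+

lemma fld_cring: "\<alpha> \<in> ON \<Longrightarrow> cring (fld k \<alpha>)"
  using fld_field by (simp add: field_def domain_def)

lemma emb_closed: "ord_le \<alpha> \<beta> \<Longrightarrow> a \<in> carrier (fld k \<alpha>) \<Longrightarrow> emb k \<beta> \<alpha> a \<in> carrier (fld k \<beta>)"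
  using emb_hom ring_hom_closed by metis

lemma chain_module: "is_chain k V \<Longrightarrow> \<alpha> \<in> ON \<Longrightarrow> module (fld k \<alpha>) (vsp V \<alpha>)"
  and chain_small: "is_chain k V \<Longrightarrow> \<alpha> \<in> ON \<Longrightarrow> small (car V \<alpha>)"
  and tmap_linear: "is_chain k V \<Longrightarrow> ord_le \<alpha> \<beta> \<Longrightarrow> tmap V \<beta> \<alpha> \<in>
    linear_maps (fld k \<alpha>) (vsp V \<alpha>) (restrict_scalars (emb k \<beta> \<alpha>) (vsp V \<beta>))"
  and tmap_id: "is_chain k V \<Longrightarrow> \<alpha> \<in> ON \<Longrightarrow> x \<in> car V \<alpha> \<Longrightarrow> tmap V \<alpha> \<alpha> x = x"
  and tmap_tmap: "is_chain k V \<Longrightarrow> ord_le \<alpha> \<beta> \<Longrightarrow> ord_le \<beta> \<gamma> \<Longrightarrow> x \<in> car V \<alpha> \<Longrightarrow>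
    tmap V \<gamma> \<beta> (tmap V \<beta> \<alpha> x) = tmap V \<gamma> \<alpha> x"
  unfolding is_chain_def by blast+

lemma chain_abelian_group: "is_chain k V \<Longrightarrow> \<alpha> \<in> ON \<Longrightarrow> abelian_group (vsp V \<alpha>)"
  using chain_module by (simp add: module_def)

lemma is_chainI:
  assumes "\<And>\<alpha>. \<alpha> \<in> ON \<Longrightarrow> module (fld k \<alpha>) (vsp V \<alpha>)"
    and "\<And>\<alpha>. \<alpha> \<in> ON \<Longrightarrow> small (car V \<alpha>)"
    and "\<And>\<alpha> \<beta> x. ord_le \<alpha> \<beta> \<Longrightarrow> x \<in> car V \<alpha> \<Longrightarrow> tmap V \<beta> \<alpha> x \<in> car V \<beta>"
    and "\<And>\<alpha> \<beta> x y. ord_le \<alpha> \<beta> \<Longrightarrow> x \<in> car V \<alpha> \<Longrightarrow> y \<in> car V \<alpha> \<Longrightarrow>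
      tmap V \<beta> \<alpha> (x \<oplus>\<^bsub>vsp V \<alpha>\<^esub> y) = tmap V \<beta> \<alpha> x \<oplus>\<^bsub>vsp V \<beta>\<^esub> tmap V \<beta> \<alpha> y"
    and "\<And>\<alpha> \<beta> a x. ord_le \<alpha> \<beta> \<Longrightarrow> a \<in> carrier (fld k \<alpha>) \<Longrightarrow> x \<in> car V \<alpha> \<Longrightarrow>
      tmap V \<beta> \<alpha> (a \<odot>\<^bsub>vsp V \<alpha>\<^esub> x) = emb k \<beta> \<alpha> a \<odot>\<^bsub>vsp V \<beta>\<^esub> tmap V \<beta> \<alpha> x"
    and "\<And>\<alpha> x. \<alpha> \<in> ON \<Longrightarrow> x \<in> car V \<alpha> \<Longrightarrow> tmap V \<alpha> \<alpha> x = x"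
    and "\<And>\<alpha> \<beta> \<gamma> x. ord_le \<alpha> \<beta> \<Longrightarrow> ord_le \<beta> \<gamma> \<Longrightarrow> x \<in> car V \<alpha> \<Longrightarrow>
      tmap V \<gamma> \<beta> (tmap V \<beta> \<alpha> x) = tmap V \<gamma> \<alpha> x"
  shows "is_chain k V"
  unfolding is_chain_def by (intro conjI allI impI ballI linear_mapsI) (auto simp: assms restrict_scalars_def)

lemma tmap_closed: "is_chain k V \<Longrightarrow> ord_le \<alpha> \<beta> \<Longrightarrow> x \<in> car V \<alpha> \<Longrightarrow>
    tmap V \<beta> \<alpha> x \<in> car V \<beta>"
  and tmap_add: "is_chain k V \<Longrightarrow> ord_le \<alpha> \<beta> \<Longrightarrow> x \<in> car V \<alpha> \<Longrightarrow> y \<in> car V \<alpha> \<Longrightarrow>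
    tmap V \<beta> \<alpha> (x \<oplus>\<^bsub>vsp V \<alpha>\<^esub> y) = tmap V \<beta> \<alpha> x \<oplus>\<^bsub>vsp V \<beta>\<^esub> tmap V \<beta> \<alpha> y"
  and tmap_smult: "is_chain k V \<Longrightarrow> ord_le \<alpha> \<beta> \<Longrightarrow> a \<in> carrier (fld k \<alpha>) \<Longrightarrow> x \<in> car V \<alpha> \<Longrightarrow>
    tmap V \<beta> \<alpha> (a \<odot>\<^bsub>vsp V \<alpha>\<^esub> x) = emb k \<beta> \<alpha> a \<odot>\<^bsub>vsp V \<beta>\<^esub> tmap V \<beta> \<alpha> x"
  using linear_mapsD[OF tmap_linear] by (auto simp: restrict_scalars_def)

lemma tmap_zero: "is_chain k V \<Longrightarrow> ord_le \<alpha> \<beta> \<Longrightarrow> tmap V \<beta> \<alpha> \<zero>\<^bsub>vsp V \<alpha>\<^esub> = \<zero>\<^bsub>vsp V \<beta>\<^esub>"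
  by (rule additive_zero[of "vsp V \<alpha>" "vsp V \<beta>"])
     (auto simp: chain_abelian_group tmap_closed tmap_add ord_le_ON)

lemma cm_linear: "f \<in> maps V W \<Longrightarrow> \<alpha> \<in> ON \<Longrightarrow>
    component f \<alpha> \<in> linear_maps (fld k \<alpha>) (vsp V \<alpha>) (vsp W \<alpha>)"
  and cm_tmap: "f \<in> maps V W \<Longrightarrow> ord_le \<alpha> \<beta> \<Longrightarrow> x \<in> car V \<alpha> \<Longrightarrow>
    component f \<beta> (tmap V \<beta> \<alpha> x) = tmap W \<beta> \<alpha> (component f \<alpha> x)"
  and cm_src: "f \<in> maps V W \<Longrightarrow> src f = V"
  and cm_tgt: "f \<in> maps V W \<Longrightarrow> tgt f = W"
  unfolding chain_maps_def by blast+

lemma cm_closed: "f \<in> maps V W \<Longrightarrow> \<alpha> \<in> ON \<Longrightarrow> x \<in> car V \<alpha> \<Longrightarrow>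
    component f \<alpha> x \<in> car W \<alpha>"
  and cm_add: "f \<in> maps V W \<Longrightarrow> \<alpha> \<in> ON \<Longrightarrow> x \<in> car V \<alpha> \<Longrightarrow> y \<in> car V \<alpha> \<Longrightarrow>
    component f \<alpha> (x \<oplus>\<^bsub>vsp V \<alpha>\<^esub> y) = component f \<alpha> x \<oplus>\<^bsub>vsp W \<alpha>\<^esub> component f \<alpha> y"
  and cm_smult: "f \<in> maps V W \<Longrightarrow> \<alpha> \<in> ON \<Longrightarrow> a \<in> carrier (fld k \<alpha>) \<Longrightarrow> x \<in> car V \<alpha> \<Longrightarrow>
    component f \<alpha> (a \<odot>\<^bsub>vsp V \<alpha>\<^esub> x) = a \<odot>\<^bsub>vsp W \<alpha>\<^esub> component f \<alpha> x"
  using linear_mapsD[OF cm_linear] by auto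

lemma cm_zero:
  assumes "f \<in> maps V W" "is_chain k V" "is_chain k W" "\<alpha> \<in> ON"
  shows "component f \<alpha> \<zero>\<^bsub>vsp V \<alpha>\<^esub> = \<zero>\<^bsub>vsp W \<alpha>\<^esub>"
  by (rule additive_zero[of "vsp V \<alpha>" "vsp W \<alpha>"])
     (use assms in \<open>auto simp: chain_abelian_group cm_closed cm_add\<close>)

lemma cm_eqI:
  assumes "f \<in> maps V W" "g \<in> maps V W"
    and "\<And>\<alpha> x. \<alpha> \<in> ON \<Longrightarrow> x \<in> car V \<alpha> \<Longrightarrow> component f \<alpha> x = component g \<alpha> x"
  shows "f = g"
proof -
  have "component f = component g"
  proof (rule extensionalityI[of _ ON])
    fix \<alpha> :: 'v assume \<alpha>: "\<alpha> \<in> ON"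
    show "component f \<alpha> = component g \<alpha>"
      by (rule extensionalityI[of _ "car V \<alpha>"])
         (use assms \<alpha> in \<open>auto simp: chain_maps_def\<close>)
  qed (use assms in \<open>auto simp: chain_maps_def\<close>)
  then show ?thesis using assms(1,2) by (simp add: chain_maps_def)
qed

lemma mk_map_in:
  assumes "\<And>\<alpha> x. \<alpha> \<in> ON \<Longrightarrow> x \<in> car V \<alpha> \<Longrightarrow> \<phi> \<alpha> x \<in> car W \<alpha>"
    and "\<And>\<alpha> x y. \<alpha> \<in> ON \<Longrightarrow> x \<in> car V \<alpha> \<Longrightarrow> y \<in> car V \<alpha> \<Longrightarrow>
      \<phi> \<alpha> (x \<oplus>\<^bsub>vsp V \<alpha>\<^esub> y) = \<phi> \<alpha> x \<oplus>\<^bsub>vsp W \<alpha>\<^esub> \<phi> \<alpha> y"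
    and "\<And>\<alpha> a x. \<alpha> \<in> ON \<Longrightarrow> a \<in> carrier (fld k \<alpha>) \<Longrightarrow> x \<in> car V \<alpha> \<Longrightarrow>
      \<phi> \<alpha> (a \<odot>\<^bsub>vsp V \<alpha>\<^esub> x) = a \<odot>\<^bsub>vsp W \<alpha>\<^esub> \<phi> \<alpha> x"
    and "\<And>\<alpha> \<beta> x. ord_le \<alpha> \<beta> \<Longrightarrow> x \<in> car V \<alpha> \<Longrightarrow> \<phi> \<beta> (tmap V \<beta> \<alpha> x) = tmap W \<beta> \<alpha> (\<phi> \<alpha> x)"
    and V: "is_chain k V"
  shows "mk_map V W \<phi> \<in> maps V W"
proof -
  have "component (mk_map V W \<phi>) \<alpha> \<in> linear_maps (fld k \<alpha>) (vsp V \<alpha>) (vsp W \<alpha>) \<inter>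
      extensional (car V \<alpha>)" if "\<alpha> \<in> ON" for \<alpha>
  proof -
    interpret module "fld k \<alpha>" "vsp V \<alpha>" using chain_module[OF V that] .
    show ?thesis using that
      by (intro IntI linear_mapsI) (simp_all add: assms(1-3) mk_map_def)
  qed
  then show ?thesis
    unfolding chain_maps_def
    using assms(4) tmap_closed[OF V]
    by (auto simp: mk_map_def ord_le_ON)
qed

lemma Ob_grounded: "Ob \<C> = {V. grchain V}"
  and Hom_grounded: "Hom \<C> = maps"
  and Ident_grounded: "Ident \<C> V = mk_map V V (\<lambda>\<alpha> x. x)"
  by (auto simp: grounded_chains_def full_subcategory_def all_chains_def mk_map_def)

lemma comp_eq_mk_map:
  assumes "f \<in> maps U V" "g \<in> maps V W"
  shows "g \<circ>\<^sub>c f = mk_map U W (\<lambda>\<alpha> x. component g \<alpha> (component f \<alpha> x))"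
  using assms
  by (simp add: grounded_chains_def full_subcategory_def all_chains_def mk_map_def compose_def
      cm_src cm_tgt)

lemma comp_in:
  assumes "f \<in> maps U V" "g \<in> maps V W" "is_chain k U"
  shows "g \<circ>\<^sub>c f \<in> maps U W"
  unfolding comp_eq_mk_map[OF assms(1,2)]
  by (rule mk_map_in)
     (use assms in \<open>auto simp: cm_closed cm_add cm_smult cm_tmap ord_le_ON\<close>)

lemma component_comp:
  assumes "f \<in> maps U V" "\<alpha> \<in> ON" "x \<in> car U \<alpha>"
  shows "component (g \<circ>\<^sub>c f) \<alpha> x = component g \<alpha> (component f \<alpha> x)"
  using assms
  by (simp add: grounded_chains_def full_subcategory_def all_chains_def compose_def cm_src)

lemma Ident_in: "is_chain k V \<Longrightarrow> Ident \<C> V \<in> maps V V"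
  unfolding Ident_grounded by (rule mk_map_in) auto

lemma component_Ident: "\<alpha> \<in> ON \<Longrightarrow> x \<in> car V \<alpha> \<Longrightarrow>
    component (Ident \<C> V) \<alpha> x = x"
  by (simp add: Ident_grounded)

lemma category_grounded_chains: "category \<C>"
proof
  fix A B A' B' f
  assume "f \<in> Hom \<C> A B" "f \<in> Hom \<C> A' B'"
  then show "A = A' \<and> B = B'" using cm_src cm_tgt unfolding Hom_grounded by metis
next
  fix A assume "A \<in> Ob \<C>"
  then show "Ident \<C> A \<in> Hom \<C> A A"
    using Ident_in by (simp add: Hom_grounded Ob_grounded)
next
  fix A B D f g assume "A \<in> Ob \<C>" "B \<in> Ob \<C>"
    "f \<in> Hom \<C> A B" "g \<in> Hom \<C> B D"
  then show "g \<circ>\<^sub>c f \<in> Hom \<C> A D"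
    using comp_in by (simp add: Hom_grounded Ob_grounded)
next
  fix A B f assume "A \<in> Ob \<C>" "B \<in> Ob \<C>"
    "f \<in> Hom \<C> A B"
  then have f: "is_chain k A" "is_chain k B" "f \<in> maps A B"
    by (auto simp: Ob_grounded Hom_grounded)
  show "f \<circ>\<^sub>c Ident \<C> A = f"
    by (rule cm_eqI[OF comp_in[OF Ident_in f(3)] f(3)])
       (use f in \<open>auto simp: component_comp[OF Ident_in] component_Ident\<close>)
  show "Ident \<C> B \<circ>\<^sub>c f = f"
    by (rule cm_eqI[OF comp_in[OF f(3) Ident_in] f(3)])
       (use f in \<open>auto simp: component_comp[OF f(3)] component_Ident cm_closed\<close>)
next
  fix A B D E f g h assume "A \<in> Ob \<C>" "B \<in> Ob \<C>"
    "f \<in> Hom \<C> A B" "g \<in> Hom \<C> B D" "h \<in> Hom \<C> D E"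
  then have f: "is_chain k A" "is_chain k B" "f \<in> maps A B" "g \<in> maps B D" "h \<in> maps D E"
    by (auto simp: Ob_grounded Hom_grounded)
  show "h \<circ>\<^sub>c g \<circ>\<^sub>c f = h \<circ>\<^sub>c (g \<circ>\<^sub>c f)"
    by (rule cm_eqI[of _ A E])
       (use f in \<open>auto intro: comp_in simp: component_comp[OF f(3)] component_comp[OF f(4)]
         component_comp[OF comp_in[OF f(3,4)]] cm_closed\<close>)
qed

text \<open>Scalars of stage \<beta> act on the image through \<open>emb\<close>, so they preserve
  the preimage of a submodule over the larger field. Together with minimality of the span this
  carries span membership along transition maps.\<close>

lemma submodule_tmap_vimage:
  assumes "is_chain k V" "ord_le \<beta> \<gamma>" "submodule H (fld k \<gamma>) (vsp V \<gamma>)"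
  shows "submodule {x \<in> car V \<beta>. tmap V \<gamma> \<beta> x \<in> H} (fld k \<beta>) (vsp V \<beta>)"
proof -
  interpret module "fld k \<beta>" "vsp V \<beta>" using assms chain_module ord_le_ON by blast
  show ?thesis
    by (rule submoduleI')
       (use submoduleD[OF assms(3)] assms in \<open>auto simp: tmap_add tmap_smult tmap_zero emb_closed\<close>)
qed

lemma submodule_cm_vimage:
  assumes "is_chain k V" "is_chain k W" "f \<in> maps V W" "\<beta> \<in> ON"
    "submodule H (fld k \<beta>) (vsp W \<beta>)"
  shows "submodule {x \<in> car V \<beta>. component f \<beta> x \<in> H} (fld k \<beta>) (vsp V \<beta>)"
proof -
  interpret module "fld k \<beta>" "vsp V \<beta>" using assms chain_module by blast
  show ?thesis
    by (rule submoduleI')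
       (use submoduleD[OF assms(5)] assms in \<open>auto simp: cm_add cm_smult cm_zero\<close>)
qed

text \<open>Testing against all submodules that contain the image replaces computations with
  elements of a span. For colimits, such a submodule is pulled back along the coprojections.\<close>

lemma grounded_at_iff:
  assumes "is_chain k V" "\<alpha> \<in> ON"
  shows "grounded_at k \<alpha> V \<longleftrightarrow> (\<forall>\<beta> H. ord_less \<alpha> \<beta> \<longrightarrow> submodule H (fld k \<beta>) (vsp V \<beta>) \<longrightarrow>
    tmap V \<beta> \<alpha> ` car V \<alpha> \<subseteq> H \<longrightarrow> car V \<beta> \<subseteq> H)" (is "?L \<longleftrightarrow> ?R")
proof
  assume L: ?L
  show ?R
  proof (intro allI impI)
    fix \<beta> H assume h: "ord_less \<alpha> \<beta>" "submodule H (fld k \<beta>) (vsp V \<beta>)"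
      "tmap V \<beta> \<alpha> ` car V \<alpha> \<subseteq> H"
    have "car V \<beta> = linear_span (fld k \<beta>) (vsp V \<beta>) (tmap V \<beta> \<alpha> ` car V \<alpha>)"
      using L h(1) unfolding grounded_at_def by blast
    then show "car V \<beta> \<subseteq> H" using linear_span_minimal[OF h(2,3)] by simp
  qed
next
  assume R: ?R
  show ?L unfolding grounded_at_def
  proof (intro allI impI)
    fix \<beta> assume \<beta>: "ord_less \<alpha> \<beta>"
    have m: "module (fld k \<beta>) (vsp V \<beta>)" using chain_module assms(1) ord_less_ON(2)[OF \<beta>] by blast
    have sub: "tmap V \<beta> \<alpha> ` car V \<alpha> \<subseteq> car V \<beta>"
      using tmap_closed[OF assms(1) ord_less_imp_le[OF \<beta>]] by blast
    note S = submodule_linear_span[OF m sub]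
    show "car V \<beta> = linear_span (fld k \<beta>) (vsp V \<beta>) (tmap V \<beta> \<alpha> ` car V \<alpha>)"
    proof
      show "car V \<beta> \<subseteq> linear_span (fld k \<beta>) (vsp V \<beta>) (tmap V \<beta> \<alpha> ` car V \<alpha>)"
        using R[rule_format, OF \<beta> S linear_span_superset] .
    qed (rule submoduleD(1)[OF S])
  qed
qed

text \<open>The image of stage \<alpha> reaches a stage \<gamma> by way of \<beta>, hence lies in
  the image of stage \<beta>. With an upper bound of ordinals, a set of grounded chains gets a
  common grounding stage.\<close>

lemma grounded_at_mono:
  assumes V: "is_chain k V" and g: "grounded_at k \<alpha> V" and le: "ord_le \<alpha> \<beta>"
  shows "grounded_at k \<beta> V"
  unfolding grounded_at_iff[OF V ord_le_ON(2)[OF le]]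
proof (intro allI impI)
  fix \<gamma> H assume h: "ord_less \<beta> \<gamma>" "submodule H (fld k \<gamma>) (vsp V \<gamma>)"
    "tmap V \<gamma> \<beta> ` car V \<beta> \<subseteq> H"
  have "tmap V \<gamma> \<alpha> ` car V \<alpha> \<subseteq> H"
  proof
    fix y assume "y \<in> tmap V \<gamma> \<alpha> ` car V \<alpha>"
    then obtain x where "x \<in> car V \<alpha>" "y = tmap V \<gamma> \<alpha> x" by blast
    then have "y = tmap V \<gamma> \<beta> (tmap V \<beta> \<alpha> x)" "tmap V \<beta> \<alpha> x \<in> car V \<beta>"
      using tmap_tmap[OF V le ord_less_imp_le[OF h(1)]] tmap_closed[OF V le] by auto
    then show "y \<in> H" using h(3) by blast
  qed
  then show "car V \<gamma> \<subseteq> H"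
    using g h ord_le_less_trans[OF le] unfolding grounded_at_iff[OF V ord_le_ON(1)[OF le]] by blast
qed

subsection \<open>Subchains\<close>

lemma vsp_subchain [simp]: "vsp (subchain V H) \<alpha> = (vsp V \<alpha>)\<lparr>carrier := H \<alpha>\<rparr>"
  and tmap_subchain [simp]: "tmap (subchain V H) = tmap V"
  by (auto simp: subchain_def)

definition closed_family :: "'v chain \<Rightarrow> ('v \<Rightarrow> 'v set) \<Rightarrow> bool" where
  "closed_family V H \<longleftrightarrow> (\<forall>\<alpha>\<in>ON. submodule (H \<alpha>) (fld k \<alpha>) (vsp V \<alpha>)) \<and>
     (\<forall>\<alpha> \<beta>. ord_le \<alpha> \<beta> \<longrightarrow> tmap V \<beta> \<alpha> ` H \<alpha> \<subseteq> H \<beta>)"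

lemma closed_familyD:
  assumes "closed_family V H"
  shows "\<alpha> \<in> ON \<Longrightarrow> submodule (H \<alpha>) (fld k \<alpha>) (vsp V \<alpha>)"
    "\<alpha> \<in> ON \<Longrightarrow> x \<in> H \<alpha> \<Longrightarrow> x \<in> car V \<alpha>"
    "ord_le \<alpha> \<beta> \<Longrightarrow> x \<in> H \<alpha> \<Longrightarrow> tmap V \<beta> \<alpha> x \<in> H \<beta>"
  using assms submoduleD(1) unfolding closed_family_def by blast+

lemma is_chain_subchain:
  assumes V: "is_chain k V" and H: "closed_family V H"
  shows "is_chain k (subchain V H)"
  by (rule is_chainI)
     (use V closed_familyD[OF H] in \<open>auto simp: ord_le_ON tmap_add tmap_smult tmap_id tmap_tmap
       intro: module.module_submodule chain_module small_subset[OF chain_small]\<close>)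

lemma inclusion_in:
  assumes V: "is_chain k V" and H: "closed_family V H"
  shows "mk_map (subchain V H) V (\<lambda>\<alpha> x. x) \<in> maps (subchain V H) V"
  by (rule mk_map_in) (use closed_familyD[OF H] is_chain_subchain[OF V H] in auto)

text \<open>
  The members of a well-ordered generating set of \<open>V \<alpha>\<close> that are, at stage \<open>\<beta>\<close>, congruent
  modulo \<open>H \<beta>\<close> to a combination of earlier ones form an increasing family of subsets
  of a set, which therefore stabilises. By elimination, \<open>H\<close> is generated at the stage where it does.
\<close>

lemma grounded_subchain:
  assumes V: "is_chain k V" and g: "grounded k V" and H: "closed_family V H"
  shows "grounded k (subchain V H)"
proof -
  obtain \<alpha> where \<alpha>: "\<alpha> \<in> ON" "grounded_at k \<alpha> V" using g unfolding grounded_def by blast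
  \<comment> \<open>All elements of V at stage \<alpha> serve as generators, ordered by an arbitrary
    well-order of the whole type.\<close>
  obtain r :: "'v rel" where r: "well_order_on UNIV r" using Zorn.well_order_on[of UNIV] by (rule exE)
  define lt where "lt = r - Id"
  have wf: "wf lt" using r unfolding lt_def well_order_on_def by blast
  have lin: "(x, y) \<in> lt \<or> x = y \<or> (y, x) \<in> lt" for x y
    using r unfolding lt_def well_order_on_def linear_order_on_def total_on_def by auto
  have trans: "(x, y) \<in> lt \<Longrightarrow> (y, z) \<in> lt \<Longrightarrow> (x, z) \<in> lt" for x y z
    using r unfolding lt_def well_order_on_def linear_order_on_def partial_order_on_def
      preorder_on_def trans_def antisym_def by blast
  define LT where "LT x = {y \<in> car V \<alpha>. (y, x) \<in> lt}" for x
  define S where "S \<beta> A = linear_span (fld k \<beta>) (vsp V \<beta>) (tmap V \<beta> \<alpha> ` A)" for \<beta> A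
  \<comment> \<open>These are the pivots of Gaussian elimination: the vector h of H is the image of
    x corrected by earlier generators, so x is a possible leading generator at stage
    \<beta>.\<close>
  define P where "P \<beta> = {x \<in> car V \<alpha>. \<exists>h\<in>H \<beta>. \<exists>s\<in>S \<beta> (LT x).
    tmap V \<beta> \<alpha> x = h \<oplus>\<^bsub>vsp V \<beta>\<^esub> s}" for \<beta>
  have S: "submodule (S \<beta> A) (fld k \<beta>) (vsp V \<beta>)" if "ord_le \<alpha> \<beta>" "A \<subseteq> car V \<alpha>" for \<beta> A
    unfolding S_def
    by (rule submodule_linear_span) (use that V in \<open>auto intro: chain_module tmap_closed ord_le_ON\<close>)
  have S_mono: "A \<subseteq> B \<Longrightarrow> S \<beta> A \<subseteq> S \<beta> B" for \<beta> A B
    unfolding S_def by (intro linear_span_mono image_mono)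
  have S_incl: "x \<in> A \<Longrightarrow> tmap V \<beta> \<alpha> x \<in> S \<beta> A" for x \<beta> A
    unfolding S_def by (rule subsetD[OF linear_span_superset]) blast
  have LT_sub: "LT x \<subseteq> car V \<alpha>" for x unfolding LT_def by blast
  \<comment> \<open>The vectors at \<beta> that are sent into \<open>S \<gamma> A\<close> form a
    submodule containing the generators, so no expansion into linear combinations is needed.\<close>
  have S_push: "tmap V \<gamma> \<beta> s \<in> S \<gamma> A"
    if "ord_le \<alpha> \<beta>" "ord_le \<beta> \<gamma>" "A \<subseteq> car V \<alpha>" "s \<in> S \<beta> A" for \<beta> \<gamma> A s
  proof -
    have "S \<beta> A \<subseteq> {x \<in> car V \<beta>. tmap V \<gamma> \<beta> x \<in> S \<gamma> A}"
      unfolding S_def[of \<beta>]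
    proof (rule linear_span_minimal)
      show "submodule {x \<in> car V \<beta>. tmap V \<gamma> \<beta> x \<in> S \<gamma> A} (fld k \<beta>) (vsp V \<beta>)"
        using that V by (intro submodule_tmap_vimage S) (auto intro: ord_le_trans)
      show "tmap V \<beta> \<alpha> ` A \<subseteq> {x \<in> car V \<beta>. tmap V \<gamma> \<beta> x \<in> S \<gamma> A}"
        using that V S_incl[of _ A \<gamma>] by (auto simp: tmap_closed subset_iff tmap_tmap[OF V])
    qed
    then show ?thesis using that by blast
  qed
  have P_mono: "P \<beta> \<subseteq> P \<gamma>" if le: "ord_le \<alpha> \<beta>" "ord_le \<beta> \<gamma>" for \<beta> \<gamma>
  proof
    fix x assume "x \<in> P \<beta>"
    then obtain h s where x: "x \<in> car V \<alpha>" "h \<in> H \<beta>" "s \<in> S \<beta> (LT x)"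
      "tmap V \<beta> \<alpha> x = h \<oplus>\<^bsub>vsp V \<beta>\<^esub> s" unfolding P_def by blast
    have hc: "h \<in> car V \<beta>" "s \<in> car V \<beta>"
      using closed_familyD(2)[OF H] x(2,3) ord_le_ON le submoduleD(1)[OF S[OF le(1) LT_sub]] by blast+
    have "tmap V \<gamma> \<alpha> x = tmap V \<gamma> \<beta> h \<oplus>\<^bsub>vsp V \<gamma>\<^esub> tmap V \<gamma> \<beta> s"
      using tmap_tmap[OF V le x(1)] x(4) tmap_add[OF V le(2) hc] by simp
    then show "x \<in> P \<gamma>"
      using x closed_familyD(3)[OF H le(2) x(2)] S_push[OF le LT_sub x(3)] unfolding P_def by blast
  qed
  \<comment> \<open>A stage at which x belongs to \<open>P\<close>. The x that have one form the set
    \<open>X\<close>, so by replacement these stages form a set, and some \<delta> lies above all of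
    them and above \<alpha>.\<close>
  define b where "b x = (SOME \<beta>. ord_le \<alpha> \<beta> \<and> x \<in> P \<beta>)" for x
  define X where "X = {x \<in> car V \<alpha>. \<exists>\<beta>. ord_le \<alpha> \<beta> \<and> x \<in> P \<beta>}"
  have b: "ord_le \<alpha> (b x) \<and> x \<in> P (b x)" if "x \<in> X" for x
    unfolding b_def by (rule someI_ex) (use that in \<open>simp add: X_def\<close>)
  have "small (insert \<alpha> (b ` X))"
  proof -
    have "small X" by (rule small_subset[OF chain_small[OF V \<alpha>(1)]]) (auto simp: X_def)
    then show ?thesis using small_Un[OF small_singleton small_image, of X \<alpha> b] by simp
  qed
  moreover have "b x \<in> ON" if "x \<in> X" for x using ord_le_ON(2)[OF conjunct1[OF b[OF that]]] .
  then have "insert \<alpha> (b ` X) \<subseteq> ON" using \<alpha>(1) by blast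
  ultimately obtain \<delta> where \<delta>: "\<delta> \<in> ON" "\<And>\<beta>. \<beta> \<in> insert \<alpha> (b ` X) \<Longrightarrow> ord_less \<beta> \<delta>"
    using ord_strict_upper_bound[of "insert \<alpha> (b ` X)"] by auto
  have \<alpha>\<delta>: "ord_le \<alpha> \<delta>" using \<delta>(2) ord_less_imp_le by blast
  have P_stable: "P \<gamma> \<subseteq> P \<delta>" if "ord_le \<alpha> \<gamma>" for \<gamma>
  proof
    fix x assume "x \<in> P \<gamma>"
    then have "x \<in> X" using that unfolding X_def P_def by blast
    then have "ord_le (b x) \<delta>" by (intro ord_less_imp_le \<delta>(2)) simp
    then show "x \<in> P \<delta>" using b[OF \<open>x \<in> X\<close>] P_mono by blast
  qed
  have C: "is_chain k (subchain V H)" by (rule is_chain_subchain[OF V H])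
  have "grounded_at k \<delta> (subchain V H)"
    unfolding grounded_at_iff[OF C \<delta>(1)]
  proof (intro allI impI, simp)
    fix \<gamma> K assume \<gamma>: "ord_less \<delta> \<gamma>" and K0: "submodule K (fld k \<gamma>) ((vsp V \<gamma>)\<lparr>carrier := H \<gamma>\<rparr>)"
      and im: "tmap V \<gamma> \<delta> ` H \<delta> \<subseteq> K"
    have le: "ord_le \<delta> \<gamma>" "ord_le \<alpha> \<gamma>" and \<gamma>ON: "\<gamma> \<in> ON"
      using \<gamma> \<alpha>\<delta> ord_less_imp_le ord_le_trans ord_less_ON by blast+
    interpret M: module "fld k \<gamma>" "vsp V \<gamma>" by (rule chain_module[OF V \<gamma>ON])
    interpret F: field "fld k \<gamma>" by (rule fld_field[OF \<gamma>ON])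
    note HS = closed_familyD(1)[OF H \<gamma>ON]
    note H\<gamma> = submoduleD[OF HS]
    note K = submoduleD[OF M.submodule_of_submodule(1)[OF HS K0]] M.submodule_of_submodule(2)[OF HS K0]
    have Sc: "A \<subseteq> car V \<alpha> \<Longrightarrow> s \<in> S \<gamma> A \<Longrightarrow> s \<in> car V \<gamma>" for s A
      using submoduleD(1)[OF S[OF le(2)]] by blast
    have Hc: "s \<in> H \<gamma> \<Longrightarrow> s \<in> car V \<gamma>" for s using H\<gamma>(1) by blast
    \<comment> \<open>A combination involves finitely many generators, and the largest of them
      bounds it. To avoid finite sums: the vectors bounded by some y in A form a submodule, because
      initial segments are nested. Zero is added separately since A may be empty.\<close>
    have split: "z = \<zero>\<^bsub>vsp V \<gamma>\<^esub> \<or> (\<exists>y\<in>A. z \<in> S \<gamma> (insert y (LT y)))"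
      if A: "A \<subseteq> car V \<alpha>" and z: "z \<in> S \<gamma> A" for A z
    proof -
      let ?Z = "{z. z = \<zero>\<^bsub>vsp V \<gamma>\<^esub> \<or> (\<exists>y\<in>A. z \<in> S \<gamma> (insert y (LT y)))}"
      have LE: "insert y (LT y) \<subseteq> car V \<alpha>" if "y \<in> A" for y using LT_sub that A by blast
      note T = submoduleD[OF S[OF le(2) LE]]
      have dir: "\<exists>w\<in>A. insert y (LT y) \<subseteq> insert w (LT w) \<and> insert y' (LT y') \<subseteq> insert w (LT w)"
        if "y \<in> A" "y' \<in> A" for y y'
      proof -
        have *: "insert y (LT y) \<subseteq> insert w (LT w)" if "(y, w) \<in> lt" "y \<in> A" for y w
          using that A trans unfolding LT_def by blast
        show ?thesis using lin[of y y'] that *[of y y'] *[of y' y] by blast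
      qed
      have "submodule ?Z (fld k \<gamma>) (vsp V \<gamma>)"
      proof (rule M.submoduleI')
        show "?Z \<subseteq> car V \<gamma>" using T(1) by auto
      next
        fix x y assume xy: "x \<in> ?Z" "y \<in> ?Z"
        show "x \<oplus>\<^bsub>vsp V \<gamma>\<^esub> y \<in> ?Z"
        proof (cases "x = \<zero>\<^bsub>vsp V \<gamma>\<^esub> \<or> y = \<zero>\<^bsub>vsp V \<gamma>\<^esub>")
          case True
          have "x \<in> car V \<gamma>" "y \<in> car V \<gamma>" using xy T(1) by auto
          then have "x \<oplus>\<^bsub>vsp V \<gamma>\<^esub> y = x \<or> x \<oplus>\<^bsub>vsp V \<gamma>\<^esub> y = y" using True by auto
          then show ?thesis using xy by (elim disjE) (simp_all only:)
        next
          case False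
          then obtain u u' where u: "u \<in> A" "u' \<in> A" "x \<in> S \<gamma> (insert u (LT u))" "y \<in> S \<gamma> (insert u' (LT u'))"
            using xy by blast
          obtain w where w: "w \<in> A" "insert u (LT u) \<subseteq> insert w (LT w)" "insert u' (LT u') \<subseteq> insert w (LT w)"
            using dir[OF u(1,2)] by (elim bexE conjE)
          have "x \<in> S \<gamma> (insert w (LT w))" "y \<in> S \<gamma> (insert w (LT w))"
            using subsetD[OF S_mono[OF w(2)] u(3)] subsetD[OF S_mono[OF w(3)] u(4)] .
          then show ?thesis using T(3)[OF w(1)] w(1) by blast
        qed
      next
        fix a x assume "a \<in> carrier (fld k \<gamma>)" "x \<in> ?Z"
        then show "a \<odot>\<^bsub>vsp V \<gamma>\<^esub> x \<in> ?Z" using T(4) by auto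
      qed auto
      moreover have "tmap V \<gamma> \<alpha> ` A \<subseteq> ?Z"         using S_incl[of _ "insert _ (LT _)" \<gamma>] by blast
      ultimately have "S \<gamma> A \<subseteq> ?Z" unfolding S_def[of \<gamma> A] by (rule linear_span_minimal)
      then show ?thesis using z by blast
    qed
    \<comment> \<open>Gaussian elimination, by well-founded induction on the bound x: a vector of H
      with leading generator x is reduced by a vector of H from stage \<delta> with the same leading
      generator, and the remainder has an earlier bound.\<close>
    have main: "z \<in> K" if z: "z \<in> H \<gamma>" "z \<in> S \<gamma> (insert x (LT x))" "x \<in> car V \<alpha>" for x z
      using that
    proof (induction x arbitrary: z rule: wf_induct_rule[OF wf])
      case (1 x)
      \<comment> \<open>\<open>split\<close> turns a vector in the span of all generators before x
        into one bounded by a single y before x, where the induction hypothesis applies.\<close>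
      have IH: "z \<in> K" if zH: "z \<in> H \<gamma>" and zS: "z \<in> S \<gamma> (LT x)" for z
      proof (cases "z = \<zero>\<^bsub>vsp V \<gamma>\<^esub>")
        case True
        then show ?thesis using K(2) by simp
      next
        case False
        then obtain y where "y \<in> LT x" "z \<in> S \<gamma> (insert y (LT y))"
          using split[OF LT_sub zS] by blast
        then show ?thesis using 1(1)[of y z] zH unfolding LT_def by blast
      qed
      let ?x = "tmap V \<gamma> \<alpha> x"
      note SL = submoduleD[OF S[OF le(2) LT_sub]]
      have x: "?x \<in> car V \<gamma>" using tmap_closed[OF V le(2) 1(4)] .
      have "tmap V \<gamma> \<alpha> ` LT x \<subseteq> car V \<gamma>" using tmap_closed[OF V le(2)] LT_sub by blast
      then obtain c s where c: "c \<in> carrier (fld k \<gamma>)" "s \<in> S \<gamma> (LT x)" "z = c \<odot>\<^bsub>vsp V \<gamma>\<^esub> ?x \<oplus>\<^bsub>vsp V \<gamma>\<^esub> s"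
        using linear_span_insert[OF M.module_axioms x, of "tmap V \<gamma> \<alpha> ` LT x" z] 1(3)
        unfolding S_def image_insert by blast
      note cl = Hc[OF 1(2)] Sc[OF LT_sub c(2)] x
      show ?case
      proof (cases "c = \<zero>\<^bsub>fld k \<gamma>\<^esub>")
        case True
        then have "z = s" using c(3) cl by simp
        then show ?thesis using IH 1(2) c(2) by blast
      next
        case False
        then have "c \<in> Units (fld k \<gamma>)" using c(1) F.field_Units by blast
        \<comment> \<open>Dividing by the leading coefficient c shows that x is a leading generator
          at stage \<gamma>; by \<open>P_stable\<close> it is one at stage \<delta> already.\<close>
        then obtain d where d: "d \<in> carrier (fld k \<gamma>)" "d \<otimes>\<^bsub>fld k \<gamma>\<^esub> c = \<one>\<^bsub>fld k \<gamma>\<^esub>"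
          using M.R.Units_inv_closed M.R.Units_l_inv by blast
        have dz: "d \<odot>\<^bsub>vsp V \<gamma>\<^esub> z = ?x \<oplus>\<^bsub>vsp V \<gamma>\<^esub> d \<odot>\<^bsub>vsp V \<gamma>\<^esub> s"
          using c d cl by (simp add: M.smult_r_distr flip: M.smult_assoc1)
        have neg: "\<ominus>\<^bsub>vsp V \<gamma>\<^esub> (d \<odot>\<^bsub>vsp V \<gamma>\<^esub> s) \<in> S \<gamma> (LT x)"
          using M.submoduleE(3)[OF S[OF le(2) LT_sub]] SL(4) d c by blast
        have "?x = d \<odot>\<^bsub>vsp V \<gamma>\<^esub> z \<oplus>\<^bsub>vsp V \<gamma>\<^esub> \<ominus>\<^bsub>vsp V \<gamma>\<^esub> (d \<odot>\<^bsub>vsp V \<gamma>\<^esub> s)"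
          unfolding dz using cl d by (simp add: M.M.a_assoc M.M.r_neg)
        moreover have "d \<odot>\<^bsub>vsp V \<gamma>\<^esub> z \<in> H \<gamma>" using H\<gamma>(4) d 1(2) by blast
        ultimately have "x \<in> P \<gamma>" unfolding P_def using neg 1(4) by blast
        then have "x \<in> P \<delta>" using P_stable le by blast
        then obtain h s' where h: "h \<in> H \<delta>" "s' \<in> S \<delta> (LT x)" "tmap V \<delta> \<alpha> x = h \<oplus>\<^bsub>vsp V \<delta>\<^esub> s'"
          unfolding P_def by blast
        let ?h = "tmap V \<gamma> \<delta> h" and ?s = "tmap V \<gamma> \<delta> s'"
        have h': "?h \<in> H \<gamma>" "?h \<in> K" "?s \<in> S \<gamma> (LT x)"
          using closed_familyD(3)[OF H le(1) h(1)] im h(1) S_push[OF \<alpha>\<delta> le(1) LT_sub h(2)] by auto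
        note cl' = Hc[OF h'(1)] Sc[OF LT_sub h'(3)]
        have "h \<in> car V \<delta>" "s' \<in> car V \<delta>"
          using closed_familyD(2)[OF H \<delta>(1) h(1)] submoduleD(1)[OF S[OF \<alpha>\<delta> LT_sub]] h(2) by blast+
        then have xx: "?x = ?h \<oplus>\<^bsub>vsp V \<gamma>\<^esub> ?s"
          using tmap_tmap[OF V \<alpha>\<delta> le(1) 1(4)] tmap_add[OF V le(1)] h(3) by simp
        \<comment> \<open>The remainder of z after subtracting c times the image of h. It lies in H
          because z and h do, and in the span of generators before x; the subtracted multiple lies
          in K because h comes from stage \<delta>.\<close>
        let ?t = "c \<odot>\<^bsub>vsp V \<gamma>\<^esub> ?s \<oplus>\<^bsub>vsp V \<gamma>\<^esub> s"
        have zt: "z = c \<odot>\<^bsub>vsp V \<gamma>\<^esub> ?h \<oplus>\<^bsub>vsp V \<gamma>\<^esub> ?t"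
          unfolding c(3) xx using c(1) cl cl' by (simp add: M.smult_r_distr M.M.a_assoc)
        have tS: "?t \<in> S \<gamma> (LT x)" using SL(3,4) h'(3) c by blast
        have ch: "c \<odot>\<^bsub>vsp V \<gamma>\<^esub> ?h \<in> H \<gamma>" using H\<gamma>(4) c h' by blast
        have "?t = \<ominus>\<^bsub>vsp V \<gamma>\<^esub> (c \<odot>\<^bsub>vsp V \<gamma>\<^esub> ?h) \<oplus>\<^bsub>vsp V \<gamma>\<^esub> z"
          unfolding zt using c(1) cl cl' by (simp add: M.M.r_neg1)
        then have "?t \<in> H \<gamma>" using H\<gamma>(3) M.submoduleE(3)[OF HS ch] 1(2) by simp
        then have "?t \<in> K" using IH tS by blast
        moreover have "c \<odot>\<^bsub>vsp V \<gamma>\<^esub> ?h \<in> K" using K(4) c h' by blast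
        ultimately show ?thesis using K(3) zt by simp
      qed
    qed
    show "H \<gamma> \<subseteq> K"
    proof
      fix z assume z: "z \<in> H \<gamma>"
      have "ord_less \<alpha> \<gamma>" using \<delta>(2) \<gamma> ord_less_imp_le ord_le_less_trans by blast
      then have "z \<in> S \<gamma> (car V \<alpha>)" using \<alpha>(2) Hc[OF z] unfolding grounded_at_def S_def by blast
      then have "z = \<zero>\<^bsub>vsp V \<gamma>\<^esub> \<or> (\<exists>y\<in>car V \<alpha>. z \<in> S \<gamma> (insert y (LT y)))"
        by (rule split[OF order_refl])
      then show "z \<in> K" using main[OF z] K(2) by blast
    qed
  qed
  then show ?thesis unfolding grounded_def using \<delta>(1) by blast
qed

end

section \<open>Colimits\<close>

text \<open>
  A colimit is built at each stage from lists of pairs \<open>(i, x)\<close>, standing for sums of elements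
  \<open>x\<close> of the \<open>i\<close>-th chain, modulo the congruence that turns concatenation into addition.
  Allowing any class of arrows instead of the arrows of a category makes
  coproducts, cokernels and the zero object special cases.
\<close>

locale chain_graph = tower k for k :: "'v::zfc tower" +
  fixes I :: "'v set" and D :: "'v \<Rightarrow> 'v chain" and E :: "('v \<times> 'v \<times> 'v chain_map) set"
  assumes small_I: "small I"
    and D: "i \<in> I \<Longrightarrow> grchain (D i)"
    and E: "(i, j, f) \<in> E \<Longrightarrow> i \<in> I \<and> j \<in> I \<and> f \<in> maps (D i) (D j)"
begin

lemma D_chain: "i \<in> I \<Longrightarrow> is_chain k (D i)"
  using D by blast

lemma D_module: "i \<in> I \<Longrightarrow> \<alpha> \<in> ON \<Longrightarrow> module (fld k \<alpha>) (vsp (D i) \<alpha>)"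
  using D chain_module by blast

lemma D_abelian_group: "i \<in> I \<Longrightarrow> \<alpha> \<in> ON \<Longrightarrow> abelian_group (vsp (D i) \<alpha>)"
  using D_module by (simp add: module_def)

definition words where
  "words \<alpha> = {w. \<forall>(i, x)\<in>set w. i \<in> I \<and> x \<in> car (D i) \<alpha>}"

lemma words_Nil [simp]: "[] \<in> words \<alpha>"
  and words_Cons [simp]: "(i, x) # w \<in> words \<alpha> \<longleftrightarrow> i \<in> I \<and> x \<in> car (D i) \<alpha> \<and> w \<in> words \<alpha>"
  and words_append [simp]: "w @ v \<in> words \<alpha> \<longleftrightarrow> w \<in> words \<alpha> \<and> v \<in> words \<alpha>"
  by (auto simp: words_def)

text \<open>Scalars and transition maps do not occur in the clauses: both act entry by entry and
  preserve every clause, which is how they pass to classes (\<open>rel_scale\<close>,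
  \<open>rel_push\<close>).\<close>

inductive rel for \<alpha> where
  refl: "w \<in> words \<alpha> \<Longrightarrow> rel \<alpha> w w"
| sym: "rel \<alpha> w v \<Longrightarrow> rel \<alpha> v w"
| trans: "rel \<alpha> w v \<Longrightarrow> rel \<alpha> v u \<Longrightarrow> rel \<alpha> w u"
| append: "rel \<alpha> w w' \<Longrightarrow> rel \<alpha> v v' \<Longrightarrow> rel \<alpha> (w @ v) (w' @ v')"
| commute: "w \<in> words \<alpha> \<Longrightarrow> v \<in> words \<alpha> \<Longrightarrow> rel \<alpha> (w @ v) (v @ w)"
| add: "i \<in> I \<Longrightarrow> x \<in> car (D i) \<alpha> \<Longrightarrow> y \<in> car (D i) \<alpha> \<Longrightarrow>
    rel \<alpha> [(i, x), (i, y)] [(i, x \<oplus>\<^bsub>vsp (D i) \<alpha>\<^esub> y)]"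
| zero: "i \<in> I \<Longrightarrow> rel \<alpha> [(i, \<zero>\<^bsub>vsp (D i) \<alpha>\<^esub>)] []"
| arrow: "(i, j, f) \<in> E \<Longrightarrow> x \<in> car (D i) \<alpha> \<Longrightarrow> rel \<alpha> [(i, x)] [(j, component f \<alpha> x)]"

lemma rel_words: "rel \<alpha> w v \<Longrightarrow> \<alpha> \<in> ON \<Longrightarrow> w \<in> words \<alpha> \<and> v \<in> words \<alpha>"
proof (induction rule: rel.induct)
  case (add i x y)
  then interpret module "fld k \<alpha>" "vsp (D i) \<alpha>" using D_module by blast
  show ?case using add by simp
next
  case (zero i)
  then interpret module "fld k \<alpha>" "vsp (D i) \<alpha>" using D_module by blast
  show ?case using zero by simp
next
  case (arrow i j f x)
  then show ?case using E[OF arrow(1)] cm_closed by auto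
qed auto

definition scale where
  "scale \<alpha> a w = map (\<lambda>(i, x). (i, a \<odot>\<^bsub>vsp (D i) \<alpha>\<^esub> x)) w"

definition push where
  "push \<beta> \<alpha> w = map (\<lambda>(i, x). (i, tmap (D i) \<beta> \<alpha> x)) w"

lemma scale_simps [simp]:
  "scale \<alpha> a [] = []" "scale \<alpha> a ((i, x) # w) = (i, a \<odot>\<^bsub>vsp (D i) \<alpha>\<^esub> x) # scale \<alpha> a w"
  "scale \<alpha> a (w @ v) = scale \<alpha> a w @ scale \<alpha> a v"
  by (auto simp: scale_def)

lemma push_simps [simp]:
  "push \<beta> \<alpha> [] = []" "push \<beta> \<alpha> ((i, x) # w) = (i, tmap (D i) \<beta> \<alpha> x) # push \<beta> \<alpha> w"
  "push \<beta> \<alpha> (w @ v) = push \<beta> \<alpha> w @ push \<beta> \<alpha> v"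
  by (auto simp: push_def)

lemma words_induct [consumes 1, case_names Nil Cons]:
  assumes "w \<in> words \<alpha>" "P []"
    and "\<And>i x w. i \<in> I \<Longrightarrow> x \<in> car (D i) \<alpha> \<Longrightarrow> w \<in> words \<alpha> \<Longrightarrow> P w \<Longrightarrow> P ((i, x) # w)"
  shows "P w"
  using assms(1) by (induction w) (use assms(2,3) in auto)

lemma scale_words: "w \<in> words \<alpha> \<Longrightarrow> \<alpha> \<in> ON \<Longrightarrow> a \<in> carrier (fld k \<alpha>) \<Longrightarrow> scale \<alpha> a w \<in> words \<alpha>"
  by (induction w rule: words_induct) (auto intro: module.smult_closed[OF D_module])

lemma push_words: "w \<in> words \<alpha> \<Longrightarrow> ord_le \<alpha> \<beta> \<Longrightarrow> push \<beta> \<alpha> w \<in> words \<beta>"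
  by (induction w rule: words_induct) (auto intro: tmap_closed[OF D_chain])

lemma rel_scale:
  assumes "rel \<alpha> w v" "\<alpha> \<in> ON" "a \<in> carrier (fld k \<alpha>)"
  shows "rel \<alpha> (scale \<alpha> a w) (scale \<alpha> a v)"
  using assms(1)
proof (induction rule: rel.induct)
  case (add i x y)
  then interpret module "fld k \<alpha>" "vsp (D i) \<alpha>" using D_module assms(2) by blast
  show ?case using add assms rel.add by (simp add: smult_r_distr)
next
  case (zero i)
  then interpret module "fld k \<alpha>" "vsp (D i) \<alpha>" using D_module assms(2) by blast
  show ?case using zero assms rel.zero by simp
next
  case (arrow i j f x)
  then interpret module "fld k \<alpha>" "vsp (D i) \<alpha>" using D_module assms(2) E by blast
  have "component f \<alpha> (a \<odot>\<^bsub>vsp (D i) \<alpha>\<^esub> x) = a \<odot>\<^bsub>vsp (D j) \<alpha>\<^esub> component f \<alpha> x"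
    using E[OF arrow(1)] arrow(2) assms(2,3) cm_smult by blast
  then show ?case using rel.arrow[OF arrow(1), of "a \<odot>\<^bsub>vsp (D i) \<alpha>\<^esub> x" \<alpha>] arrow(2) assms(3) by simp
qed (auto intro: rel.intros scale_words assms)

lemma rel_push:
  assumes "rel \<alpha> w v" "ord_le \<alpha> \<beta>"
  shows "rel \<beta> (push \<beta> \<alpha> w) (push \<beta> \<alpha> v)"
  using assms(1)
proof (induction rule: rel.induct)
  case (add i x y)
  then show ?case
    using rel.add[OF add(1), of "tmap (D i) \<beta> \<alpha> x" \<beta> "tmap (D i) \<beta> \<alpha> y"] assms(2) D_chain
    by (simp add: tmap_add tmap_closed)
next
  case (zero i)
  then show ?case using rel.zero[OF zero] assms(2) D_chain by (simp add: tmap_zero)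
next
  case (arrow i j f x)
  have "component f \<beta> (tmap (D i) \<beta> \<alpha> x) = tmap (D j) \<beta> \<alpha> (component f \<alpha> x)"
    using E[OF arrow(1)] arrow(2) assms(2) cm_tmap by blast
  then show ?case
    using rel.arrow[OF arrow(1), of "tmap (D i) \<beta> \<alpha> x" \<beta>] arrow(2) assms(2) E[OF arrow(1)] D_chain
    by (simp add: tmap_closed)
qed (auto intro: rel.intros push_words assms)

lemma rel_Cons: "rel \<alpha> w v \<Longrightarrow> i \<in> I \<Longrightarrow> x \<in> car (D i) \<alpha> \<Longrightarrow> rel \<alpha> ((i, x) # w) ((i, x) # v)"
  using rel.append[OF rel.refl, of "[(i, x)]" \<alpha> w v] by simp

text \<open>The two sides are different lists: \<open>rel.add\<close> splits the head entry, and
  \<open>rel.commute\<close> moves the b-part of the head past the a-multiples of the tail.\<close>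

lemma rel_scale_add:
  assumes "w \<in> words \<alpha>" "\<alpha> \<in> ON" "a \<in> carrier (fld k \<alpha>)" "b \<in> carrier (fld k \<alpha>)"
  shows "rel \<alpha> (scale \<alpha> (a \<oplus>\<^bsub>fld k \<alpha>\<^esub> b) w) (scale \<alpha> a w @ scale \<alpha> b w)"
  using assms(1)
proof (induction w rule: words_induct)
  case Nil
  then show ?case by (simp add: rel.refl)
next
  case (Cons i x w)
  interpret module "fld k \<alpha>" "vsp (D i) \<alpha>" using D_module Cons(1) assms(2) by blast
  let ?a = "(i, a \<odot>\<^bsub>vsp (D i) \<alpha>\<^esub> x)" and ?b = "(i, b \<odot>\<^bsub>vsp (D i) \<alpha>\<^esub> x)"
  note sw = scale_words[OF Cons(3) assms(2)]
  have 1: "rel \<alpha> (scale \<alpha> (a \<oplus>\<^bsub>fld k \<alpha>\<^esub> b) ((i, x) # w)) ([?a, ?b] @ (scale \<alpha> a w @ scale \<alpha> b w))"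
  proof -
    have "rel \<alpha> ([(i, (a \<oplus>\<^bsub>fld k \<alpha>\<^esub> b) \<odot>\<^bsub>vsp (D i) \<alpha>\<^esub> x)] @ scale \<alpha> (a \<oplus>\<^bsub>fld k \<alpha>\<^esub> b) w)
      ([?a, ?b] @ (scale \<alpha> a w @ scale \<alpha> b w))"
      using rel.sym[OF rel.add[OF Cons(1), of "a \<odot>\<^bsub>vsp (D i) \<alpha>\<^esub> x" \<alpha> "b \<odot>\<^bsub>vsp (D i) \<alpha>\<^esub> x"]] Cons assms
      by (intro rel.append) (auto simp: smult_l_distr)
    then show ?thesis by simp
  qed
  have "rel \<alpha> (([?b] @ scale \<alpha> a w) @ scale \<alpha> b w) ((scale \<alpha> a w @ [?b]) @ scale \<alpha> b w)"
    using Cons assms by (intro rel.append rel.commute rel.refl) (auto simp: sw)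
  then have "rel \<alpha> ([?a, ?b] @ (scale \<alpha> a w @ scale \<alpha> b w)) (scale \<alpha> a ((i, x) # w) @ scale \<alpha> b ((i, x) # w))"
    using rel_Cons[of \<alpha> _ _ i "a \<odot>\<^bsub>vsp (D i) \<alpha>\<^esub> x"] Cons assms by simp
  with 1 show ?case by (rule rel.trans)
qed

lemma rel_scale_zero:
  assumes "w \<in> words \<alpha>" "\<alpha> \<in> ON"
  shows "rel \<alpha> (scale \<alpha> \<zero>\<^bsub>fld k \<alpha>\<^esub> w) []"
  using assms(1)
proof (induction w rule: words_induct)
  case (Cons i x w)
  interpret module "fld k \<alpha>" "vsp (D i) \<alpha>" using D_module Cons(1) assms(2) by blast
  show ?case using rel.append[OF rel.zero[OF Cons(1)] Cons(4)] Cons(2) by simp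
qed (simp add: rel.refl)

lemma scale_one: "w \<in> words \<alpha> \<Longrightarrow> \<alpha> \<in> ON \<Longrightarrow> scale \<alpha> \<one>\<^bsub>fld k \<alpha>\<^esub> w = w"
  by (induction w rule: words_induct) (auto intro: module.smult_one[OF D_module])

lemma scale_mult: "w \<in> words \<alpha> \<Longrightarrow> \<alpha> \<in> ON \<Longrightarrow> a \<in> carrier (fld k \<alpha>) \<Longrightarrow> b \<in> carrier (fld k \<alpha>) \<Longrightarrow>
    scale \<alpha> (a \<otimes>\<^bsub>fld k \<alpha>\<^esub> b) w = scale \<alpha> a (scale \<alpha> b w)"
  by (induction w rule: words_induct) (auto intro: module.smult_assoc1[OF D_module])

lemma push_id: "w \<in> words \<alpha> \<Longrightarrow> \<alpha> \<in> ON \<Longrightarrow> push \<alpha> \<alpha> w = w"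
  by (induction w rule: words_induct) (auto intro: tmap_id[OF D_chain])

lemma push_push: "w \<in> words \<alpha> \<Longrightarrow> ord_le \<alpha> \<beta> \<Longrightarrow> ord_le \<beta> \<gamma> \<Longrightarrow> push \<gamma> \<beta> (push \<beta> \<alpha> w) = push \<gamma> \<alpha> w"
  by (induction w rule: words_induct) (auto intro: tmap_tmap[OF D_chain])

lemma push_scale: "w \<in> words \<alpha> \<Longrightarrow> ord_le \<alpha> \<beta> \<Longrightarrow> a \<in> carrier (fld k \<alpha>) \<Longrightarrow>
    push \<beta> \<alpha> (scale \<alpha> a w) = scale \<beta> (emb k \<beta> \<alpha> a) (push \<beta> \<alpha> w)"
  by (induction w rule: words_induct) (auto intro: tmap_smult[OF D_chain])

subsection \<open>The quotient chain\<close>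

text \<open>A class is represented by the code of one chosen member, which is an element of the
  universe. The choice depends on the predicate \<open>rel \<alpha> w\<close> alone, and congruent
  words have the same predicate.\<close>

definition cls where "cls \<alpha> w = encode (SOME v. rel \<alpha> w v)"

definition rep where "rep a = inv_into UNIV encode a"

lemma rel_rep_cls: "w \<in> words \<alpha> \<Longrightarrow> rel \<alpha> w (rep (cls \<alpha> w))"
  unfolding cls_def rep_def inv_f_f[OF inj_encode] by (rule someI) (rule rel.refl)

lemma cls_eq_iff: "w \<in> words \<alpha> \<Longrightarrow> v \<in> words \<alpha> \<Longrightarrow> cls \<alpha> w = cls \<alpha> v \<longleftrightarrow> rel \<alpha> w v"
proof
  assume w: "w \<in> words \<alpha>" "v \<in> words \<alpha>"
  show "cls \<alpha> w = cls \<alpha> v \<Longrightarrow> rel \<alpha> w v"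
    using rel_rep_cls[OF w(1)] rel_rep_cls[OF w(2)] rel.sym rel.trans by metis
  assume "rel \<alpha> w v"
  then have "rel \<alpha> w = rel \<alpha> v" using rel.sym rel.trans by blast
  then show "cls \<alpha> w = cls \<alpha> v" by (simp add: cls_def)
qed

lemma rep_words: "w \<in> words \<alpha> \<Longrightarrow> \<alpha> \<in> ON \<Longrightarrow> rep (cls \<alpha> w) \<in> words \<alpha>"
  using rel_rep_cls rel_words by blast

definition colim where
  "colim = \<lparr>vsp = \<lambda>\<alpha>. \<lparr>carrier = cls \<alpha> ` words \<alpha>, mult = undefined, one = undefined,
       zero = cls \<alpha> [], add = \<lambda>a b. cls \<alpha> (rep a @ rep b), smult = \<lambda>r a. cls \<alpha> (scale \<alpha> r (rep a))\<rparr>,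
     tmap = \<lambda>\<beta> \<alpha> a. cls \<beta> (push \<beta> \<alpha> (rep a))\<rparr>"

lemma carrier_colim: "car colim \<alpha> = cls \<alpha> ` words \<alpha>"
  and zero_colim: "\<zero>\<^bsub>vsp colim \<alpha>\<^esub> = cls \<alpha> []"
  by (simp_all add: colim_def)

lemma add_cls: "w \<in> words \<alpha> \<Longrightarrow> v \<in> words \<alpha> \<Longrightarrow> \<alpha> \<in> ON \<Longrightarrow>
    cls \<alpha> w \<oplus>\<^bsub>vsp colim \<alpha>\<^esub> cls \<alpha> v = cls \<alpha> (w @ v)"
  by (simp add: colim_def cls_eq_iff rep_words) (intro rel.sym[OF rel.append] rel_rep_cls)

lemma smult_cls: "w \<in> words \<alpha> \<Longrightarrow> a \<in> carrier (fld k \<alpha>) \<Longrightarrow> \<alpha> \<in> ON \<Longrightarrow>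
    a \<odot>\<^bsub>vsp colim \<alpha>\<^esub> cls \<alpha> w = cls \<alpha> (scale \<alpha> a w)"
  by (simp add: colim_def cls_eq_iff rep_words scale_words) (intro rel.sym[OF rel_scale] rel_rep_cls)

lemma tmap_cls: "w \<in> words \<alpha> \<Longrightarrow> ord_le \<alpha> \<beta> \<Longrightarrow> tmap colim \<beta> \<alpha> (cls \<alpha> w) = cls \<beta> (push \<beta> \<alpha> w)"
  by (simp add: colim_def cls_eq_iff rep_words push_words ord_le_ON)
     (intro rel.sym[OF rel_push] rel_rep_cls)

lemma module_colim:
  assumes "\<alpha> \<in> ON"
  shows "module (fld k \<alpha>) (vsp colim \<alpha>)"
proof -
  interpret cring "fld k \<alpha>" by (rule fld_cring[OF assms])
  have "abelian_group (vsp colim \<alpha>)"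
  proof (rule abelian_groupI)
    fix a assume "a \<in> car colim \<alpha>"
    then obtain w where w: "w \<in> words \<alpha>" "a = cls \<alpha> w" by (auto simp: carrier_colim)
    \<comment> \<open>The negative of a class is its multiple by -1; \<open>rel_scale_add\<close>
      collapses the sum to the multiple by zero.\<close>
    let ?v = "scale \<alpha> (\<ominus>\<^bsub>fld k \<alpha>\<^esub> \<one>\<^bsub>fld k \<alpha>\<^esub>) w"
    have v: "?v \<in> words \<alpha>" using scale_words w assms by simp
    have "rel \<alpha> (?v @ w) (scale \<alpha> \<zero>\<^bsub>fld k \<alpha>\<^esub> w)"
      using rel.sym[OF rel_scale_add[OF w(1) assms, of "\<ominus>\<^bsub>fld k \<alpha>\<^esub> \<one>\<^bsub>fld k \<alpha>\<^esub>" "\<one>\<^bsub>fld k \<alpha>\<^esub>"]]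
      by (simp add: scale_one w assms l_neg)
    then have "rel \<alpha> (?v @ w) []" using rel.trans rel_scale_zero[OF w(1) assms] by blast
    then have "cls \<alpha> ?v \<oplus>\<^bsub>vsp colim \<alpha>\<^esub> a = \<zero>\<^bsub>vsp colim \<alpha>\<^esub>"
      using w v by (simp add: add_cls assms zero_colim cls_eq_iff)
    then show "\<exists>b\<in>car colim \<alpha>. b \<oplus>\<^bsub>vsp colim \<alpha>\<^esub> a = \<zero>\<^bsub>vsp colim \<alpha>\<^esub>"
      using v by (auto simp: carrier_colim)
  qed (auto simp: carrier_colim zero_colim add_cls assms cls_eq_iff rel.commute)
  then show ?thesis
    by (intro moduleI is_cring)
       (auto simp: carrier_colim smult_cls add_cls assms scale_words cls_eq_iff rel_scale_add
         scale_mult scale_one rel.refl)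
qed

lemma small_colim:
  assumes "\<alpha> \<in> ON"
  shows "small (car colim \<alpha>)"
proof -
  \<comment> \<open>One alphabet for indices and entries together, since
    \<open>small_encode_lists\<close> draws both from the same class.\<close>
  let ?S = "I \<union> (\<Union>i\<in>I. car (D i) \<alpha>)"
  have "small ?S" using chain_small[OF D_chain assms] by (intro small_Un small_UN small_I)
  then have "small (encode ` {w. \<forall>(i, x)\<in>set w. i \<in> ?S \<and> x \<in> ?S})" by (rule small_encode_lists)
  moreover have "cls \<alpha> w = encode (rep (cls \<alpha> w))" for w
    by (simp add: cls_def rep_def inv_f_f[OF inj_encode])
  then have "car colim \<alpha> \<subseteq> encode ` words \<alpha>"
    unfolding carrier_colim using rep_words assms by blast
  then have "car colim \<alpha> \<subseteq> encode ` {w. \<forall>(i, x)\<in>set w. i \<in> ?S \<and> x \<in> ?S}"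
    unfolding words_def by fastforce
  ultimately show ?thesis by (rule small_subset)
qed

lemma is_chain_colim: "is_chain k colim"
proof (rule is_chainI)
  fix \<alpha> \<beta> a x
  assume h: "ord_le \<alpha> \<beta>" "a \<in> carrier (fld k \<alpha>)" "x \<in> car colim \<alpha>"
  then show "tmap colim \<beta> \<alpha> (a \<odot>\<^bsub>vsp colim \<alpha>\<^esub> x) = emb k \<beta> \<alpha> a \<odot>\<^bsub>vsp colim \<beta>\<^esub> tmap colim \<beta> \<alpha> x"
    by (auto simp: carrier_colim smult_cls tmap_cls scale_words push_words emb_closed ord_le_ON push_scale)
next
  fix \<alpha> \<beta> \<gamma> x assume h: "ord_le \<alpha> \<beta>" "ord_le \<beta> \<gamma>" "x \<in> car colim \<alpha>"
  then show "tmap colim \<gamma> \<beta> (tmap colim \<beta> \<alpha> x) = tmap colim \<gamma> \<alpha> x"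
    using ord_le_trans[OF h(1,2)] by (auto simp: carrier_colim tmap_cls push_words push_push)
next
  fix \<alpha> :: 'v assume "\<alpha> \<in> ON"
  then show "small (car colim \<alpha>)" by (rule small_colim)
qed (auto simp: module_colim carrier_colim tmap_cls add_cls push_words ord_le_ON push_id ord_le_refl)

section \<open>Coprojections, groundedness and the universal property of the colimit\<close>

definition coproj where "coproj i = mk_map (D i) colim (\<lambda>\<alpha> x. cls \<alpha> [(i, x)])"

lemma component_coproj [simp]:
  "\<alpha> \<in> ON \<Longrightarrow> x \<in> car (D i) \<alpha> \<Longrightarrow> component (coproj i) \<alpha> x = cls \<alpha> [(i, x)]"
  by (simp add: coproj_def)

lemma coproj_in:
  assumes i: "i \<in> I"
  shows "coproj i \<in> maps (D i) colim"
  unfolding coproj_def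
proof (rule mk_map_in)
  fix \<alpha> x y assume "\<alpha> \<in> ON" "x \<in> car (D i) \<alpha>" "y \<in> car (D i) \<alpha>"
  moreover from this interpret module "fld k \<alpha>" "vsp (D i) \<alpha>" using D_module i by blast
  show "cls \<alpha> [(i, x \<oplus>\<^bsub>vsp (D i) \<alpha>\<^esub> y)] = cls \<alpha> [(i, x)] \<oplus>\<^bsub>vsp colim \<alpha>\<^esub> cls \<alpha> [(i, y)]"
    using i calculation by (simp add: add_cls cls_eq_iff rel.sym[OF rel.add])
qed (use i in \<open>auto simp: carrier_colim smult_cls tmap_cls D_chain\<close>)

text \<open>Induction on words: the colimit is additively generated by the images of the
  coprojections, scalars being absorbed into the entries.\<close>

lemma colim_subset:
  assumes "\<alpha> \<in> ON" "\<zero>\<^bsub>vsp colim \<alpha>\<^esub> \<in> H"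
    and "\<And>i x. i \<in> I \<Longrightarrow> x \<in> car (D i) \<alpha> \<Longrightarrow> component (coproj i) \<alpha> x \<in> H"
    and "\<And>a b. a \<in> H \<Longrightarrow> b \<in> H \<Longrightarrow> a \<oplus>\<^bsub>vsp colim \<alpha>\<^esub> b \<in> H"
  shows "car colim \<alpha> \<subseteq> H"
proof -
  have "cls \<alpha> w \<in> H" if "w \<in> words \<alpha>" for w
    using that
  proof (induction w rule: words_induct)
    case Nil
    then show ?case using assms(2) by (simp add: zero_colim)
  next
    case (Cons i x w)
    then show ?case using assms(4)[OF assms(3)[OF Cons(1,2)] Cons(4)] assms(1) by (simp add: add_cls)
  qed
  then show ?thesis by (auto simp: carrier_colim)
qed

lemma coproj_arrow:
  assumes "(i, j, f) \<in> E"
  shows "coproj j \<circ>\<^sub>c f = coproj i"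
proof -
  note e = E[OF assms]
  show ?thesis
  proof (rule cm_eqI)
    show "coproj j \<circ>\<^sub>c f \<in> maps (D i) colim" using e coproj_in comp_in D_chain by blast
    show "coproj i \<in> maps (D i) colim" using e coproj_in by blast
    fix \<alpha> x assume h: "\<alpha> \<in> ON" "x \<in> car (D i) \<alpha>"
    then show "component (coproj j \<circ>\<^sub>c f) \<alpha> x = component (coproj i) \<alpha> x"
      using e rel.sym[OF rel.arrow[OF assms h(2)]] cm_closed
      by (auto simp: component_comp cls_eq_iff)
  qed
qed

text \<open>Smallness of the index class gives the grounding stages of the chains \<open>D i\<close>
  a common upper bound \<delta>. At later stages, a submodule containing the image of stage \<delta>
  has a preimage in \<open>D i\<close> that is all of \<open>D i\<close>, so it contains every
  coprojection.\<close>

lemma grounded_colim: "grounded k colim"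
proof -
  define g where "g i = (SOME \<alpha>. \<alpha> \<in> ON \<and> grounded_at k \<alpha> (D i))" for i
  have g: "g i \<in> ON \<and> grounded_at k (g i) (D i)" if "i \<in> I" for i
    unfolding g_def by (rule someI_ex) (use D[OF that] in \<open>auto simp: grounded_def\<close>)
  obtain \<delta> where \<delta>: "\<delta> \<in> ON" "\<And>i. i \<in> I \<Longrightarrow> ord_less (g i) \<delta>"
    using ord_strict_upper_bound[OF small_image[OF small_I, of g]] g by auto
  have gD: "grounded_at k \<delta> (D i)" if "i \<in> I" for i
    using grounded_at_mono[OF D_chain[OF that]] g[OF that] ord_less_imp_le[OF \<delta>(2)[OF that]] by blast
  have "grounded_at k \<delta> colim"
    unfolding grounded_at_iff[OF is_chain_colim \<delta>(1)]
  proof (intro allI impI)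
    fix \<beta> H assume \<beta>: "ord_less \<delta> \<beta>" and H: "submodule H (fld k \<beta>) (vsp colim \<beta>)"
      and im: "tmap colim \<beta> \<delta> ` car colim \<delta> \<subseteq> H"
    have \<beta>ON: "\<beta> \<in> ON" and le: "ord_le \<delta> \<beta>" using \<beta> ord_less_ON ord_less_imp_le by blast+
    show "car colim \<beta> \<subseteq> H"
    proof (rule colim_subset[OF \<beta>ON])
      fix i x assume i: "i \<in> I" and x: "x \<in> car (D i) \<beta>"
      let ?H = "{x \<in> car (D i) \<beta>. component (coproj i) \<beta> x \<in> H}"
      have "submodule ?H (fld k \<beta>) (vsp (D i) \<beta>)"
        by (rule submodule_cm_vimage[OF D_chain[OF i] is_chain_colim coproj_in[OF i] \<beta>ON H])
      moreover have "tmap (D i) \<beta> \<delta> ` car (D i) \<delta> \<subseteq> ?H"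
      proof
        fix y assume "y \<in> tmap (D i) \<beta> \<delta> ` car (D i) \<delta>"
        then obtain z where z: "z \<in> car (D i) \<delta>" "y = tmap (D i) \<beta> \<delta> z" by blast
        have "component (coproj i) \<beta> y = tmap colim \<beta> \<delta> (component (coproj i) \<delta> z)"
          using cm_tmap[OF coproj_in[OF i] le z(1)] z(2) by simp
        then show "y \<in> ?H"
          using im cm_closed[OF coproj_in[OF i] \<delta>(1) z(1)] tmap_closed[OF D_chain[OF i] le z(1)] z(2) by auto
      qed
      ultimately have "car (D i) \<beta> \<subseteq> ?H"
        using gD[OF i] \<beta> unfolding grounded_at_iff[OF D_chain[OF i] \<delta>(1)] by blast
      then show "component (coproj i) \<beta> x \<in> H" using x by blast
    qed (use submoduleD[OF H] in auto)
  qed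
  then show ?thesis unfolding grounded_def using \<delta>(1) by blast
qed

text \<open>The elements on which the two maps agree include the images of the coprojections and are
  closed under addition.\<close>

lemma colim_eqI:
  assumes f: "f \<in> maps colim T" and g: "g \<in> maps colim T" and T: "is_chain k T"
    and "\<And>i. i \<in> I \<Longrightarrow> f \<circ>\<^sub>c coproj i = g \<circ>\<^sub>c coproj i"
  shows "f = g"
proof (rule cm_eqI[OF f g])
  fix \<alpha> x assume \<alpha>: "\<alpha> \<in> ON" and x: "x \<in> car colim \<alpha>"
  interpret module "fld k \<alpha>" "vsp colim \<alpha>" by (rule module_colim[OF \<alpha>])
  have "car colim \<alpha> \<subseteq> {x \<in> car colim \<alpha>. component f \<alpha> x = component g \<alpha> x}"
  proof (rule colim_subset[OF \<alpha>])
    fix i x assume i: "i \<in> I" "x \<in> car (D i) \<alpha>"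
    then show "component (coproj i) \<alpha> x \<in> {x \<in> car colim \<alpha>. component f \<alpha> x = component g \<alpha> x}"
      using arg_cong[OF assms(4)[OF i(1)], of "\<lambda>h. component h \<alpha> x"] cm_closed[OF coproj_in \<alpha>]
      by (simp only: component_comp[OF coproj_in \<alpha>] mem_Collect_eq)
  qed (auto simp: cm_zero[OF f is_chain_colim T \<alpha>] cm_zero[OF g is_chain_colim T \<alpha>]
      cm_add[OF f \<alpha>] cm_add[OF g \<alpha>])
  then show "component f \<alpha> x = component g \<alpha> x" using x by blast
qed

text \<open>The family \<open>t\<close> need not be a cocone here; compatibility with arrows is
  asked for in \<open>word_sum_rel\<close> and \<open>induced_universal\<close>. Families that are
  not cocones serve for cokernels and for filtered diagrams.\<close>

fun word_sum where
  "word_sum T t \<alpha> [] = \<zero>\<^bsub>vsp T \<alpha>\<^esub>"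
| "word_sum T t \<alpha> ((i, x) # w) = component (t i) \<alpha> x \<oplus>\<^bsub>vsp T \<alpha>\<^esub> word_sum T t \<alpha> w"

context
  fixes T t
  assumes T: "is_chain k T" and t: "\<And>i. i \<in> I \<Longrightarrow> t i \<in> maps (D i) T"
begin

lemma word_sum_closed: "w \<in> words \<alpha> \<Longrightarrow> \<alpha> \<in> ON \<Longrightarrow> word_sum T t \<alpha> w \<in> car T \<alpha>"
proof (induction w rule: words_induct)
  case Nil
  then interpret abelian_group "vsp T \<alpha>" using chain_abelian_group T by blast
  show ?case by simp
next
  case (Cons i x w)
  then interpret abelian_group "vsp T \<alpha>" using chain_abelian_group T by blast
  show ?case using Cons cm_closed[OF t] by simp
qed

lemma word_sum_append: "w \<in> words \<alpha> \<Longrightarrow> v \<in> words \<alpha> \<Longrightarrow> \<alpha> \<in> ON \<Longrightarrow>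
    word_sum T t \<alpha> (w @ v) = word_sum T t \<alpha> w \<oplus>\<^bsub>vsp T \<alpha>\<^esub> word_sum T t \<alpha> v"
proof (induction w rule: words_induct)
  case Nil
  then interpret abelian_group "vsp T \<alpha>" using chain_abelian_group T by blast
  show ?case using Nil word_sum_closed by simp
next
  case (Cons i x w)
  then interpret abelian_group "vsp T \<alpha>" using chain_abelian_group T by blast
  show ?case using Cons cm_closed[OF t] word_sum_closed by (simp add: a_assoc)
qed

lemma word_sum_scale: "w \<in> words \<alpha> \<Longrightarrow> \<alpha> \<in> ON \<Longrightarrow> a \<in> carrier (fld k \<alpha>) \<Longrightarrow>
    word_sum T t \<alpha> (scale \<alpha> a w) = a \<odot>\<^bsub>vsp T \<alpha>\<^esub> word_sum T t \<alpha> w"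
proof (induction w rule: words_induct)
  case Nil
  then interpret module "fld k \<alpha>" "vsp T \<alpha>" using chain_module T by blast
  show ?case using Nil by simp
next
  case (Cons i x w)
  then interpret module "fld k \<alpha>" "vsp T \<alpha>" using chain_module T by blast
  show ?case using Cons cm_closed[OF t] cm_smult[OF t] word_sum_closed by (simp add: smult_r_distr)
qed

lemma word_sum_push: "w \<in> words \<alpha> \<Longrightarrow> ord_le \<alpha> \<beta> \<Longrightarrow>
    word_sum T t \<beta> (push \<beta> \<alpha> w) = tmap T \<beta> \<alpha> (word_sum T t \<alpha> w)"
proof (induction w rule: words_induct)
  case Nil
  then show ?case using tmap_zero[OF T] by simp
next
  case (Cons i x w)
  then show ?case
    using cm_closed[OF t] cm_tmap[OF t] word_sum_closed tmap_add[OF T Cons(5)] by (simp add: ord_le_ON)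
qed

text \<open>Each clause of \<open>rel\<close> turns into an identity in T, and the cocone condition
  is what the clause \<open>arrow\<close> turns into.\<close>

lemma word_sum_rel:
  assumes arr: "\<And>i j f. (i, j, f) \<in> E \<Longrightarrow> t j \<circ>\<^sub>c f = t i"
  shows "rel \<alpha> w v \<Longrightarrow> \<alpha> \<in> ON \<Longrightarrow> word_sum T t \<alpha> w = word_sum T t \<alpha> v"
proof (induction rule: rel.induct)
  case (append w w' v v')
  then show ?case using rel_words word_sum_append by metis
next
  case (commute w v)
  then interpret abelian_group "vsp T \<alpha>" using chain_abelian_group T by blast
  show ?case using commute word_sum_append word_sum_closed by (simp add: a_comm)
next
  case (add i x y)
  then interpret abelian_group "vsp T \<alpha>" using chain_abelian_group T by blast
  show ?case using add cm_add[OF t] cm_closed[OF t] by (simp add: a_assoc)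
next
  case (zero i)
  then interpret abelian_group "vsp T \<alpha>" using chain_abelian_group T by blast
  show ?case using zero cm_zero[OF t D_chain T] by simp
next
  case (arrow i j f x)
  have "component (t j) \<alpha> (component f \<alpha> x) = component (t i) \<alpha> x"
    using component_comp[OF conjunct2[OF conjunct2[OF E[OF arrow(1)]]] arrow(3,2)] arr[OF arrow(1)] by metis
  then show ?case by simp
qed auto

definition induced where "induced = mk_map colim T (\<lambda>\<alpha> a. word_sum T t \<alpha> (rep a))"

lemma induced_universal:
  assumes arr: "\<And>i j f. (i, j, f) \<in> E \<Longrightarrow> t j \<circ>\<^sub>c f = t i"
  shows "\<exists>!h. h \<in> maps colim T \<and> (\<forall>i\<in>I. h \<circ>\<^sub>c coproj i = t i)"
proof -
  have rep: "word_sum T t \<alpha> (rep (cls \<alpha> w)) = word_sum T t \<alpha> w" if "w \<in> words \<alpha>" "\<alpha> \<in> ON" for \<alpha> w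
    using word_sum_rel[OF arr rel_rep_cls[OF that(1)] that(2)] by simp
  have h: "induced \<in> maps colim T"
    unfolding induced_def
  proof (rule mk_map_in)
    fix \<alpha> \<beta> x assume "ord_le \<alpha> \<beta>" "x \<in> car colim \<alpha>"
    then show "word_sum T t \<beta> (rep (tmap colim \<beta> \<alpha> x)) = tmap T \<beta> \<alpha> (word_sum T t \<alpha> (rep x))"
      by (auto simp: carrier_colim tmap_cls rep push_words word_sum_push ord_le_ON)
  qed (auto simp: carrier_colim add_cls smult_cls rep word_sum_closed word_sum_append word_sum_scale
      scale_words is_chain_colim)
  moreover have "induced \<circ>\<^sub>c coproj i = t i" if i: "i \<in> I" for i
  proof (rule cm_eqI[OF comp_in[OF coproj_in[OF i] h D_chain[OF i]] t[OF i]])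
    fix \<alpha> x assume x: "\<alpha> \<in> ON" "x \<in> car (D i) \<alpha>"
    interpret abelian_group "vsp T \<alpha>" using chain_abelian_group T x by blast
    show "component (induced \<circ>\<^sub>c coproj i) \<alpha> x = component (t i) \<alpha> x"
      using x i cm_closed[OF t] rep[of "[(i, x)]" \<alpha>]
      by (simp add: component_comp[OF coproj_in[OF i]] induced_def carrier_colim)
  qed
  ultimately show ?thesis
    using colim_eqI[OF _ _ T] by (intro ex1I[of _ induced]) auto
qed

end

end

section \<open>Colimits of small diagrams, and words over filtered shapes\<close>

definition (in tower) zero_map where
  "zero_map V W = mk_map V W (\<lambda>\<alpha> x. \<zero>\<^bsub>vsp W \<alpha>\<^esub>)"

lemma (in tower) zero_map_in:
  assumes "is_chain k V" "is_chain k W"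
  shows "zero_map V W \<in> maps V W"
  unfolding zero_map_def
proof (rule mk_map_in)
  fix \<alpha> a :: 'v assume \<alpha>: "\<alpha> \<in> ON"
  interpret module "fld k \<alpha>" "vsp W \<alpha>" by (rule chain_module[OF assms(2) \<alpha>])
  show "\<zero>\<^bsub>vsp W \<alpha>\<^esub> \<in> car W \<alpha>" by simp
  show "\<zero>\<^bsub>vsp W \<alpha>\<^esub> = \<zero>\<^bsub>vsp W \<alpha>\<^esub> \<oplus>\<^bsub>vsp W \<alpha>\<^esub> \<zero>\<^bsub>vsp W \<alpha>\<^esub>" by simp
  show "a \<in> carrier (fld k \<alpha>) \<Longrightarrow> \<zero>\<^bsub>vsp W \<alpha>\<^esub> = a \<odot>\<^bsub>vsp W \<alpha>\<^esub> \<zero>\<^bsub>vsp W \<alpha>\<^esub>" by simp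
qed (use assms in \<open>auto simp: tmap_zero\<close>)

lemma (in tower) component_zero_map [simp]:
  "\<alpha> \<in> ON \<Longrightarrow> x \<in> car V \<alpha> \<Longrightarrow> component (zero_map V W) \<alpha> x = \<zero>\<^bsub>vsp W \<alpha>\<^esub>"
  by (simp add: zero_map_def)

locale chain_diagram = tower k for k :: "'v::zfc tower" +
  fixes J :: "('v, 'v) category" and F :: "('v, 'v, 'v chain, 'v chain_map) diagram"
  assumes J: "small_category J"
    and F: "is_diagram J \<C> F"
begin

definition arrows where
  "arrows = {(i, j, darr F u) | i j u. i \<in> Ob J \<and> j \<in> Ob J \<and> u \<in> Hom J i j}"

sublocale J: category J
  using J by (simp add: small_category_def)

lemma dob_grchain: "i \<in> Ob J \<Longrightarrow> grchain (dob F i)"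
  and darr_in: "i \<in> Ob J \<Longrightarrow> j \<in> Ob J \<Longrightarrow> u \<in> Hom J i j \<Longrightarrow> darr F u \<in> maps (dob F i) (dob F j)"
  and darr_Comp: "i \<in> Ob J \<Longrightarrow> j \<in> Ob J \<Longrightarrow> l \<in> Ob J \<Longrightarrow> u \<in> Hom J i j \<Longrightarrow> v \<in> Hom J j l \<Longrightarrow>
    darr F (v \<cdot>\<^bsub>J\<^esub> u) = darr F v \<circ>\<^sub>c darr F u"
  using F unfolding is_diagram_def Ob_grounded Hom_grounded by blast+

sublocale chain_graph k "Ob J" "dob F" arrows
proof
  show "small (Ob J)" using J by (simp add: small_category_def)
qed (use dob_grchain darr_in in \<open>auto simp: arrows_def\<close>)

lemma component_darr_Comp:
  assumes "i \<in> Ob J" "j \<in> Ob J" "l \<in> Ob J" "u \<in> Hom J i j" "v \<in> Hom J j l"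
    and "\<alpha> \<in> ON" "x \<in> car (dob F i) \<alpha>"
  shows "component (darr F (v \<cdot>\<^bsub>J\<^esub> u)) \<alpha> x = component (darr F v) \<alpha> (component (darr F u) \<alpha> x)"
  unfolding darr_Comp[OF assms(1-5)] by (rule component_comp[OF darr_in[OF assms(1,2,4)] assms(6,7)])

lemma is_cocone_iff:
  "is_cocone J \<C> F T t \<longleftrightarrow> grchain T \<and>
    (\<forall>i\<in>Ob J. t i \<in> maps (dob F i) T) \<and> (\<forall>(i, j, f)\<in>arrows. t j \<circ>\<^sub>c f = t i)"
proof -
  have "(\<forall>(i, j, f)\<in>arrows. t j \<circ>\<^sub>c f = t i) \<longleftrightarrow>
      (\<forall>i\<in>Ob J. \<forall>j\<in>Ob J. \<forall>u\<in>Hom J i j. t j \<circ>\<^sub>c darr F u = t i)"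
    unfolding arrows_def by fast
  then show ?thesis unfolding is_cocone_def Ob_grounded Hom_grounded by simp
qed

lemma is_colimit_colim: "is_colimit J \<C> F colim coproj"
  unfolding is_colimit_def is_cocone_iff Hom_grounded
proof (intro conjI allI impI ballI)
  fix T t assume T: "grchain T \<and> (\<forall>i\<in>Ob J. t i \<in> maps (dob F i) T) \<and>
    (\<forall>(i, j, f)\<in>arrows. t j \<circ>\<^sub>c f = t i)"
  show "\<exists>!h. h \<in> maps colim T \<and> (\<forall>i\<in>Ob J. h \<circ>\<^sub>c coproj i = t i)"
    by (rule induced_universal) (use T in auto)
qed (use is_chain_colim grounded_colim coproj_in coproj_arrow in auto)

end

text \<open>
  For a filtered shape, two congruent words have the same sum once all their entries
  are transported far enough: here \<open>u\<close> chooses the transporting arrows to a common index \<open>l\<close>.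
\<close>

locale filtered_diagram = chain_diagram +
  assumes filtered: "filtered J"
begin

lemma join: "i \<in> Ob J \<Longrightarrow> j \<in> Ob J \<Longrightarrow> \<exists>l\<in>Ob J. \<exists>u\<in>Hom J i l. \<exists>v\<in>Hom J j l. True"
  using filtered unfolding filtered_def by blast

lemma coequalize: "i \<in> Ob J \<Longrightarrow> j \<in> Ob J \<Longrightarrow> u \<in> Hom J i j \<Longrightarrow> v \<in> Hom J i j \<Longrightarrow>
    \<exists>l\<in>Ob J. \<exists>w\<in>Hom J j l. w \<cdot>\<^bsub>J\<^esub> u = w \<cdot>\<^bsub>J\<^esub> v"
  using filtered unfolding filtered_def by blast

text \<open>Filteredness completes a span to a commutative square: join the two targets, then
  coequalize the two composites out of \<open>l\<close>.\<close>

lemma merge: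
  assumes "l \<in> Ob J" "l1 \<in> Ob J" "l2 \<in> Ob J" "p1 \<in> Hom J l l1" "p2 \<in> Hom J l l2"
  shows "\<exists>l3\<in>Ob J. \<exists>r1\<in>Hom J l1 l3. \<exists>r2\<in>Hom J l2 l3. r1 \<cdot>\<^bsub>J\<^esub> p1 = r2 \<cdot>\<^bsub>J\<^esub> p2"
proof -
  obtain m a b where m: "m \<in> Ob J" "a \<in> Hom J l1 m" "b \<in> Hom J l2 m" using join assms by blast
  obtain n w where n: "n \<in> Ob J" "w \<in> Hom J m n" "w \<cdot>\<^bsub>J\<^esub> (a \<cdot>\<^bsub>J\<^esub> p1) = w \<cdot>\<^bsub>J\<^esub> (b \<cdot>\<^bsub>J\<^esub> p2)"
    using coequalize[of l m "a \<cdot>\<^bsub>J\<^esub> p1" "b \<cdot>\<^bsub>J\<^esub> p2"] J.Comp_Hom assms m by blast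
  have "(w \<cdot>\<^bsub>J\<^esub> a) \<cdot>\<^bsub>J\<^esub> p1 = (w \<cdot>\<^bsub>J\<^esub> b) \<cdot>\<^bsub>J\<^esub> p2"
    using n(3) J.Comp_assoc[OF assms(1,2) m(1) n(1) assms(4) m(2) n(2)]
      J.Comp_assoc[OF assms(1,3) m(1) n(1) assms(5) m(3) n(2)] by simp
  then show ?thesis using J.Comp_Hom[OF assms(2) m(1) n(1) m(2) n(2)]
      J.Comp_Hom[OF assms(3) m(1) n(1) m(3) n(2)] n(1) by blast
qed

text \<open>The arrows \<open>u i\<close> are chosen freely: for an arrow a from i to j, nothing
  relates \<open>u i\<close> to the composite of a with \<open>u j\<close>. Such relations are
  forced later by composing with a further arrow out of \<open>l\<close>.\<close>

definition typed where
  "typed l u A \<longleftrightarrow> l \<in> Ob J \<and> (\<forall>i\<in>A. i \<in> Ob J \<and> u i \<in> Hom J i l)"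

lemma typed_Comp: "typed l u A \<Longrightarrow> l' \<in> Ob J \<Longrightarrow> p \<in> Hom J l l' \<Longrightarrow> typed l' (\<lambda>i. p \<cdot>\<^bsub>J\<^esub> u i) A"
  unfolding typed_def using J.Comp_Hom by blast

text \<open>Each new index is joined with the current target, so the old arrows change by one common
  composition. Transitivity of \<open>rel\<close> calls for this, because the middle word may carry
  indices foreign to the outer two.\<close>

lemma typed_extend:
  assumes "typed l u A" "finite B" "B \<subseteq> Ob J"
  shows "\<exists>l'\<in>Ob J. \<exists>p\<in>Hom J l l'. \<exists>u'. typed l' u' (A \<union> B) \<and> (\<forall>i\<in>A. u' i = p \<cdot>\<^bsub>J\<^esub> u i)"
  using assms(2,3)
proof (induction B rule: finite_induct)
  case empty
  have "l \<in> Ob J" using assms(1) by (simp add: typed_def)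
  then show ?case
    using typed_Comp[OF assms(1) _ J.Id_Hom]
    by (intro bexI[of _ l] bexI[of _ "Ident J l"] exI[of _ "\<lambda>i. Ident J l \<cdot>\<^bsub>J\<^esub> u i"]) (auto intro: J.Id_Hom)
next
  case (insert b B)
  then obtain m p v where m: "m \<in> Ob J" "p \<in> Hom J l m" "typed m v (A \<union> B)" "\<forall>i\<in>A. v i = p \<cdot>\<^bsub>J\<^esub> u i"
    by auto
  show ?case
  proof (cases "b \<in> A \<union> B")
    case True
    then have "A \<union> insert b B = A \<union> B" by blast
    then show ?thesis using m by metis
  next
    case False
    obtain n q r where n: "n \<in> Ob J" "q \<in> Hom J m n" "r \<in> Hom J b n" using join[of m b] m insert by auto
    let ?v = "(\<lambda>i. q \<cdot>\<^bsub>J\<^esub> v i)(b := r)"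
    have l: "l \<in> Ob J" and A: "i \<in> A \<Longrightarrow> i \<in> Ob J \<and> u i \<in> Hom J i l" for i
      using assms(1) by (auto simp: typed_def)
    have "typed n ?v (A \<union> insert b B)"
      using typed_Comp[OF m(3) n(1,2)] n insert unfolding typed_def by auto
    moreover have "?v i = (q \<cdot>\<^bsub>J\<^esub> p) \<cdot>\<^bsub>J\<^esub> u i" if "i \<in> A" for i
    proof -
      have "(q \<cdot>\<^bsub>J\<^esub> p) \<cdot>\<^bsub>J\<^esub> u i = q \<cdot>\<^bsub>J\<^esub> (p \<cdot>\<^bsub>J\<^esub> u i)" using J.Comp_assoc[of i l m n "u i" p q] A[OF that] l m n by blast
      then show ?thesis using m(4) that False by auto
    qed
    moreover have "q \<cdot>\<^bsub>J\<^esub> p \<in> Hom J l n" using J.Comp_Hom[OF l m(1) n(1) m(2) n(2)] .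
    ultimately show ?thesis using n(1) by blast
  qed
qed

text \<open>The zero map is a default for arrows of the wrong type: between objects of the shape
  \<open>leg l u i\<close> is then always a chain map, and the lemmas on \<open>word_sum\<close>
  apply without a condition on \<open>u\<close>.\<close>

definition leg where
  "leg l u i = (if u i \<in> Hom J i l then darr F (u i) else zero_map (dob F i) (dob F l))"

lemma leg_typed: "u i \<in> Hom J i l \<Longrightarrow> leg l u i = darr F (u i)"
  by (simp add: leg_def)

abbreviation total where
  "total \<alpha> l u \<equiv> word_sum (dob F l) (leg l u) \<alpha>"

abbreviation indices where "indices w \<equiv> fst ` set w"

lemma indices_words: "w \<in> words \<alpha> \<Longrightarrow> indices w \<subseteq> Ob J"
  unfolding words_def by auto

lemma leg_in: "l \<in> Ob J \<Longrightarrow> i \<in> Ob J \<Longrightarrow> leg l u i \<in> maps (dob F i) (dob F l)"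
  unfolding leg_def using darr_in zero_map_in D_chain by auto

lemma total_closed: "w \<in> words \<alpha> \<Longrightarrow> \<alpha> \<in> ON \<Longrightarrow> l \<in> Ob J \<Longrightarrow> total \<alpha> l u w \<in> car (dob F l) \<alpha>"
  using word_sum_closed[OF D_chain leg_in] .

lemma total_append: "w \<in> words \<alpha> \<Longrightarrow> v \<in> words \<alpha> \<Longrightarrow> \<alpha> \<in> ON \<Longrightarrow> l \<in> Ob J \<Longrightarrow>
    total \<alpha> l u (w @ v) = total \<alpha> l u w \<oplus>\<^bsub>vsp (dob F l) \<alpha>\<^esub> total \<alpha> l u v"
  using word_sum_append[OF D_chain leg_in] .

lemma total_cong: "(\<And>i. i \<in> indices w \<Longrightarrow> u i = u' i) \<Longrightarrow> total \<alpha> l u w = total \<alpha> l u' w"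
proof (induction w)
  case (Cons a w)
  obtain i x where a: "a = (i, x)" by fastforce
  then have "leg l u i = leg l u' i" using Cons(2)[of i] by (simp add: leg_def)
  then show ?case using Cons a by simp
qed simp

lemma total_Comp:
  assumes "w \<in> words \<alpha>" "typed l u (indices w)" "l' \<in> Ob J" "p \<in> Hom J l l'" "\<alpha> \<in> ON"
  shows "total \<alpha> l' (\<lambda>i. p \<cdot>\<^bsub>J\<^esub> u i) w = component (darr F p) \<alpha> (total \<alpha> l u w)"
  using assms(1,2)
proof (induction w rule: words_induct)
  case Nil
  have l: "l \<in> Ob J" using assms(2) by (simp add: typed_def)
  show ?case using cm_zero[OF darr_in[OF l assms(3,4)] D_chain D_chain assms(5)] l assms(3) by simp
next
  case (Cons i x w)
  have h: "l \<in> Ob J" "u i \<in> Hom J i l" "typed l u (indices w)" using Cons(5) by (auto simp: typed_def)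
  have pu: "p \<cdot>\<^bsub>J\<^esub> u i \<in> Hom J i l'" using J.Comp_Hom[OF Cons(1) h(1) assms(3) h(2) assms(4)] .
  show ?case
    using Cons h pu total_closed[OF Cons(3) assms(5) h(1)] cm_closed[OF darr_in[OF Cons(1) h(1,2)] assms(5) Cons(2)]
      component_darr_Comp[OF Cons(1) h(1) assms(3) h(2) assms(4,5) Cons(2)]
      cm_add[OF darr_in[OF h(1) assms(3,4)] assms(5)]
    by (simp add: leg_typed)
qed

text \<open>An equality reached at \<open>l'\<close> survives further transport, so equalities found
  at different indices can be compared at a later one.\<close>

lemma total_eq_Comp:
  assumes "w \<in> words \<alpha>" "v \<in> words \<alpha>" "typed l u (indices w \<union> indices v)" "l' \<in> Ob J" "l'' \<in> Ob J"
    "p \<in> Hom J l l'" "q \<in> Hom J l' l''" "\<alpha> \<in> ON"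
    and eq: "total \<alpha> l' (\<lambda>i. p \<cdot>\<^bsub>J\<^esub> u i) w = total \<alpha> l' (\<lambda>i. p \<cdot>\<^bsub>J\<^esub> u i) v"
  shows "total \<alpha> l'' (\<lambda>i. (q \<cdot>\<^bsub>J\<^esub> p) \<cdot>\<^bsub>J\<^esub> u i) w = total \<alpha> l'' (\<lambda>i. (q \<cdot>\<^bsub>J\<^esub> p) \<cdot>\<^bsub>J\<^esub> u i) v"
proof -
  have l: "l \<in> Ob J" and ty: "typed l u (indices w)" "typed l u (indices v)"
    using assms(3) by (auto simp: typed_def)
  have c: "total \<alpha> l'' (\<lambda>i. (q \<cdot>\<^bsub>J\<^esub> p) \<cdot>\<^bsub>J\<^esub> u i) z = component (darr F q) \<alpha> (total \<alpha> l' (\<lambda>i. p \<cdot>\<^bsub>J\<^esub> u i) z)"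
    if "z \<in> words \<alpha>" "typed l u (indices z)" for z
    unfolding total_Comp[OF that assms(4,6,8)]
      total_Comp[OF that assms(5) J.Comp_Hom[OF l assms(4,5,6,7)] assms(8)]
    by (rule component_darr_Comp[OF l assms(4,5,6,7,8) total_closed[OF that(1) assms(8) l]])
  show ?thesis unfolding c[OF assms(1) ty(1)] c[OF assms(2) ty(2)] eq ..
qed

text \<open>Induction on the congruence, for all choices \<open>u\<close> at once. The clauses
  \<open>trans\<close>, \<open>append\<close> and \<open>arrow\<close> use filteredness in different
  ways: by extending \<open>u\<close> to more indices, by completing a span to a square, and by
  coequalizing parallel arrows.\<close>

lemma total_rel:
  "rel \<alpha> w v \<Longrightarrow> \<alpha> \<in> ON \<Longrightarrow> typed l u (indices w \<union> indices v) \<Longrightarrow>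
    \<exists>l'\<in>Ob J. \<exists>p\<in>Hom J l l'. total \<alpha> l' (\<lambda>i. p \<cdot>\<^bsub>J\<^esub> u i) w = total \<alpha> l' (\<lambda>i. p \<cdot>\<^bsub>J\<^esub> u i) v"
proof (induction arbitrary: l u rule: rel.induct)
  case (refl w)
  then show ?case using J.Id_Hom unfolding typed_def by blast
next
  case (sym w v)
  then show ?case by (metis sup_commute)
next
  case (trans w v z)
  have words: "w \<in> words \<alpha>" "v \<in> words \<alpha>" "z \<in> words \<alpha>" using trans rel_words by blast+
  have l: "l \<in> Ob J" and uty: "\<And>i. i \<in> indices w \<union> indices z \<Longrightarrow> i \<in> Ob J \<and> u i \<in> Hom J i l"
    using trans(6) by (auto simp: typed_def)
  \<comment> \<open>Extends the choice to the indices of the middle word, at the cost of composing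
    with q.\<close>
  obtain l0 q u0 where 0: "l0 \<in> Ob J" "q \<in> Hom J l l0" "typed l0 u0 (indices w \<union> indices z \<union> indices v)"
    "\<And>i. i \<in> indices w \<union> indices z \<Longrightarrow> u0 i = q \<cdot>\<^bsub>J\<^esub> u i"
    using typed_extend[OF trans(6), of "indices v"] indices_words[OF words(2)] by auto
  have ty0: "typed l0 u0 (indices w \<union> indices v)" using 0(3) by (auto simp: typed_def)
  obtain l1 p1 where 1: "l1 \<in> Ob J" "p1 \<in> Hom J l0 l1"
    "total \<alpha> l1 (\<lambda>i. p1 \<cdot>\<^bsub>J\<^esub> u0 i) w = total \<alpha> l1 (\<lambda>i. p1 \<cdot>\<^bsub>J\<^esub> u0 i) v"
    using trans(3)[OF trans(5) ty0] by blast
  have "typed l1 (\<lambda>i. p1 \<cdot>\<^bsub>J\<^esub> u0 i) (indices w \<union> indices z \<union> indices v)" using typed_Comp[OF 0(3) 1(1,2)] .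
  then have "typed l1 (\<lambda>i. p1 \<cdot>\<^bsub>J\<^esub> u0 i) (indices v \<union> indices z)" by (auto simp: typed_def)
  then obtain l2 p2 where 2: "l2 \<in> Ob J" "p2 \<in> Hom J l1 l2"
    "total \<alpha> l2 (\<lambda>i. p2 \<cdot>\<^bsub>J\<^esub> (p1 \<cdot>\<^bsub>J\<^esub> u0 i)) v = total \<alpha> l2 (\<lambda>i. p2 \<cdot>\<^bsub>J\<^esub> (p1 \<cdot>\<^bsub>J\<^esub> u0 i)) z"
    using trans(4)[OF trans(5)] by blast
  let ?p = "p2 \<cdot>\<^bsub>J\<^esub> p1"
  have p: "?p \<in> Hom J l0 l2" using J.Comp_Hom[OF 0(1) 1(1) 2(1) 1(2) 2(2)] .
  have assoc0: "p2 \<cdot>\<^bsub>J\<^esub> (p1 \<cdot>\<^bsub>J\<^esub> u0 i) = ?p \<cdot>\<^bsub>J\<^esub> u0 i" if "i \<in> indices w \<union> indices z \<union> indices v" for i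
    using J.Comp_assoc[of i l0 l1 l2 "u0 i" p1 p2] that 0 1 2 unfolding typed_def by auto
  have assoc: "?p \<cdot>\<^bsub>J\<^esub> u0 i = (?p \<cdot>\<^bsub>J\<^esub> q) \<cdot>\<^bsub>J\<^esub> u i" if "i \<in> indices w \<union> indices z" for i
    using J.Comp_assoc[of i l l0 l2 "u i" q ?p] that 0 2 p l uty by simp
  have "total \<alpha> l2 (\<lambda>i. (?p \<cdot>\<^bsub>J\<^esub> q) \<cdot>\<^bsub>J\<^esub> u i) w = total \<alpha> l2 (\<lambda>i. ?p \<cdot>\<^bsub>J\<^esub> u0 i) w"
    by (rule total_cong) (use assoc in auto)
  also have "\<dots> = total \<alpha> l2 (\<lambda>i. ?p \<cdot>\<^bsub>J\<^esub> u0 i) v"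
    by (rule total_eq_Comp[OF words(1,2) ty0 1(1) 2(1) 1(2) 2(2) trans(5) 1(3)])
  also have "\<dots> = total \<alpha> l2 (\<lambda>i. p2 \<cdot>\<^bsub>J\<^esub> (p1 \<cdot>\<^bsub>J\<^esub> u0 i)) v"
    by (rule total_cong) (use assoc0 in auto)
  also have "\<dots> = total \<alpha> l2 (\<lambda>i. p2 \<cdot>\<^bsub>J\<^esub> (p1 \<cdot>\<^bsub>J\<^esub> u0 i)) z" by (rule 2(3))
  also have "\<dots> = total \<alpha> l2 (\<lambda>i. (?p \<cdot>\<^bsub>J\<^esub> q) \<cdot>\<^bsub>J\<^esub> u i) z"
    by (rule total_cong) (use assoc assoc0 in auto)
  finally show ?case using 2(1) J.Comp_Hom[OF l 0(1) 2(1) 0(2) p] by blast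
next
  case (append w w' v v')
  have words: "w \<in> words \<alpha>" "w' \<in> words \<alpha>" "v \<in> words \<alpha>" "v' \<in> words \<alpha>" using append rel_words by blast+
  have l: "l \<in> Ob J" and ty: "typed l u (indices w \<union> indices w')" "typed l u (indices v \<union> indices v')"
    using append(6) by (auto simp: typed_def)
  obtain l1 p1 where 1: "l1 \<in> Ob J" "p1 \<in> Hom J l l1"
    "total \<alpha> l1 (\<lambda>i. p1 \<cdot>\<^bsub>J\<^esub> u i) w = total \<alpha> l1 (\<lambda>i. p1 \<cdot>\<^bsub>J\<^esub> u i) w'"
    using append(3)[OF append(5) ty(1)] by blast
  obtain l2 p2 where 2: "l2 \<in> Ob J" "p2 \<in> Hom J l l2"
    "total \<alpha> l2 (\<lambda>i. p2 \<cdot>\<^bsub>J\<^esub> u i) v = total \<alpha> l2 (\<lambda>i. p2 \<cdot>\<^bsub>J\<^esub> u i) v'"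
    using append(4)[OF append(5) ty(2)] by blast
  \<comment> \<open>The two halves become equal along different arrows; a commutative square yields
    one arrow that serves both.\<close>
  obtain l3 r1 r2 where 3: "l3 \<in> Ob J" "r1 \<in> Hom J l1 l3" "r2 \<in> Hom J l2 l3" "r1 \<cdot>\<^bsub>J\<^esub> p1 = r2 \<cdot>\<^bsub>J\<^esub> p2"
    using merge[OF l 1(1) 2(1) 1(2) 2(2)] by blast
  have "total \<alpha> l3 (\<lambda>i. (r1 \<cdot>\<^bsub>J\<^esub> p1) \<cdot>\<^bsub>J\<^esub> u i) w = total \<alpha> l3 (\<lambda>i. (r1 \<cdot>\<^bsub>J\<^esub> p1) \<cdot>\<^bsub>J\<^esub> u i) w'"
    by (rule total_eq_Comp[OF words(1,2) ty(1) 1(1) 3(1) 1(2) 3(2) append(5) 1(3)])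
  moreover have "total \<alpha> l3 (\<lambda>i. (r1 \<cdot>\<^bsub>J\<^esub> p1) \<cdot>\<^bsub>J\<^esub> u i) v = total \<alpha> l3 (\<lambda>i. (r1 \<cdot>\<^bsub>J\<^esub> p1) \<cdot>\<^bsub>J\<^esub> u i) v'"
    unfolding 3(4) by (rule total_eq_Comp[OF words(3,4) ty(2) 2(1) 3(1) 2(2) 3(3) append(5) 2(3)])
  ultimately have "total \<alpha> l3 (\<lambda>i. (r1 \<cdot>\<^bsub>J\<^esub> p1) \<cdot>\<^bsub>J\<^esub> u i) (w @ v) = total \<alpha> l3 (\<lambda>i. (r1 \<cdot>\<^bsub>J\<^esub> p1) \<cdot>\<^bsub>J\<^esub> u i) (w' @ v')"
    using total_append words append(5) 3(1) by simp
  then show ?case using 3(1) J.Comp_Hom[OF l 1(1) 3(1) 1(2) 3(2)] by blast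
next
  case (commute w v)
  then have l: "l \<in> Ob J" by (simp add: typed_def)
  interpret abelian_group "vsp (dob F l) \<alpha>" by (rule D_abelian_group[OF l commute(3)])
  have "total \<alpha> l (\<lambda>i. Ident J l \<cdot>\<^bsub>J\<^esub> u i) (w @ v) = total \<alpha> l (\<lambda>i. Ident J l \<cdot>\<^bsub>J\<^esub> u i) (v @ w)"
    using commute l total_append total_closed by (simp add: a_comm)
  then show ?case using J.Id_Hom[OF l] l by blast
next
  case (add i x y)
  then have l: "l \<in> Ob J" by (simp add: typed_def)
  interpret abelian_group "vsp (dob F l) \<alpha>" by (rule D_abelian_group[OF l add(4)])
  let ?u = "\<lambda>i. Ident J l \<cdot>\<^bsub>J\<^esub> u i"
  have "total \<alpha> l ?u [(i, x), (i, y)] = total \<alpha> l ?u [(i, x \<oplus>\<^bsub>vsp (dob F i) \<alpha>\<^esub> y)]"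
    using add cm_closed[OF leg_in[OF l add(1)]] cm_add[OF leg_in[OF l add(1)]] by (simp add: a_assoc)
  then show ?case using J.Id_Hom[OF l] l by blast
next
  case (zero i)
  then have l: "l \<in> Ob J" by (simp add: typed_def)
  interpret abelian_group "vsp (dob F l) \<alpha>" by (rule D_abelian_group[OF l zero(2)])
  let ?u = "\<lambda>i. Ident J l \<cdot>\<^bsub>J\<^esub> u i"
  have "total \<alpha> l ?u [(i, \<zero>\<^bsub>vsp (dob F i) \<alpha>\<^esub>)] = total \<alpha> l ?u []"
    using zero cm_zero[OF leg_in[OF l zero(1)] D_chain D_chain] l by simp
  then show ?case using J.Id_Hom[OF l] l by blast
next
  case (arrow i j f x)
  then obtain a where a: "i \<in> Ob J" "j \<in> Ob J" "a \<in> Hom J i j" "f = darr F a" by (auto simp: arrows_def)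
  have l: "l \<in> Ob J" "u i \<in> Hom J i l" "u j \<in> Hom J j l" using arrow(4) by (auto simp: typed_def)
  \<comment> \<open>\<open>u i\<close> and the composite of a with \<open>u j\<close> may be
    different arrows from i to l; they are made equal here.\<close>
  obtain m p where p: "m \<in> Ob J" "p \<in> Hom J l m" "p \<cdot>\<^bsub>J\<^esub> u i = p \<cdot>\<^bsub>J\<^esub> (u j \<cdot>\<^bsub>J\<^esub> a)"
    using coequalize[OF a(1) l(1,2) J.Comp_Hom[OF a(1,2) l(1) a(3) l(3)]] by blast
  have pu: "p \<cdot>\<^bsub>J\<^esub> u i \<in> Hom J i m" "p \<cdot>\<^bsub>J\<^esub> u j \<in> Hom J j m"
    using J.Comp_Hom[OF a(1) l(1) p(1) l(2) p(2)] J.Comp_Hom[OF a(2) l(1) p(1) l(3) p(2)] .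
  have "p \<cdot>\<^bsub>J\<^esub> u i = (p \<cdot>\<^bsub>J\<^esub> u j) \<cdot>\<^bsub>J\<^esub> a" using p(3) J.Comp_assoc[OF a(1,2) l(1) p(1) a(3) l(3) p(2)] by simp
  then have "component (darr F (p \<cdot>\<^bsub>J\<^esub> u i)) \<alpha> x = component (darr F (p \<cdot>\<^bsub>J\<^esub> u j)) \<alpha> (component f \<alpha> x)"
    using component_darr_Comp[OF a(1,2) p(1) a(3) pu(2) arrow(3,2)] a(4) by simp
  then have "total \<alpha> m (\<lambda>i. p \<cdot>\<^bsub>J\<^esub> u i) [(i, x)] = total \<alpha> m (\<lambda>i. p \<cdot>\<^bsub>J\<^esub> u i) [(j, component f \<alpha> x)]"
    using pu by (simp add: leg_def)
  then show ?case using p by blast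
qed

section \<open>Elements of filtered colimits\<close>

lemma coproj_eq_zero:
  assumes i: "i \<in> Ob J" and \<alpha>: "\<alpha> \<in> ON" and x: "x \<in> car (dob F i) \<alpha>"
    and eq: "component (coproj i) \<alpha> x = \<zero>\<^bsub>vsp colim \<alpha>\<^esub>"
  shows "\<exists>j\<in>Ob J. \<exists>u\<in>Hom J i j. component (darr F u) \<alpha> x = \<zero>\<^bsub>vsp (dob F j) \<alpha>\<^esub>"
proof -
  have r: "rel \<alpha> [(i, x)] []" using eq i x \<alpha> by (simp add: zero_colim cls_eq_iff)
  \<comment> \<open>A single index occurs in the two words, so its identity arrow is a valid
    choice.\<close>
  have "typed i (\<lambda>_. Ident J i) (indices [(i, x)] \<union> indices [])"
    using i J.Id_Hom by (simp add: typed_def)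
  then obtain j p where j: "j \<in> Ob J" "p \<in> Hom J i j"
    "total \<alpha> j (\<lambda>_. p \<cdot>\<^bsub>J\<^esub> Ident J i) [(i, x)] = total \<alpha> j (\<lambda>_. p \<cdot>\<^bsub>J\<^esub> Ident J i) []"
    using total_rel[OF r \<alpha>] by blast
  interpret abelian_group "vsp (dob F j) \<alpha>" by (rule D_abelian_group[OF j(1) \<alpha>])
  have "component (darr F p) \<alpha> x = \<zero>\<^bsub>vsp (dob F j) \<alpha>\<^esub>"
    using j cm_closed[OF darr_in[OF i j(1,2)] \<alpha> x] J.Comp_Id[OF i j(1,2)] by (simp add: leg_def)
  then show ?thesis using j by blast
qed

lemma coproj_darr:
  assumes "i \<in> Ob J" "j \<in> Ob J" "u \<in> Hom J i j" "\<alpha> \<in> ON" "x \<in> car (dob F i) \<alpha>"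
  shows "component (coproj j) \<alpha> (component (darr F u) \<alpha> x) = component (coproj i) \<alpha> x"
proof -
  have "coproj j \<circ>\<^sub>c darr F u = coproj i"
    by (rule coproj_arrow) (use assms in \<open>auto simp: arrows_def\<close>)
  then show ?thesis using component_comp[OF darr_in[OF assms(1-3)] assms(4,5)] by metis
qed

text \<open>Elements from two indices are added after transport to a common one; zero comes from any
  index, the shape being non-empty.\<close>

lemma coproj_surj:
  assumes \<alpha>: "\<alpha> \<in> ON" and y: "y \<in> car colim \<alpha>"
  shows "\<exists>i\<in>Ob J. \<exists>x\<in>car (dob F i) \<alpha>. y = component (coproj i) \<alpha> x"
proof -
  let ?H = "{y. \<exists>i\<in>Ob J. \<exists>x\<in>car (dob F i) \<alpha>. y = component (coproj i) \<alpha> x}"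
  have "car colim \<alpha> \<subseteq> ?H"
  proof (rule colim_subset[OF \<alpha>])
    obtain i where i: "i \<in> Ob J" using filtered unfolding filtered_def by blast
    interpret abelian_group "vsp (dob F i) \<alpha>" by (rule D_abelian_group[OF i \<alpha>])
    show "\<zero>\<^bsub>vsp colim \<alpha>\<^esub> \<in> ?H"
      using i cm_zero[OF coproj_in[OF i] D_chain[OF i] is_chain_colim \<alpha>] zero_closed by force
  next
    fix a b assume "a \<in> ?H" "b \<in> ?H"
    then obtain i x j y where h: "i \<in> Ob J" "x \<in> car (dob F i) \<alpha>" "a = component (coproj i) \<alpha> x"
      "j \<in> Ob J" "y \<in> car (dob F j) \<alpha>" "b = component (coproj j) \<alpha> y" by blast
    obtain l u v where l: "l \<in> Ob J" "u \<in> Hom J i l" "v \<in> Hom J j l" using join h by blast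
    interpret abelian_group "vsp (dob F l) \<alpha>" by (rule D_abelian_group[OF l(1) \<alpha>])
    let ?x = "component (darr F u) \<alpha> x" and ?y = "component (darr F v) \<alpha> y"
    have cl: "?x \<in> car (dob F l) \<alpha>" "?y \<in> car (dob F l) \<alpha>"
      using cm_closed[OF darr_in \<alpha>] h l by blast+
    have "a \<oplus>\<^bsub>vsp colim \<alpha>\<^esub> b = component (coproj l) \<alpha> (?x \<oplus>\<^bsub>vsp (dob F l) \<alpha>\<^esub> ?y)"
      unfolding cm_add[OF coproj_in[OF l(1)] \<alpha> cl] coproj_darr[OF h(1) l(1,2) \<alpha> h(2)]
        coproj_darr[OF h(4) l(1,3) \<alpha> h(5)] h(3,6) ..
    then show "a \<oplus>\<^bsub>vsp colim \<alpha>\<^esub> b \<in> ?H" using l(1) cl by blast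
  qed blast
  then show ?thesis using y by blast
qed

text \<open>Exactness is asserted for arbitrary colimits, so the facts about \<open>colim\<close>
  are carried over by the comparison maps h and g. Uniqueness of factorisations makes h after g the
  identity of L, which gives representatives; vanishing is transported by g, which takes each
  \<open>s i\<close> to \<open>coproj i\<close>.\<close>

lemma colimit_elements:
  assumes "is_colimit J \<C> F L s" and \<alpha>: "\<alpha> \<in> ON"
  shows "y \<in> car L \<alpha> \<Longrightarrow> \<exists>i\<in>Ob J. \<exists>x\<in>car (dob F i) \<alpha>. y = component (s i) \<alpha> x"
    and "i \<in> Ob J \<Longrightarrow> x \<in> car (dob F i) \<alpha> \<Longrightarrow> component (s i) \<alpha> x = \<zero>\<^bsub>vsp L \<alpha>\<^esub> \<Longrightarrow>
      \<exists>j\<in>Ob J. \<exists>u\<in>Hom J i j. component (darr F u) \<alpha> x = \<zero>\<^bsub>vsp (dob F j) \<alpha>\<^esub>"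
proof -
  have cL: "is_cocone J \<C> F L s"
    and cC: "is_cocone J \<C> F colim coproj"
    using assms(1) is_colimit_colim by (auto simp: is_colimit_def)
  have L: "is_chain k L" and s: "\<And>i. i \<in> Ob J \<Longrightarrow> s i \<in> maps (dob F i) L"
    using cL unfolding is_cocone_iff by blast+
  obtain h where h: "h \<in> maps colim L" "\<And>i. i \<in> Ob J \<Longrightarrow> h \<circ>\<^sub>c coproj i = s i"
    using is_colimit_colim cL unfolding is_colimit_def Hom_grounded by blast
  obtain g where g: "g \<in> maps L colim" "\<And>i. i \<in> Ob J \<Longrightarrow> g \<circ>\<^sub>c s i = coproj i"
    using assms(1) cC unfolding is_colimit_def Hom_grounded by blast
  interpret C: category "\<C>" by (rule category_grounded_chains)
  have "h \<circ>\<^sub>c g = Ident \<C> L"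
  proof -
    have "\<exists>!e. e \<in> maps L L \<and> (\<forall>i\<in>Ob J. e \<circ>\<^sub>c s i = s i)"
      using assms(1) cL unfolding is_colimit_def Hom_grounded by blast
    moreover have "h \<circ>\<^sub>c g \<in> maps L L" using comp_in[OF g(1) h(1) L] .
    moreover have "(h \<circ>\<^sub>c g) \<circ>\<^sub>c s i = s i" if i: "i \<in> Ob J" for i
      using C.Comp_assoc[of "dob F i" L colim L "s i" g h] g(2)[OF i] h(2)[OF i] s[OF i] g(1) h(1)
        cL cC dob_grchain[OF i] unfolding is_cocone_iff Ob_grounded Hom_grounded by simp
    moreover have "Ident \<C> L \<circ>\<^sub>c s i = s i" if i: "i \<in> Ob J" for i
      using C.Id_Comp[of "dob F i" L "s i"] s[OF i] cL dob_grchain[OF i]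
      unfolding is_cocone_iff Ob_grounded Hom_grounded by simp
    ultimately show ?thesis using Ident_in[OF L] by blast
  qed
  then have hg: "component h \<alpha> (component g \<alpha> y) = y" if "y \<in> car L \<alpha>" for y
    using component_comp[OF g(1) \<alpha> that, of h] component_Ident[OF \<alpha> that] by simp
  have hc: "component h \<alpha> (component (coproj i) \<alpha> x) = component (s i) \<alpha> x"
    if "i \<in> Ob J" "x \<in> car (dob F i) \<alpha>" for i x
    using component_comp[OF coproj_in[OF that(1)] \<alpha> that(2), of h] h(2)[OF that(1)] by simp
  have gs: "component g \<alpha> (component (s i) \<alpha> x) = component (coproj i) \<alpha> x"
    if "i \<in> Ob J" "x \<in> car (dob F i) \<alpha>" for i x
    using component_comp[OF s[OF that(1)] \<alpha> that(2), of g] g(2)[OF that(1)] by simp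
  show "\<exists>i\<in>Ob J. \<exists>x\<in>car (dob F i) \<alpha>. y = component (s i) \<alpha> x"
    if y: "y \<in> car L \<alpha>"
  proof -
    obtain i x where i: "i \<in> Ob J" "x \<in> car (dob F i) \<alpha>" "component g \<alpha> y = component (coproj i) \<alpha> x"
      using coproj_surj[OF \<alpha> cm_closed[OF g(1) \<alpha> y]] by blast
    have "y = component (s i) \<alpha> x" using hg[OF y] hc[OF i(1,2)] i(3) by simp
    then show ?thesis using i by blast
  qed
  show "\<exists>j\<in>Ob J. \<exists>u\<in>Hom J i j. component (darr F u) \<alpha> x = \<zero>\<^bsub>vsp (dob F j) \<alpha>\<^esub>"
    if i: "i \<in> Ob J" "x \<in> car (dob F i) \<alpha>" and z: "component (s i) \<alpha> x = \<zero>\<^bsub>vsp L \<alpha>\<^esub>"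
    using coproj_eq_zero[OF i(1) \<alpha> i(2)] gs[OF i] cm_zero[OF g(1) L is_chain_colim \<alpha>] z by simp
qed

end

lemma (in tower) cocomplete_grounded_chains: "cocomplete TYPE('v) \<C>"
  unfolding cocomplete_def
proof (intro allI impI)
  fix J :: "('v, 'v) category" and F
  assume h: "small_category J \<and> is_diagram J \<C> F"
  interpret chain_diagram k J F by standard (use h in auto)
  show "\<exists>L s. is_colimit J \<C> F L s" using is_colimit_colim by blast
qed

section \<open>The abelian structure\<close>

context tower
begin

subsection \<open>Pointwise criteria\<close>

lemma cm_a_minus:
  assumes "f \<in> maps V W" "is_chain k V" "is_chain k W" "\<alpha> \<in> ON"
    "x \<in> car V \<alpha>" "y \<in> car V \<alpha>"
  shows "component f \<alpha> (x \<ominus>\<^bsub>vsp V \<alpha>\<^esub> y) = component f \<alpha> x \<ominus>\<^bsub>vsp W \<alpha>\<^esub> component f \<alpha> y"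
proof -
  interpret V: abelian_group "vsp V \<alpha>" using assms chain_abelian_group by blast
  interpret W: abelian_group "vsp W \<alpha>" using assms chain_abelian_group by blast
  note cl = cm_closed[OF assms(1,4)]
  have "x = (x \<ominus>\<^bsub>vsp V \<alpha>\<^esub> y) \<oplus>\<^bsub>vsp V \<alpha>\<^esub> y"
    using assms(5,6) by (simp add: V.minus_eq V.a_assoc V.l_neg)
  then have "component f \<alpha> x = component f \<alpha> (x \<ominus>\<^bsub>vsp V \<alpha>\<^esub> y) \<oplus>\<^bsub>vsp W \<alpha>\<^esub> component f \<alpha> y"
    using cm_add[OF assms(1,4) V.minus_closed[OF assms(5,6)] assms(6)] by simp
  then show ?thesis
    using cl[OF V.minus_closed[OF assms(5,6)]] cl[OF assms(6)] by (simp add: W.minus_eq W.a_assoc W.r_neg)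
qed

lemma cm_inj_onI:
  assumes f: "f \<in> maps V W" "is_chain k V" "is_chain k W" "\<alpha> \<in> ON"
    and ker: "\<And>x. x \<in> car V \<alpha> \<Longrightarrow> component f \<alpha> x = \<zero>\<^bsub>vsp W \<alpha>\<^esub> \<Longrightarrow> x = \<zero>\<^bsub>vsp V \<alpha>\<^esub>"
  shows "inj_on (component f \<alpha>) (car V \<alpha>)"
proof (rule inj_onI)
  interpret V: abelian_group "vsp V \<alpha>" using assms chain_abelian_group by blast
  interpret W: abelian_group "vsp W \<alpha>" using assms chain_abelian_group by blast
  fix x y assume h: "x \<in> car V \<alpha>" "y \<in> car V \<alpha>" "component f \<alpha> x = component f \<alpha> y"
  then have "component f \<alpha> (x \<ominus>\<^bsub>vsp V \<alpha>\<^esub> y) = \<zero>\<^bsub>vsp W \<alpha>\<^esub>"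
    using cm_a_minus[OF f] cm_closed[OF f(1,4)] by (simp add: W.minus_eq W.r_neg)
  then have "x \<ominus>\<^bsub>vsp V \<alpha>\<^esub> y = \<zero>\<^bsub>vsp V \<alpha>\<^esub>" using ker V.minus_closed h by blast
  then show "x = y" by (rule V.minus_zero_imp_eq[OF h(1,2)])
qed

lemma comp_eq_iff:
  assumes "f \<in> maps U V" "g \<in> maps V W" "is_chain k U" "h \<in> maps U W"
  shows "g \<circ>\<^sub>c f = h \<longleftrightarrow> (\<forall>\<alpha>\<in>ON. \<forall>x\<in>car U \<alpha>. component g \<alpha> (component f \<alpha> x) = component h \<alpha> x)"
  using cm_eqI[OF comp_in[OF assms(1-3)] assms(4)] component_comp[OF assms(1)] by metis

text \<open>The factor is the pointwise preimage. As preimages under \<open>i\<close> are unique,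
  recognising one by its image (\<open>eq\<close>) yields linearity, compatibility with transition
  maps and uniqueness alike.\<close>

lemma factor_through_injective:
  assumes i: "i \<in> maps K A" "is_chain k K" and g: "g \<in> maps T A" "is_chain k T"
    and inj: "\<And>\<alpha>. \<alpha> \<in> ON \<Longrightarrow> inj_on (component i \<alpha>) (car K \<alpha>)"
    and im: "\<And>\<alpha> x. \<alpha> \<in> ON \<Longrightarrow> x \<in> car T \<alpha> \<Longrightarrow> component g \<alpha> x \<in> component i \<alpha> ` car K \<alpha>"
  shows "\<exists>!h. h \<in> maps T K \<and> i \<circ>\<^sub>c h = g"
proof -
  define \<phi> where "\<phi> \<alpha> x = inv_into (car K \<alpha>) (component i \<alpha>) (component g \<alpha> x)" for \<alpha> x
  have \<phi>: "\<phi> \<alpha> x \<in> car K \<alpha>" "component i \<alpha> (\<phi> \<alpha> x) = component g \<alpha> x"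
    if "\<alpha> \<in> ON" "x \<in> car T \<alpha>" for \<alpha> x
    unfolding \<phi>_def using im[OF that] by (rule inv_into_into, rule f_inv_into_f)
  have eq: "y = \<phi> \<alpha> x"
    if "\<alpha> \<in> ON" "x \<in> car T \<alpha>" "y \<in> car K \<alpha>" "component i \<alpha> y = component g \<alpha> x" for \<alpha> x y
    using inj_onD[OF inj[OF that(1)], of y "\<phi> \<alpha> x"] \<phi>[OF that(1,2)] that by simp
  have h: "mk_map T K \<phi> \<in> maps T K"
  proof (rule mk_map_in)
    fix \<alpha> x y assume a: "\<alpha> \<in> ON" "x \<in> car T \<alpha>" "y \<in> car T \<alpha>"
    interpret T: module "fld k \<alpha>" "vsp T \<alpha>" using chain_module g(2) a(1) .
    interpret K: module "fld k \<alpha>" "vsp K \<alpha>" using chain_module i(2) a(1) .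
    show "\<phi> \<alpha> x \<in> car K \<alpha>" using \<phi> a by simp
    show "\<phi> \<alpha> (x \<oplus>\<^bsub>vsp T \<alpha>\<^esub> y) = \<phi> \<alpha> x \<oplus>\<^bsub>vsp K \<alpha>\<^esub> \<phi> \<alpha> y"
      by (rule eq[symmetric]) (use a \<phi> cm_add[OF i(1)] cm_add[OF g(1)] in auto)
    show "\<phi> \<alpha> (c \<odot>\<^bsub>vsp T \<alpha>\<^esub> x) = c \<odot>\<^bsub>vsp K \<alpha>\<^esub> \<phi> \<alpha> x" if "c \<in> carrier (fld k \<alpha>)" for c
      by (rule eq[symmetric]) (use a that \<phi> cm_smult[OF i(1)] cm_smult[OF g(1)] in auto)
  next
    fix \<alpha> \<beta> x assume a: "ord_le \<alpha> \<beta>" "x \<in> car T \<alpha>"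
    show "\<phi> \<beta> (tmap T \<beta> \<alpha> x) = tmap K \<beta> \<alpha> (\<phi> \<alpha> x)"
      by (rule eq[symmetric])
         (use a ord_le_ON[OF a(1)] \<phi> cm_tmap[OF i(1)] cm_tmap[OF g(1)] tmap_closed[OF i(2)] tmap_closed[OF g(2)] in auto)
  qed (rule g(2))
  show ?thesis
  proof (rule ex1I)
    show "mk_map T K \<phi> \<in> maps T K \<and> i \<circ>\<^sub>c mk_map T K \<phi> = g"
      using h \<phi> by (simp add: comp_eq_iff[OF h i(1) g(2,1)])
  next
    fix h' assume h': "h' \<in> maps T K \<and> i \<circ>\<^sub>c h' = g"
    show "h' = mk_map T K \<phi>"
    proof (rule cm_eqI[OF conjunct1[OF h'] h])
      fix \<alpha> x assume a: "\<alpha> \<in> ON" "x \<in> car T \<alpha>"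
      then show "component h' \<alpha> x = component (mk_map T K \<phi>) \<alpha> x"
        using eq[OF a cm_closed[OF conjunct1[OF h'] a]] h'
          comp_eq_iff[OF conjunct1[OF h'] i(1) g(2,1)] by simp
    qed
  qed
qed

text \<open>The factor is g after a pointwise section r of q. The section need not be linear, but by
  the kernel condition g takes equal values on elements with the same image under q, so the
  composite does not depend on r and is linear.\<close>

lemma factor_through_surjective:
  assumes q: "q \<in> maps B Q" "is_chain k B" "is_chain k Q" and g: "g \<in> maps B T" "is_chain k T"
    and surj: "\<And>\<alpha>. \<alpha> \<in> ON \<Longrightarrow> component q \<alpha> ` car B \<alpha> = car Q \<alpha>"
    and ker: "\<And>\<alpha> x. \<alpha> \<in> ON \<Longrightarrow> x \<in> car B \<alpha> \<Longrightarrow> component q \<alpha> x = \<zero>\<^bsub>vsp Q \<alpha>\<^esub> \<Longrightarrow>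
      component g \<alpha> x = \<zero>\<^bsub>vsp T \<alpha>\<^esub>"
  shows "\<exists>!h. h \<in> maps Q T \<and> h \<circ>\<^sub>c q = g"
proof -
  define r where "r \<alpha> = inv_into (car B \<alpha>) (component q \<alpha>)" for \<alpha>
  have r: "r \<alpha> y \<in> car B \<alpha>" "component q \<alpha> (r \<alpha> y) = y"
    if "\<alpha> \<in> ON" "y \<in> car Q \<alpha>" for \<alpha> y
    unfolding r_def using that(2)[folded surj[OF that(1)]] by (rule inv_into_into, rule f_inv_into_f)
  have eq: "component g \<alpha> x = component g \<alpha> y"
    if a: "\<alpha> \<in> ON" "x \<in> car B \<alpha>" "y \<in> car B \<alpha>" and e: "component q \<alpha> x = component q \<alpha> y" for \<alpha> x y
  proof -
    interpret B: abelian_group "vsp B \<alpha>" using chain_abelian_group q(2) a(1) .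
    interpret Q: abelian_group "vsp Q \<alpha>" using chain_abelian_group q(3) a(1) .
    interpret T: abelian_group "vsp T \<alpha>" using chain_abelian_group g(2) a(1) .
    have "component q \<alpha> (x \<ominus>\<^bsub>vsp B \<alpha>\<^esub> y) = \<zero>\<^bsub>vsp Q \<alpha>\<^esub>"
      using cm_a_minus[OF q a] cm_closed[OF q(1) a(1)] a e by (simp add: Q.minus_eq Q.r_neg)
    then have "component g \<alpha> (x \<ominus>\<^bsub>vsp B \<alpha>\<^esub> y) = \<zero>\<^bsub>vsp T \<alpha>\<^esub>" using ker a B.minus_closed by blast
    then show ?thesis
      using T.minus_zero_imp_eq[OF cm_closed[OF g(1) a(1,2)] cm_closed[OF g(1) a(1,3)]]
        cm_a_minus[OF g(1) q(2) g(2) a] by simp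
  qed
  let ?h = "mk_map Q T (\<lambda>\<alpha> y. component g \<alpha> (r \<alpha> y))"
  have h: "?h \<in> maps Q T"
  proof (rule mk_map_in)
    fix \<alpha> x y assume a: "\<alpha> \<in> ON" "x \<in> car Q \<alpha>" "y \<in> car Q \<alpha>"
    interpret B: module "fld k \<alpha>" "vsp B \<alpha>" using chain_module q(2) a(1) .
    interpret Q: module "fld k \<alpha>" "vsp Q \<alpha>" using chain_module q(3) a(1) .
    note ra = r[OF a(1,2)] r[OF a(1,3)]
    show "component g \<alpha> (r \<alpha> x) \<in> car T \<alpha>" using cm_closed[OF g(1) a(1)] ra by simp
    have "component g \<alpha> (r \<alpha> (x \<oplus>\<^bsub>vsp Q \<alpha>\<^esub> y)) = component g \<alpha> (r \<alpha> x \<oplus>\<^bsub>vsp B \<alpha>\<^esub> r \<alpha> y)"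
      by (rule eq) (use a ra r cm_add[OF q(1)] in auto)
    then show "component g \<alpha> (r \<alpha> (x \<oplus>\<^bsub>vsp Q \<alpha>\<^esub> y)) = component g \<alpha> (r \<alpha> x) \<oplus>\<^bsub>vsp T \<alpha>\<^esub> component g \<alpha> (r \<alpha> y)"
      using cm_add[OF g(1) a(1)] ra by simp
    fix c assume c: "c \<in> carrier (fld k \<alpha>)"
    have "component g \<alpha> (r \<alpha> (c \<odot>\<^bsub>vsp Q \<alpha>\<^esub> x)) = component g \<alpha> (c \<odot>\<^bsub>vsp B \<alpha>\<^esub> r \<alpha> x)"
      by (rule eq) (use a c ra r cm_smult[OF q(1)] in auto)
    then show "component g \<alpha> (r \<alpha> (c \<odot>\<^bsub>vsp Q \<alpha>\<^esub> x)) = c \<odot>\<^bsub>vsp T \<alpha>\<^esub> component g \<alpha> (r \<alpha> x)"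
      using cm_smult[OF g(1) a(1) c] ra by simp
  next
    fix \<alpha> \<beta> x assume a: "ord_le \<alpha> \<beta>" "x \<in> car Q \<alpha>"
    note o = ord_le_ON[OF a(1)]
    note ra = r[OF o(1) a(2)]
    have "component g \<beta> (r \<beta> (tmap Q \<beta> \<alpha> x)) = component g \<beta> (tmap B \<beta> \<alpha> (r \<alpha> x))"
      by (rule eq) (use a o ra r cm_tmap[OF q(1)] tmap_closed[OF q(2)] tmap_closed[OF q(3)] in auto)
    then show "component g \<beta> (r \<beta> (tmap Q \<beta> \<alpha> x)) = tmap T \<beta> \<alpha> (component g \<alpha> (r \<alpha> x))"
      using cm_tmap[OF g(1) a(1)] ra by simp
  qed (rule q(3))
  show ?thesis
  proof (rule ex1I)
    have "component g \<alpha> (r \<alpha> (component q \<alpha> x)) = component g \<alpha> x" if "\<alpha> \<in> ON" "x \<in> car B \<alpha>" for \<alpha> x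
      by (rule eq) (use that r cm_closed[OF q(1)] in auto)
    then show "?h \<in> maps Q T \<and> ?h \<circ>\<^sub>c q = g"
      using h cm_closed[OF q(1)] by (simp add: comp_eq_iff[OF q(1) h q(2) g(1)])
  next
    fix h' assume h': "h' \<in> maps Q T \<and> h' \<circ>\<^sub>c q = g"
    show "h' = ?h"
    proof (rule cm_eqI[OF conjunct1[OF h'] h])
      fix \<alpha> x assume a: "\<alpha> \<in> ON" "x \<in> car Q \<alpha>"
      then show "component h' \<alpha> x = component ?h \<alpha> x"
        using h' r[OF a] comp_eq_iff[OF q(1) conjunct1[OF h'] q(2) g(1)] by fastforce
    qed
  qed
qed

subsection \<open>Zero object, coproducts and cokernels\<close>

text \<open>The colimit of the empty graph, over which the empty word is the only one.\<close>

lemma ex_trivial_chain: "\<exists>Z. grchain Z \<and> (\<forall>\<alpha>\<in>ON. car Z \<alpha> = {\<zero>\<^bsub>vsp Z \<alpha>\<^esub>})"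
proof -
  interpret chain_graph k "{}" undefined "{}" by standard (auto simp: small_empty)
  have "car colim \<alpha> = {\<zero>\<^bsub>vsp colim \<alpha>\<^esub>}" if \<alpha>: "\<alpha> \<in> ON" for \<alpha>
  proof -
    interpret module "fld k \<alpha>" "vsp colim \<alpha>" by (rule module_colim[OF \<alpha>])
    have "car colim \<alpha> \<subseteq> {\<zero>\<^bsub>vsp colim \<alpha>\<^esub>}" by (rule colim_subset[OF \<alpha>]) auto
    then show ?thesis by auto
  qed
  then show ?thesis using is_chain_colim grounded_colim by blast
qed

text \<open>A zero object has a single endomorphism, so its identity is the zero map and each of its
  elements is zero.\<close>

lemma zero_object_iff:
  "zero_object \<C> Z \<longleftrightarrow> grchain Z \<and> (\<forall>\<alpha>\<in>ON. car Z \<alpha> = {\<zero>\<^bsub>vsp Z \<alpha>\<^esub>})"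
proof
  assume z: "zero_object \<C> Z"
  then have Z: "grchain Z" and u: "\<exists>!f. f \<in> maps Z Z"
    unfolding zero_object_def Ob_grounded Hom_grounded by blast+
  have "zero_map Z Z = Ident \<C> Z" using u Z zero_map_in Ident_in by blast
  then have *: "x = \<zero>\<^bsub>vsp Z \<alpha>\<^esub>" if "\<alpha> \<in> ON" "x \<in> car Z \<alpha>" for \<alpha> x
    using component_zero_map[OF that, of Z] component_Ident[OF that] by simp
  have "car Z \<alpha> = {\<zero>\<^bsub>vsp Z \<alpha>\<^esub>}" if "\<alpha> \<in> ON" for \<alpha>
  proof -
    interpret abelian_group "vsp Z \<alpha>" using chain_abelian_group Z that by blast
    show ?thesis using *[OF that] by auto
  qed
  then show "grchain Z \<and> (\<forall>\<alpha>\<in>ON. car Z \<alpha> = {\<zero>\<^bsub>vsp Z \<alpha>\<^esub>})" using Z by blast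
next
  assume r: "grchain Z \<and> (\<forall>\<alpha>\<in>ON. car Z \<alpha> = {\<zero>\<^bsub>vsp Z \<alpha>\<^esub>})"
  then have Z: "is_chain k Z" and z: "\<And>\<alpha>. \<alpha> \<in> ON \<Longrightarrow> car Z \<alpha> = {\<zero>\<^bsub>vsp Z \<alpha>\<^esub>}" by auto
  have "(\<exists>!f. f \<in> maps Z A) \<and> (\<exists>!f. f \<in> maps A Z)" if A: "is_chain k A" for A
  proof
    show "\<exists>!f. f \<in> maps Z A"
      by (rule ex1I, rule zero_map_in[OF Z A], rule cm_eqI[OF _ zero_map_in[OF Z A]], assumption)
         (use z cm_zero[OF _ Z A] in auto)
    show "\<exists>!f. f \<in> maps A Z"
    proof (rule ex1I, rule zero_map_in[OF A Z])
      fix f assume f: "f \<in> maps A Z"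
      show "f = zero_map A Z"
      proof (rule cm_eqI[OF f zero_map_in[OF A Z]])
        fix \<alpha> x assume a: "\<alpha> \<in> ON" "x \<in> car A \<alpha>"
        then have "component f \<alpha> x = \<zero>\<^bsub>vsp Z \<alpha>\<^esub>" using cm_closed[OF f a] unfolding z[OF a(1)] by blast
        then show "component f \<alpha> x = component (zero_map A Z) \<alpha> x" using component_zero_map[OF a] by simp
      qed
    qed
  qed
  note u = this
  show "zero_object \<C> Z"
    unfolding zero_object_def Ob_grounded Hom_grounded
  proof (intro conjI ballI)
    fix A assume "A \<in> {V. grchain V}"
    then have "is_chain k A" by simp
    from u[OF this] show "\<exists>!f. f \<in> maps Z A" "\<exists>!f. f \<in> maps A Z" by (rule conjunct1, rule conjunct2)
  qed (use r in simp)
qed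

lemma zero_map_comp:
  assumes "f \<in> maps U V" "is_chain k U" "is_chain k V" "is_chain k W"
  shows "zero_map V W \<circ>\<^sub>c f = zero_map U W"
  using comp_eq_iff[OF assms(1) zero_map_in[OF assms(3,4)] assms(2) zero_map_in[OF assms(2,4)]]
    cm_closed[OF assms(1)] by simp

lemma comp_zero_map:
  assumes "g \<in> maps V W" "is_chain k U" "is_chain k V" "is_chain k W"
  shows "g \<circ>\<^sub>c zero_map U V = zero_map U W"
  using comp_eq_iff[OF zero_map_in[OF assms(2,3)] assms(1,2) zero_map_in[OF assms(2,4)]]
    cm_zero[OF assms(1,3,4)] by simp

lemma zero_arrow_iff:
  assumes A: "is_chain k A" and B: "is_chain k B"
  shows "zero_arrow \<C> A B f \<longleftrightarrow> f = zero_map A B"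
proof
  assume "zero_arrow \<C> A B f"
  then obtain Z g h where Z: "zero_object \<C> Z" and gh: "g \<in> maps A Z"
    "h \<in> maps Z B" "f = h \<circ>\<^sub>c g" unfolding zero_arrow_def Hom_grounded by blast
  have Zc: "is_chain k Z" and Zt: "\<And>\<alpha>. \<alpha> \<in> ON \<Longrightarrow> car Z \<alpha> = {\<zero>\<^bsub>vsp Z \<alpha>\<^esub>}"
    using Z unfolding zero_object_iff by auto
  have "component g \<alpha> x = \<zero>\<^bsub>vsp Z \<alpha>\<^esub>" if "\<alpha> \<in> ON" "x \<in> car A \<alpha>" for \<alpha> x
    using cm_closed[OF gh(1) that] Zt[OF that(1)] by simp
  then show "f = zero_map A B"
    unfolding gh(3) comp_eq_iff[OF gh(1,2) A zero_map_in[OF A B]]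
    using cm_zero[OF gh(2) Zc B] by simp
next
  assume f: "f = zero_map A B"
  obtain Z where "zero_object \<C> Z" and Z: "is_chain k Z"
    using ex_trivial_chain zero_object_iff by blast
  then show "zero_arrow \<C> A B f"
    unfolding zero_arrow_def Hom_grounded f
    using zero_map_in A B zero_map_comp[OF zero_map_in[OF A Z] A Z B] by metis
qed

text \<open>Supplies the indices for graphs with two vertices.\<close>

lemma ex_distinct: "\<exists>a b :: 'v. a \<noteq> b"
proof -
  have "elts (vset {}) \<noteq> elts (vsucc (vset {}) :: 'v)" by (simp add: elts_vset small_empty)
  then show ?thesis by metis
qed

text \<open>The cokernel is the coequalizer of f and the zero map, a colimit over two vertices with
  two parallel arrows. That the projection kills nothing beyond the image of f is read off from the
  congruence on words.\<close>

lemma ex_cokernel: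
  assumes A: "grchain A" and B: "grchain B" and f: "f \<in> maps A B"
  shows "\<exists>Q q. grchain Q \<and> q \<in> maps B Q \<and> (\<forall>\<alpha>\<in>ON.
    component q \<alpha> ` car B \<alpha> = car Q \<alpha> \<and>
    {x \<in> car B \<alpha>. component q \<alpha> x = \<zero>\<^bsub>vsp Q \<alpha>\<^esub>} = component f \<alpha> ` car A \<alpha>)"
proof -
  obtain a b :: 'v where ab: "a \<noteq> b" using ex_distinct by blast
  let ?D = "\<lambda>i. if i = a then A else B"
  let ?E = "{(a, b, f), (a, b, zero_map A B)}"
  interpret chain_graph k "{a, b}" ?D ?E
    by standard (use A B f ab zero_map_in in \<open>auto simp: small_doubleton\<close>)
  note Ac = conjunct1[OF A] and Bc = conjunct1[OF B]
  let ?q = "coproj b"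
  have q: "?q \<in> maps B colim" using coproj_in[of b] ab by simp
  \<comment> \<open>Both composites equal the coprojection of the vertex a, so \<open>?q\<close>
    kills the image of f.\<close>
  have qf: "?q \<circ>\<^sub>c f = coproj a" and q0: "?q \<circ>\<^sub>c zero_map A B = coproj a"
    using coproj_arrow by auto
  have qf_zero: "component ?q \<alpha> (component f \<alpha> x) = \<zero>\<^bsub>vsp colim \<alpha>\<^esub>"
    if "\<alpha> \<in> ON" "x \<in> car A \<alpha>" for \<alpha> x
    using component_comp[OF f that, of ?q] component_comp[OF zero_map_in[OF Ac Bc] that, of ?q]
      that cm_zero[OF q Bc is_chain_colim that(1)] unfolding qf q0 by simp
  \<comment> \<open>In general not a cocone, since A goes to zero while f followed by the identity
    need not vanish. Evaluation of words in B is therefore compared modulo the image of f.\<close>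
  let ?t = "\<lambda>i. if i = a then zero_map A B else Ident \<C> B"
  have t: "?t i \<in> maps (?D i) B" if "i \<in> {a, b}" for i
    using zero_map_in[OF Ac Bc] Ident_in[OF Bc] by simp
  show ?thesis
  proof (intro exI[of _ colim] exI[of _ ?q] conjI ballI is_chain_colim grounded_colim q)
    fix \<alpha> :: 'v assume \<alpha>: "\<alpha> \<in> ON"
    interpret A: module "fld k \<alpha>" "vsp A \<alpha>" by (rule chain_module[OF Ac \<alpha>])
    interpret B: module "fld k \<alpha>" "vsp B \<alpha>" by (rule chain_module[OF Bc \<alpha>])
    have "car colim \<alpha> \<subseteq> component ?q \<alpha> ` car B \<alpha>"
    proof (rule colim_subset[OF \<alpha>])
      show "\<zero>\<^bsub>vsp colim \<alpha>\<^esub> \<in> component ?q \<alpha> ` car B \<alpha>"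
        unfolding cm_zero[OF q Bc is_chain_colim \<alpha>, symmetric] by (rule imageI) (rule B.M.zero_closed)
      fix i x assume i: "i \<in> {a, b}" "x \<in> car (?D i) \<alpha>"
      show "component (coproj i) \<alpha> x \<in> component ?q \<alpha> ` car B \<alpha>"
      proof (cases "i = a")
        case True
        then have x: "x \<in> car A \<alpha>" using i by simp
        have "component (coproj i) \<alpha> x = component ?q \<alpha> (component f \<alpha> x)"
          unfolding True qf[symmetric] by (rule component_comp[OF f \<alpha> x])
        then show ?thesis using cm_closed[OF f \<alpha> x] by simp
      next
        case False
        then show ?thesis using i by simp
      qed
    next
      fix y z assume "y \<in> component ?q \<alpha> ` car B \<alpha>" "z \<in> component ?q \<alpha> ` car B \<alpha>"
      then obtain y' z' where h: "y' \<in> car B \<alpha>" "z' \<in> car B \<alpha>"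
        "y = component ?q \<alpha> y'" "z = component ?q \<alpha> z'" by blast
      then have "y \<oplus>\<^bsub>vsp colim \<alpha>\<^esub> z = component ?q \<alpha> (y' \<oplus>\<^bsub>vsp B \<alpha>\<^esub> z')" using cm_add[OF q \<alpha>] by simp
      then show "y \<oplus>\<^bsub>vsp colim \<alpha>\<^esub> z \<in> component ?q \<alpha> ` car B \<alpha>"
        using B.M.a_closed[OF h(1,2)] by (rule image_eqI)
    qed
    then show "component ?q \<alpha> ` car B \<alpha> = car colim \<alpha>"
      using cm_closed[OF q \<alpha>] by blast
    define s where "s = word_sum B ?t \<alpha>"
    have s_closed: "w \<in> words \<alpha> \<Longrightarrow> s w \<in> car B \<alpha>" for w
      unfolding s_def using word_sum_closed[OF Bc t _ \<alpha>] .
    have s_append: "w \<in> words \<alpha> \<Longrightarrow> v \<in> words \<alpha> \<Longrightarrow> s (w @ v) = s w \<oplus>\<^bsub>vsp B \<alpha>\<^esub> s v" for w v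
      unfolding s_def using word_sum_append[OF Bc t _ _ \<alpha>] .
    have s_sing: "s [(b, x)] = x" "s [] = \<zero>\<^bsub>vsp B \<alpha>\<^esub>" if "x \<in> car B \<alpha>" for x
      unfolding s_def using ab that \<alpha> by (simp_all add: component_Ident)
    have s_arrow: "s [(a, x)] = \<zero>\<^bsub>vsp B \<alpha>\<^esub>" if "x \<in> car A \<alpha>" for x
      unfolding s_def using ab that \<alpha> by simp
    let ?Im = "component f \<alpha> ` car A \<alpha>"
    have fc: "component f \<alpha> y \<in> car B \<alpha>" if "y \<in> car A \<alpha>" for y
      using cm_closed[OF f \<alpha> that] .
    have s_rel: "rel \<alpha> w v \<Longrightarrow> s w \<ominus>\<^bsub>vsp B \<alpha>\<^esub> s v \<in> ?Im" for w v
    proof -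
      have Im0: "\<zero>\<^bsub>vsp B \<alpha>\<^esub> \<in> ?Im"
        unfolding cm_zero[OF f Ac Bc \<alpha>, symmetric] by (rule imageI) (rule A.M.zero_closed)
      have Im_add: "x \<oplus>\<^bsub>vsp B \<alpha>\<^esub> y \<in> ?Im" if xy: "x \<in> ?Im" "y \<in> ?Im" for x y
      proof -
        obtain x' y' where "x' \<in> car A \<alpha>" "y' \<in> car A \<alpha>"
          "x = component f \<alpha> x'" "y = component f \<alpha> y'" using xy by blast
        then show ?thesis using cm_add[OF f \<alpha>, of x' y'] A.M.a_closed by (intro image_eqI[of _ _ "x' \<oplus>\<^bsub>vsp A \<alpha>\<^esub> y'"]) auto
      qed
      have Im_minus: "x \<ominus>\<^bsub>vsp B \<alpha>\<^esub> y \<in> ?Im" if xy: "x \<in> ?Im" "y \<in> ?Im" for x y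
      proof -
        obtain x' y' where "x' \<in> car A \<alpha>" "y' \<in> car A \<alpha>"
          "x = component f \<alpha> x'" "y = component f \<alpha> y'" using xy by blast
        then show ?thesis using cm_a_minus[OF f Ac Bc \<alpha>, of x' y'] A.M.minus_closed
          by (intro image_eqI[of _ _ "x' \<ominus>\<^bsub>vsp A \<alpha>\<^esub> y'"]) auto
      qed
      have eq: "x = y \<Longrightarrow> x \<in> car B \<alpha> \<Longrightarrow> x \<ominus>\<^bsub>vsp B \<alpha>\<^esub> y \<in> ?Im" for x y
        using Im0 by (simp add: B.M.minus_eq B.M.r_neg)
      have ImB: "x \<in> ?Im \<Longrightarrow> x \<in> car B \<alpha>" for x using fc by blast
      show "rel \<alpha> w v \<Longrightarrow> s w \<ominus>\<^bsub>vsp B \<alpha>\<^esub> s v \<in> ?Im"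
      proof (induction rule: rel.induct)
        case (refl w)
        then show ?case using eq s_closed by blast
      next
        case (sym w v)
        have c: "s w \<in> car B \<alpha>" "s v \<in> car B \<alpha>" using rel_words[OF sym(1) \<alpha>] s_closed by auto
        have "s v \<ominus>\<^bsub>vsp B \<alpha>\<^esub> s w = \<zero>\<^bsub>vsp B \<alpha>\<^esub> \<ominus>\<^bsub>vsp B \<alpha>\<^esub> (s w \<ominus>\<^bsub>vsp B \<alpha>\<^esub> s v)"
          using c by (simp add: B.M.minus_eq B.M.minus_add B.M.a_comm)
        then show ?case using Im_minus[OF Im0 sym(2)] by simp
      next
        case (trans w v z)
        have c: "s w \<in> car B \<alpha>" "s v \<in> car B \<alpha>" "s z \<in> car B \<alpha>"
          using rel_words[OF trans(1) \<alpha>] rel_words[OF trans(2) \<alpha>] s_closed by auto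
        have "s w \<ominus>\<^bsub>vsp B \<alpha>\<^esub> s z = (s w \<ominus>\<^bsub>vsp B \<alpha>\<^esub> s v) \<oplus>\<^bsub>vsp B \<alpha>\<^esub> (s v \<ominus>\<^bsub>vsp B \<alpha>\<^esub> s z)"
          using c by (simp add: B.M.minus_eq B.M.a_assoc B.M.r_neg1)
        then show ?case using Im_add[OF trans(3,4)] by simp
      next
        case (append w w' v v')
        have c: "w \<in> words \<alpha>" "w' \<in> words \<alpha>" "v \<in> words \<alpha>" "v' \<in> words \<alpha>"
          using rel_words[OF append(1) \<alpha>] rel_words[OF append(2) \<alpha>] by auto
        have "s (w @ v) \<ominus>\<^bsub>vsp B \<alpha>\<^esub> s (w' @ v') = (s w \<ominus>\<^bsub>vsp B \<alpha>\<^esub> s w') \<oplus>\<^bsub>vsp B \<alpha>\<^esub> (s v \<ominus>\<^bsub>vsp B \<alpha>\<^esub> s v')"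
          using c by (simp add: s_append s_closed B.M.minus_eq B.M.minus_add B.M.a_ac)
        then show ?case using Im_add[OF append(3,4)] by simp
      next
        case (commute w v)
        then show ?case using s_closed s_append by (intro eq) (auto simp: B.M.a_comm)
      next
        case (add i x y)
        interpret abelian_group "vsp (?D i) \<alpha>" by (rule D_abelian_group[OF add(1) \<alpha>])
        have "s [(i, x), (i, y)] = s [(i, x \<oplus>\<^bsub>vsp (?D i) \<alpha>\<^esub> y)]"
          using cm_closed[OF t[OF add(1)] \<alpha>] cm_add[OF t[OF add(1)] \<alpha>] add by (simp add: s_def B.M.a_assoc)
        then show ?case using s_closed[of "[(i, x), (i, y)]"] add by (intro eq) auto
      next
        case (zero i)
        interpret abelian_group "vsp (?D i) \<alpha>" by (rule D_abelian_group[OF zero(1) \<alpha>])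
        have "s [(i, \<zero>\<^bsub>vsp (?D i) \<alpha>\<^esub>)] = s []"
          using cm_zero[OF t[OF zero(1)] D_chain[OF zero(1)] Bc \<alpha>] by (simp add: s_def)
        then show ?case using s_closed[of "[]"] zero by (intro eq) auto
      next
        case (arrow i j g x)
        then have ij: "i = a" "j = b" "x \<in> car A \<alpha>" and g: "g = f \<or> g = zero_map A B"
          by (auto split: if_splits)
        have "component g \<alpha> x \<in> ?Im" using g ij(3) Im0 \<alpha> by auto
        then show ?case using Im_minus[OF Im0] s_arrow[OF ij(3)] s_sing(1) ImB ij(1,2) by simp
      qed
    qed
    show "{x \<in> car B \<alpha>. component ?q \<alpha> x = \<zero>\<^bsub>vsp colim \<alpha>\<^esub>} = ?Im"
    proof (intro equalityI subsetI)
      fix x assume "x \<in> {x \<in> car B \<alpha>. component ?q \<alpha> x = \<zero>\<^bsub>vsp colim \<alpha>\<^esub>}"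
      then have x: "x \<in> car B \<alpha>" "component ?q \<alpha> x = \<zero>\<^bsub>vsp colim \<alpha>\<^esub>" by auto
      then have "rel \<alpha> [(b, x)] []" using ab \<alpha> by (simp add: zero_colim cls_eq_iff)
      then have "x \<ominus>\<^bsub>vsp B \<alpha>\<^esub> \<zero>\<^bsub>vsp B \<alpha>\<^esub> \<in> ?Im" using s_rel[of "[(b, x)]" "[]"] s_sing[OF x(1)] by simp
      moreover have "\<ominus>\<^bsub>vsp B \<alpha>\<^esub> \<zero>\<^bsub>vsp B \<alpha>\<^esub> = \<zero>\<^bsub>vsp B \<alpha>\<^esub>" by (rule B.M.minus_equality) simp_all
      ultimately show "x \<in> ?Im" unfolding B.M.minus_eq using x(1) by (simp only: B.M.r_zero)
    next
      fix x assume "x \<in> ?Im"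
      then show "x \<in> {x \<in> car B \<alpha>. component ?q \<alpha> x = \<zero>\<^bsub>vsp colim \<alpha>\<^esub>}"
        using qf_zero[OF \<alpha>] fc by blast
    qed
  qed
qed

subsection \<open>Preadditive structure and biproducts\<close>

definition add_map where
  "add_map V W f g = mk_map V W (\<lambda>\<alpha> x. component f \<alpha> x \<oplus>\<^bsub>vsp W \<alpha>\<^esub> component g \<alpha> x)"

lemma component_add_map [simp]:
  "\<alpha> \<in> ON \<Longrightarrow> x \<in> car V \<alpha> \<Longrightarrow>
    component (add_map V W f g) \<alpha> x = component f \<alpha> x \<oplus>\<^bsub>vsp W \<alpha>\<^esub> component g \<alpha> x"
  by (simp add: add_map_def)

lemma add_map_in:
  assumes V: "is_chain k V" and W: "is_chain k W" and f: "f \<in> maps V W" and g: "g \<in> maps V W"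
  shows "add_map V W f g \<in> maps V W"
  unfolding add_map_def
proof (rule mk_map_in[OF _ _ _ _ V])
  fix \<alpha> x y assume a: "\<alpha> \<in> ON" "x \<in> car V \<alpha>" "y \<in> car V \<alpha>"
  interpret W: module "fld k \<alpha>" "vsp W \<alpha>" by (rule chain_module[OF W a(1)])
  note s = cm_closed[OF f a(1)] cm_closed[OF g a(1)] cm_add[OF f a(1)] cm_add[OF g a(1)]
    cm_smult[OF f a(1)] cm_smult[OF g a(1)]
  show "component f \<alpha> x \<oplus>\<^bsub>vsp W \<alpha>\<^esub> component g \<alpha> x \<in> car W \<alpha>" using a s by simp
  show "component f \<alpha> (x \<oplus>\<^bsub>vsp V \<alpha>\<^esub> y) \<oplus>\<^bsub>vsp W \<alpha>\<^esub> component g \<alpha> (x \<oplus>\<^bsub>vsp V \<alpha>\<^esub> y) =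
    component f \<alpha> x \<oplus>\<^bsub>vsp W \<alpha>\<^esub> component g \<alpha> x \<oplus>\<^bsub>vsp W \<alpha>\<^esub> (component f \<alpha> y \<oplus>\<^bsub>vsp W \<alpha>\<^esub> component g \<alpha> y)"
    using a s by (simp add: W.M.a_ac)
  show "component f \<alpha> (c \<odot>\<^bsub>vsp V \<alpha>\<^esub> x) \<oplus>\<^bsub>vsp W \<alpha>\<^esub> component g \<alpha> (c \<odot>\<^bsub>vsp V \<alpha>\<^esub> x) =
    c \<odot>\<^bsub>vsp W \<alpha>\<^esub> (component f \<alpha> x \<oplus>\<^bsub>vsp W \<alpha>\<^esub> component g \<alpha> x)" if "c \<in> carrier (fld k \<alpha>)" for c
    using a s that by (simp add: W.smult_r_distr)
next
  fix \<alpha> \<beta> x assume a: "ord_le \<alpha> \<beta>" "x \<in> car V \<alpha>"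
  then show "component f \<beta> (tmap V \<beta> \<alpha> x) \<oplus>\<^bsub>vsp W \<beta>\<^esub> component g \<beta> (tmap V \<beta> \<alpha> x) =
      tmap W \<beta> \<alpha> (component f \<alpha> x \<oplus>\<^bsub>vsp W \<alpha>\<^esub> component g \<alpha> x)"
    using cm_tmap[OF f] cm_tmap[OF g] tmap_add[OF W] cm_closed[OF f] cm_closed[OF g] by (simp add: ord_le_ON)
qed

definition hom_group where
  "hom_group V W = \<lparr>carrier = maps V W, monoid.mult = add_map V W, one = zero_map V W\<rparr>"

lemma comm_group_hom_group:
  assumes V: "is_chain k V" and W: "is_chain k W"
  shows "comm_group (hom_group V W)"
proof (rule comm_groupI)
  fix f g h assume "f \<in> carrier (hom_group V W)" "g \<in> carrier (hom_group V W)" "h \<in> carrier (hom_group V W)"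
  then have f: "f \<in> maps V W" and g: "g \<in> maps V W" and h: "h \<in> maps V W"
    by (auto simp: hom_group_def)
  show "f \<otimes>\<^bsub>hom_group V W\<^esub> g \<in> carrier (hom_group V W)"
    using add_map_in[OF V W f g] by (simp add: hom_group_def)
  have "add_map V W (add_map V W f g) h = add_map V W f (add_map V W g h)"
  proof (rule cm_eqI)
    fix \<alpha> x assume a: "\<alpha> \<in> ON" "x \<in> car V \<alpha>"
    interpret abelian_group "vsp W \<alpha>" by (rule chain_abelian_group[OF W a(1)])
    show "component (add_map V W (add_map V W f g) h) \<alpha> x = component (add_map V W f (add_map V W g h)) \<alpha> x"
      using a cm_closed[OF f] cm_closed[OF g] cm_closed[OF h] by (simp add: a_assoc)
  qed (rule add_map_in zero_map_in V W f g h)+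
  then show "f \<otimes>\<^bsub>hom_group V W\<^esub> g \<otimes>\<^bsub>hom_group V W\<^esub> h = f \<otimes>\<^bsub>hom_group V W\<^esub> (g \<otimes>\<^bsub>hom_group V W\<^esub> h)"
    by (simp add: hom_group_def)
  have "add_map V W f g = add_map V W g f"
  proof (rule cm_eqI)
    fix \<alpha> x assume a: "\<alpha> \<in> ON" "x \<in> car V \<alpha>"
    interpret abelian_group "vsp W \<alpha>" by (rule chain_abelian_group[OF W a(1)])
    show "component (add_map V W f g) \<alpha> x = component (add_map V W g f) \<alpha> x"
      using a cm_closed[OF f] cm_closed[OF g] by (simp add: a_comm)
  qed (rule add_map_in zero_map_in V W f g)+
  then show "f \<otimes>\<^bsub>hom_group V W\<^esub> g = g \<otimes>\<^bsub>hom_group V W\<^esub> f" by (simp add: hom_group_def)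
next
  show "\<one>\<^bsub>hom_group V W\<^esub> \<in> carrier (hom_group V W)" using zero_map_in[OF V W] by (simp add: hom_group_def)
next
  fix f assume "f \<in> carrier (hom_group V W)"
  then have f: "f \<in> maps V W" by (simp add: hom_group_def)
  have "add_map V W (zero_map V W) f = f"
  proof (rule cm_eqI)
    fix \<alpha> x assume a: "\<alpha> \<in> ON" "x \<in> car V \<alpha>"
    interpret abelian_group "vsp W \<alpha>" by (rule chain_abelian_group[OF W a(1)])
    show "component (add_map V W (zero_map V W) f) \<alpha> x = component f \<alpha> x" using a cm_closed[OF f] by simp
  qed (rule add_map_in zero_map_in V W f)+
  then show "\<one>\<^bsub>hom_group V W\<^esub> \<otimes>\<^bsub>hom_group V W\<^esub> f = f" by (simp add: hom_group_def)
  define n where "n = mk_map V W (\<lambda>\<alpha> x. \<ominus>\<^bsub>vsp W \<alpha>\<^esub> component f \<alpha> x)"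
  have n: "n \<in> maps V W"
    unfolding n_def
  proof (rule mk_map_in[OF _ _ _ _ V])
    fix \<alpha> x y assume a: "\<alpha> \<in> ON" "x \<in> car V \<alpha>" "y \<in> car V \<alpha>"
    interpret W: module "fld k \<alpha>" "vsp W \<alpha>" by (rule chain_module[OF W a(1)])
    note s = cm_closed[OF f a(1)] cm_add[OF f a(1)] cm_smult[OF f a(1)]
    show "\<ominus>\<^bsub>vsp W \<alpha>\<^esub> component f \<alpha> x \<in> car W \<alpha>" using a s by simp
    show "\<ominus>\<^bsub>vsp W \<alpha>\<^esub> component f \<alpha> (x \<oplus>\<^bsub>vsp V \<alpha>\<^esub> y) =
        \<ominus>\<^bsub>vsp W \<alpha>\<^esub> component f \<alpha> x \<oplus>\<^bsub>vsp W \<alpha>\<^esub> \<ominus>\<^bsub>vsp W \<alpha>\<^esub> component f \<alpha> y"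
      using a s by (simp add: W.M.minus_add)
    show "\<ominus>\<^bsub>vsp W \<alpha>\<^esub> component f \<alpha> (c \<odot>\<^bsub>vsp V \<alpha>\<^esub> x) = c \<odot>\<^bsub>vsp W \<alpha>\<^esub> (\<ominus>\<^bsub>vsp W \<alpha>\<^esub> component f \<alpha> x)"
      if "c \<in> carrier (fld k \<alpha>)" for c
      using a s that by (simp add: W.smult_r_minus)
  next
    fix \<alpha> \<beta> x assume a: "ord_le \<alpha> \<beta>" "x \<in> car V \<alpha>"
    note o = ord_le_ON[OF a(1)]
    interpret Wa: abelian_group "vsp W \<alpha>" by (rule chain_abelian_group[OF W o(1)])
    interpret Wb: abelian_group "vsp W \<beta>" by (rule chain_abelian_group[OF W o(2)])
    let ?y = "component f \<alpha> x"
    have y: "?y \<in> car W \<alpha>" using cm_closed[OF f o(1) a(2)] .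
    have "tmap W \<beta> \<alpha> (\<ominus>\<^bsub>vsp W \<alpha>\<^esub> ?y) \<oplus>\<^bsub>vsp W \<beta>\<^esub> tmap W \<beta> \<alpha> ?y = \<zero>\<^bsub>vsp W \<beta>\<^esub>"
      using tmap_add[OF W a(1) Wa.a_inv_closed[OF y] y] tmap_zero[OF W a(1)] y by (simp add: Wa.l_neg)
    then have "\<ominus>\<^bsub>vsp W \<beta>\<^esub> tmap W \<beta> \<alpha> ?y = tmap W \<beta> \<alpha> (\<ominus>\<^bsub>vsp W \<alpha>\<^esub> ?y)"
      using tmap_closed[OF W a(1)] y by (intro Wb.minus_equality) auto
    then show "\<ominus>\<^bsub>vsp W \<beta>\<^esub> component f \<beta> (tmap V \<beta> \<alpha> x) = tmap W \<beta> \<alpha> (\<ominus>\<^bsub>vsp W \<alpha>\<^esub> ?y)"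
      using cm_tmap[OF f a] by simp
  qed
  have "add_map V W n f = zero_map V W"
  proof (rule cm_eqI)
    fix \<alpha> x assume a: "\<alpha> \<in> ON" "x \<in> car V \<alpha>"
    interpret abelian_group "vsp W \<alpha>" by (rule chain_abelian_group[OF W a(1)])
    show "component (add_map V W n f) \<alpha> x = component (zero_map V W) \<alpha> x"
      using a cm_closed[OF f] by (simp add: n_def l_neg)
  qed (rule add_map_in zero_map_in V W f n)+
  then show "\<exists>n\<in>carrier (hom_group V W). n \<otimes>\<^bsub>hom_group V W\<^esub> f = \<one>\<^bsub>hom_group V W\<^esub>"
    using n by (auto simp: hom_group_def)
qed

lemma preadditive_grounded_chains: "preadditive \<C> hom_group"
proof -
  have l: "h \<circ>\<^sub>c add_map A B f g = add_map A D (h \<circ>\<^sub>c f) (h \<circ>\<^sub>c g)"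
    if A: "is_chain k A" and B: "is_chain k B" and D: "is_chain k D" and f: "f \<in> maps A B"
      and g: "g \<in> maps A B" and h: "h \<in> maps B D" for A B D f g h
    unfolding comp_eq_iff[OF add_map_in[OF A B f g] h A add_map_in[OF A D comp_in[OF f h A] comp_in[OF g h A]]]
    using cm_add[OF h] cm_closed[OF f] cm_closed[OF g] component_comp[OF f] component_comp[OF g] by simp
  have r: "add_map B D g h \<circ>\<^sub>c f = add_map A D (g \<circ>\<^sub>c f) (h \<circ>\<^sub>c f)"
    if A: "is_chain k A" and B: "is_chain k B" and D: "is_chain k D" and f: "f \<in> maps A B"
      and g: "g \<in> maps B D" and h: "h \<in> maps B D" for A B D f g h
    unfolding comp_eq_iff[OF f add_map_in[OF B D g h] A add_map_in[OF A D comp_in[OF f g A] comp_in[OF f h A]]]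
    using cm_closed[OF f] component_comp[OF f] by simp
  show ?thesis
    unfolding preadditive_def Ob_grounded Hom_grounded
  proof (intro conjI ballI; (unfold mem_Collect_eq)?)
    fix A B assume "grchain A" "grchain B"
    then show "comm_group (hom_group A B)" "carrier (hom_group A B) = maps A B"
      using comm_group_hom_group by (auto simp: hom_group_def)
  qed (auto simp: hom_group_def intro: l r)
qed

text \<open>The colimit of two vertices without arrows. The universal property gives the
  projections, and the identity for the sum of the two composites is checked on the
  coprojections.\<close>

lemma ex_biproduct:
  assumes A: "grchain A" and B: "grchain B"
  shows "\<exists>S i\<^sub>A i\<^sub>B p\<^sub>A p\<^sub>B. is_biproduct \<C> hom_group A B S i\<^sub>A i\<^sub>B p\<^sub>A p\<^sub>B"
proof -
  obtain a b :: 'v where ab: "a \<noteq> b" using ex_distinct by blast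
  let ?D = "\<lambda>i. if i = a then A else B"
  interpret chain_graph k "{a, b}" ?D "{}"
    by standard (use A B ab in \<open>auto simp: small_doubleton\<close>)
  note Ac = conjunct1[OF A] and Bc = conjunct1[OF B]
  let ?I = "Ident \<C>"
  let ?i = "coproj a" and ?j = "coproj b"
  have i: "?i \<in> maps A colim" and j: "?j \<in> maps B colim"
    using coproj_in[of a] coproj_in[of b] ab by auto
  have "\<exists>p. p \<in> maps colim A \<and> (\<forall>i\<in>{a, b}. p \<circ>\<^sub>c coproj i = (if i = a then ?I A else zero_map B A))"
    by (rule ex1_implies_ex, rule induced_universal[OF Ac])
       (use zero_map_in[OF Bc Ac] Ident_in[OF Ac] in auto)
  then obtain p where p: "p \<in> maps colim A" "p \<circ>\<^sub>c ?i = ?I A" "p \<circ>\<^sub>c ?j = zero_map B A"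
    using ab by auto
  have "\<exists>q. q \<in> maps colim B \<and> (\<forall>i\<in>{a, b}. q \<circ>\<^sub>c coproj i = (if i = a then zero_map A B else ?I B))"
    by (rule ex1_implies_ex, rule induced_universal[OF Bc])
       (use zero_map_in[OF Ac Bc] Ident_in[OF Bc] in auto)
  then obtain q where q: "q \<in> maps colim B" "q \<circ>\<^sub>c ?i = zero_map A B" "q \<circ>\<^sub>c ?j = ?I B"
    using ab by auto
  note S = is_chain_colim
  have ip: "?i \<circ>\<^sub>c p \<in> maps colim colim" and jq: "?j \<circ>\<^sub>c q \<in> maps colim colim"
    using comp_in[OF p(1) i S] comp_in[OF q(1) j S] .
  have pi: "component p \<alpha> (component ?i \<alpha> x) = x" "component q \<alpha> (component ?i \<alpha> x) = \<zero>\<^bsub>vsp B \<alpha>\<^esub>"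
    if "\<alpha> \<in> ON" "x \<in> car A \<alpha>" for \<alpha> x
    using component_comp[OF i that, of p] component_comp[OF i that, of q] p(2) q(2) component_Ident[OF that] that
    by (simp_all del: component_coproj)
  have pj: "component p \<alpha> (component ?j \<alpha> x) = \<zero>\<^bsub>vsp A \<alpha>\<^esub>" "component q \<alpha> (component ?j \<alpha> x) = x"
    if "\<alpha> \<in> ON" "x \<in> car B \<alpha>" for \<alpha> x
    using component_comp[OF j that, of p] component_comp[OF j that, of q] p(3) q(3) component_Ident[OF that] that
    by (simp_all del: component_coproj)
  have "add_map colim colim (?i \<circ>\<^sub>c p) (?j \<circ>\<^sub>c q) = ?I colim"
  proof (rule colim_eqI[OF add_map_in[OF S S ip jq] Ident_in[OF S] S])
    fix c assume "c \<in> {a, b}"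
    then consider "c = a" | "c = b" by blast
    then show "add_map colim colim (?i \<circ>\<^sub>c p) (?j \<circ>\<^sub>c q) \<circ>\<^sub>c coproj c = ?I colim \<circ>\<^sub>c coproj c"
    proof cases
      case 1
      show ?thesis unfolding 1 comp_eq_iff[OF i add_map_in[OF S S ip jq] Ac comp_in[OF i Ident_in[OF S] Ac]]
      proof (intro ballI)
        fix \<alpha> x assume x: "\<alpha> \<in> ON" "x \<in> car A \<alpha>"
        interpret abelian_group "vsp colim \<alpha>" by (rule chain_abelian_group[OF S x(1)])
        show "component (add_map colim colim (?i \<circ>\<^sub>c p) (?j \<circ>\<^sub>c q)) \<alpha> (component ?i \<alpha> x) =
            component (?I colim \<circ>\<^sub>c ?i) \<alpha> x"
          using x pi[OF x] cm_closed[OF i x] cm_zero[OF j Bc S x(1)]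
          by (simp del: component_coproj add: component_comp[OF i] component_comp[OF p(1)] component_comp[OF q(1)] component_Ident)
      qed
    next
      case 2
      show ?thesis unfolding 2 comp_eq_iff[OF j add_map_in[OF S S ip jq] Bc comp_in[OF j Ident_in[OF S] Bc]]
      proof (intro ballI)
        fix \<alpha> x assume x: "\<alpha> \<in> ON" "x \<in> car B \<alpha>"
        interpret abelian_group "vsp colim \<alpha>" by (rule chain_abelian_group[OF S x(1)])
        show "component (add_map colim colim (?i \<circ>\<^sub>c p) (?j \<circ>\<^sub>c q)) \<alpha> (component ?j \<alpha> x) =
            component (?I colim \<circ>\<^sub>c ?j) \<alpha> x"
          using x pj[OF x] cm_closed[OF j x] cm_zero[OF i Ac S x(1)]
          by (simp del: component_coproj add: component_comp[OF j] component_comp[OF p(1)] component_comp[OF q(1)] component_Ident)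
      qed
    qed
  qed
  then have "is_biproduct \<C> hom_group A B colim ?i ?j p q"
    unfolding is_biproduct_def Ob_grounded Hom_grounded
    using i j p q S grounded_colim by (simp add: hom_group_def)
  then show ?thesis by blast
qed

lemma additive_grounded_chains: "additive_category \<C>"
proof -
  have "\<exists>Z. zero_object \<C> Z" using ex_trivial_chain zero_object_iff by blast
  then show ?thesis
    unfolding additive_category_def
    using category_grounded_chains preadditive_grounded_chains ex_biproduct unfolding Ob_grounded by blast
qed

subsection \<open>Kernels, cokernels and exactness\<close>

definition kernel_chain where
  "kernel_chain V W f = subchain V (\<lambda>\<alpha>. {x \<in> car V \<alpha>. component f \<alpha> x = \<zero>\<^bsub>vsp W \<alpha>\<^esub>})"

definition kernel_map where
  "kernel_map V W f = mk_map (kernel_chain V W f) V (\<lambda>\<alpha> x. x)"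

lemma carrier_kernel_chain:
  "car (kernel_chain V W f) \<alpha> = {x \<in> car V \<alpha>. component f \<alpha> x = \<zero>\<^bsub>vsp W \<alpha>\<^esub>}"
  by (simp add: kernel_chain_def)

lemma component_kernel_map:
  "\<alpha> \<in> ON \<Longrightarrow> x \<in> car (kernel_chain V W f) \<alpha> \<Longrightarrow> component (kernel_map V W f) \<alpha> x = x"
  unfolding kernel_map_def by (rule component_mk_map)

text \<open>Kernels are preimages of the zero submodule, and maps commute with transitions, so they
  form a closed family. Groundedness rests on \<open>grounded_subchain\<close>.\<close>

lemma kernel_chain:
  assumes V: "grchain V" and W: "is_chain k W" and f: "f \<in> maps V W"
  shows "grchain (kernel_chain V W f)" "kernel_map V W f \<in> maps (kernel_chain V W f) V"
proof -
  have "closed_family V (\<lambda>\<alpha>. {x \<in> car V \<alpha>. component f \<alpha> x = \<zero>\<^bsub>vsp W \<alpha>\<^esub>})"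
    unfolding closed_family_def
  proof (intro conjI ballI allI impI)
    fix \<alpha> :: 'v assume \<alpha>: "\<alpha> \<in> ON"
    interpret W: module "fld k \<alpha>" "vsp W \<alpha>" by (rule chain_module[OF W \<alpha>])
    have "submodule {\<zero>\<^bsub>vsp W \<alpha>\<^esub>} (fld k \<alpha>) (vsp W \<alpha>)" by (rule W.submoduleI') auto
    from submodule_cm_vimage[OF conjunct1[OF V] W f \<alpha> this]
    show "submodule {x \<in> car V \<alpha>. component f \<alpha> x = \<zero>\<^bsub>vsp W \<alpha>\<^esub>} (fld k \<alpha>) (vsp V \<alpha>)" by simp
  next
    fix \<alpha> \<beta> :: 'v assume le: "ord_le \<alpha> \<beta>"
    show "tmap V \<beta> \<alpha> ` {x \<in> car V \<alpha>. component f \<alpha> x = \<zero>\<^bsub>vsp W \<alpha>\<^esub>} \<subseteq>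
        {x \<in> car V \<beta>. component f \<beta> x = \<zero>\<^bsub>vsp W \<beta>\<^esub>}"
      using tmap_closed[OF conjunct1[OF V] le] cm_tmap[OF f le] tmap_zero[OF W le] by auto
  qed
  then show "grchain (kernel_chain V W f)" "kernel_map V W f \<in> maps (kernel_chain V W f) V"
    using V is_chain_subchain grounded_subchain inclusion_in by (auto simp: kernel_chain_def kernel_map_def)
qed

lemma comp_kernel_map:
  assumes V: "grchain V" and W: "is_chain k W" and f: "f \<in> maps V W"
  shows "f \<circ>\<^sub>c kernel_map V W f = zero_map (kernel_chain V W f) W"
proof -
  note K = kernel_chain[OF assms]
  show ?thesis
    unfolding comp_eq_iff[OF K(2) f conjunct1[OF K(1)] zero_map_in[OF conjunct1[OF K(1)] W]]
    by (simp add: component_kernel_map) (simp add: carrier_kernel_chain)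
qed

lemma comp_eq_zero_iff:
  assumes "f \<in> maps U V" "g \<in> maps V W" "is_chain k U" "is_chain k W"
  shows "g \<circ>\<^sub>c f = zero_map U W \<longleftrightarrow>
    (\<forall>\<alpha>\<in>ON. \<forall>x\<in>car U \<alpha>. component g \<alpha> (component f \<alpha> x) = \<zero>\<^bsub>vsp W \<alpha>\<^esub>)"
  unfolding comp_eq_iff[OF assms(1-3) zero_map_in[OF assms(3,4)]] by simp

lemma is_kernel_iff:
  assumes A: "grchain A" and B: "grchain B"
  shows "is_kernel \<C> A B f K i \<longleftrightarrow> grchain K \<and> i \<in> maps K A \<and>
    f \<circ>\<^sub>c i = zero_map K B \<and>
    (\<forall>T. grchain T \<longrightarrow> (\<forall>g\<in>maps T A. f \<circ>\<^sub>c g = zero_map T B \<longrightarrow>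
      (\<exists>!h. h \<in> maps T K \<and> i \<circ>\<^sub>c h = g)))"
  unfolding is_kernel_def Ob_grounded Hom_grounded
  using A B by (auto simp: zero_arrow_iff)

lemma is_cokernel_iff:
  assumes A: "grchain A" and B: "grchain B"
  shows "is_cokernel \<C> A B f Q q \<longleftrightarrow> grchain Q \<and> q \<in> maps B Q \<and>
    q \<circ>\<^sub>c f = zero_map A Q \<and>
    (\<forall>T. grchain T \<longrightarrow> (\<forall>g\<in>maps B T. g \<circ>\<^sub>c f = zero_map A T \<longrightarrow>
      (\<exists>!h. h \<in> maps Q T \<and> h \<circ>\<^sub>c q = g)))"
  unfolding is_cokernel_def Ob_grounded Hom_grounded
  using A B by (auto simp: zero_arrow_iff)

lemma is_kernelI:
  assumes K: "grchain K" and A: "grchain A" and B: "grchain B"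
    and i: "i \<in> maps K A" and f: "f \<in> maps A B"
    and inj: "\<And>\<alpha>. \<alpha> \<in> ON \<Longrightarrow> inj_on (component i \<alpha>) (car K \<alpha>)"
    and ex: "\<And>\<alpha>. \<alpha> \<in> ON \<Longrightarrow> component i \<alpha> ` car K \<alpha> =
      {x \<in> car A \<alpha>. component f \<alpha> x = \<zero>\<^bsub>vsp B \<alpha>\<^esub>}"
  shows "is_kernel \<C> A B f K i"
  unfolding is_kernel_iff[OF A B]
proof (intro conjI allI ballI impI conjunct1[OF K] conjunct2[OF K] i)
  show "f \<circ>\<^sub>c i = zero_map K B"
    unfolding comp_eq_zero_iff[OF i f conjunct1[OF K] conjunct1[OF B]] using ex by blast
next
  fix T g assume T: "grchain T" and g: "g \<in> maps T A" and z: "f \<circ>\<^sub>c g = zero_map T B"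
  show "\<exists>!h. h \<in> maps T K \<and> i \<circ>\<^sub>c h = g"
  proof (rule factor_through_injective[OF i conjunct1[OF K] g conjunct1[OF T] inj])
    fix \<alpha> x assume a: "\<alpha> \<in> ON" "x \<in> car T \<alpha>"
    then show "component g \<alpha> x \<in> component i \<alpha> ` car K \<alpha>"
      unfolding ex[OF a(1)]
      using z[unfolded comp_eq_zero_iff[OF g f conjunct1[OF T] conjunct1[OF B]]] cm_closed[OF g a] by blast
  qed
qed

lemma is_cokernelI:
  assumes A: "grchain A" and B: "grchain B" and Q: "grchain Q"
    and f: "f \<in> maps A B" and q: "q \<in> maps B Q"
    and surj: "\<And>\<alpha>. \<alpha> \<in> ON \<Longrightarrow> component q \<alpha> ` car B \<alpha> = car Q \<alpha>"
    and ex: "\<And>\<alpha>. \<alpha> \<in> ON \<Longrightarrow> component f \<alpha> ` car A \<alpha> =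
      {x \<in> car B \<alpha>. component q \<alpha> x = \<zero>\<^bsub>vsp Q \<alpha>\<^esub>}"
  shows "is_cokernel \<C> A B f Q q"
  unfolding is_cokernel_iff[OF A B]
proof (intro conjI allI ballI impI conjunct1[OF Q] conjunct2[OF Q] q)
  show "q \<circ>\<^sub>c f = zero_map A Q"
    unfolding comp_eq_zero_iff[OF f q conjunct1[OF A] conjunct1[OF Q]] using ex by blast
next
  fix T g assume T: "grchain T" and g: "g \<in> maps B T" and z: "g \<circ>\<^sub>c f = zero_map A T"
  show "\<exists>!h. h \<in> maps Q T \<and> h \<circ>\<^sub>c q = g"
  proof (rule factor_through_surjective[OF q conjunct1[OF B] conjunct1[OF Q] g conjunct1[OF T] surj])
    fix \<alpha> x assume a: "\<alpha> \<in> ON" "x \<in> car B \<alpha>" "component q \<alpha> x = \<zero>\<^bsub>vsp Q \<alpha>\<^esub>"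
    then have "x \<in> component f \<alpha> ` car A \<alpha>" unfolding ex[OF a(1)] by blast
    then show "component g \<alpha> x = \<zero>\<^bsub>vsp T \<alpha>\<^esub>"
      using z[unfolded comp_eq_zero_iff[OF f g conjunct1[OF A] conjunct1[OF T]]] a(1) by blast
  qed
qed

text \<open>The kernel inclusion and the zero map have the same composite with f, so for a mono they
  coincide and the kernel is trivial at each stage.\<close>

lemma mono_arrow_iff:
  assumes A: "grchain A" and B: "grchain B"
  shows "mono_arrow \<C> A B f \<longleftrightarrow> f \<in> maps A B \<and>
    (\<forall>\<alpha>\<in>ON. inj_on (component f \<alpha>) (car A \<alpha>))"
proof
  assume m: "mono_arrow \<C> A B f"
  then have f: "f \<in> maps A B"
    and can: "\<And>T g h. grchain T \<Longrightarrow> g \<in> maps T A \<Longrightarrow> h \<in> maps T A \<Longrightarrow> f \<circ>\<^sub>c g = f \<circ>\<^sub>c h \<Longrightarrow> g = h"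
    unfolding mono_arrow_def Ob_grounded Hom_grounded by blast+
  note Ac = conjunct1[OF A] and Bc = conjunct1[OF B]
  note K = kernel_chain[OF A Bc f]
  note Kc = conjunct1[OF K(1)]
  have eq: "kernel_map A B f = zero_map (kernel_chain A B f) A"
    by (rule can[OF K zero_map_in[OF Kc Ac]])
       (simp add: comp_kernel_map[OF A Bc f] comp_zero_map[OF f Kc Ac Bc])
  have "inj_on (component f \<alpha>) (car A \<alpha>)" if \<alpha>: "\<alpha> \<in> ON" for \<alpha>
  proof (rule cm_inj_onI[OF f Ac Bc \<alpha>])
    fix x assume "x \<in> car A \<alpha>" "component f \<alpha> x = \<zero>\<^bsub>vsp B \<alpha>\<^esub>"
    then have x: "x \<in> car (kernel_chain A B f) \<alpha>" by (simp add: carrier_kernel_chain)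
    show "x = \<zero>\<^bsub>vsp A \<alpha>\<^esub>"
      using component_kernel_map[OF \<alpha> x] component_zero_map[OF \<alpha> x, of A] unfolding eq by simp
  qed
  then show "f \<in> maps A B \<and> (\<forall>\<alpha>\<in>ON. inj_on (component f \<alpha>) (car A \<alpha>))" using f by blast
next
  assume r: "f \<in> maps A B \<and> (\<forall>\<alpha>\<in>ON. inj_on (component f \<alpha>) (car A \<alpha>))"
  then have f: "f \<in> maps A B" by blast
  have "g = h" if T: "grchain T" and g: "g \<in> maps T A" and h: "h \<in> maps T A"
    and e: "f \<circ>\<^sub>c g = f \<circ>\<^sub>c h" for T g h
  proof (rule cm_eqI[OF g h])
    fix \<alpha> x assume a: "\<alpha> \<in> ON" "x \<in> car T \<alpha>"
    have "component f \<alpha> (component g \<alpha> x) = component f \<alpha> (component h \<alpha> x)"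
      using component_comp[OF g a, of f] component_comp[OF h a, of f] e by simp
    then show "component g \<alpha> x = component h \<alpha> x"
      using inj_onD[of "component f \<alpha>" "car A \<alpha>"] r a cm_closed[OF g a] cm_closed[OF h a] by blast
  qed
  then show "mono_arrow \<C> A B f"
    unfolding mono_arrow_def Ob_grounded Hom_grounded using f by blast
qed

text \<open>Cancellation applied to the projection q onto the cokernel gives q = 0, so the kernel of
  q, which is the image of f, is everything. Cancellation against zero is available both for epis
  and for the last map of a short exact sequence.\<close>

lemma surj_if_left_cancel_zero:
  assumes A: "grchain A" and B: "grchain B" and f: "f \<in> maps A B"
    and can: "\<And>T g. grchain T \<Longrightarrow> g \<in> maps B T \<Longrightarrow> g \<circ>\<^sub>c f = zero_map A T \<Longrightarrow> g = zero_map B T"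
    and \<alpha>: "\<alpha> \<in> ON"
  shows "component f \<alpha> ` car A \<alpha> = car B \<alpha>"
proof -
  obtain Q q where Q: "grchain Q" and q: "q \<in> maps B Q" and
    "\<forall>\<alpha>\<in>ON. component q \<alpha> ` car B \<alpha> = car Q \<alpha> \<and>
      {x \<in> car B \<alpha>. component q \<alpha> x = \<zero>\<^bsub>vsp Q \<alpha>\<^esub>} = component f \<alpha> ` car A \<alpha>"
    using ex_cokernel[OF A B f] by blast
  then have ex: "{x \<in> car B \<alpha>. component q \<alpha> x = \<zero>\<^bsub>vsp Q \<alpha>\<^esub>} =
      component f \<alpha> ` car A \<alpha>" if "\<alpha> \<in> ON" for \<alpha>
    using that by simp
  have "q \<circ>\<^sub>c f = zero_map A Q"
    unfolding comp_eq_zero_iff[OF f q conjunct1[OF A] conjunct1[OF Q]] using ex by blast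
  then have "q = zero_map B Q" using can Q q by blast
  then have "{x \<in> car B \<alpha>. component q \<alpha> x = \<zero>\<^bsub>vsp Q \<alpha>\<^esub>} = car B \<alpha>" using \<alpha> by auto
  then show ?thesis using ex[OF \<alpha>] by simp
qed

lemma epi_arrow_surj:
  assumes A: "grchain A" and B: "grchain B" and e: "epi_arrow \<C> A B f" and \<alpha>: "\<alpha> \<in> ON"
  shows "component f \<alpha> ` car A \<alpha> = car B \<alpha>"
proof -
  have f: "f \<in> maps A B"
    and can: "\<And>T g h. grchain T \<Longrightarrow> g \<in> maps B T \<Longrightarrow> h \<in> maps B T \<Longrightarrow> g \<circ>\<^sub>c f = h \<circ>\<^sub>c f \<Longrightarrow> g = h"
    using e unfolding epi_arrow_def Ob_grounded Hom_grounded by blast+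
  show ?thesis
  proof (rule surj_if_left_cancel_zero[OF A B f _ \<alpha>])
    fix T g assume T: "grchain T" and g: "g \<in> maps B T" and z: "g \<circ>\<^sub>c f = zero_map A T"
    then show "g = zero_map B T"
      using zero_map_comp[OF f, of T] A B zero_map_in by (intro can[OF T g]) auto
  qed
qed

text \<open>By \<open>ex_cokernel\<close> the kernel of the projection is the image, so a mono is
  the kernel of its cokernel. An epi is surjective at each stage, hence the cokernel of its
  kernel.\<close>

lemma abelian_grounded_chains: "abelian_category \<C>"
  unfolding abelian_category_def
proof (intro conjI ballI allI impI; (unfold Ob_grounded Hom_grounded mem_Collect_eq)?)
  show "additive_category \<C>" by (rule additive_grounded_chains)
next
  fix A B f assume A: "grchain A" and B: "grchain B" and f: "f \<in> maps A B"
  note K = kernel_chain[OF A conjunct1[OF B] f]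
  have "is_kernel \<C> A B f (kernel_chain A B f) (kernel_map A B f)"
    by (rule is_kernelI[OF K(1) A B K(2) f])
       (auto simp: inj_on_def component_kernel_map image_def carrier_kernel_chain)
  then show "\<exists>K i. is_kernel \<C> A B f K i" by blast
  obtain Q q where "grchain Q" "q \<in> maps B Q" "\<forall>\<alpha>\<in>ON.
    component q \<alpha> ` car B \<alpha> = car Q \<alpha> \<and>
    {x \<in> car B \<alpha>. component q \<alpha> x = \<zero>\<^bsub>vsp Q \<alpha>\<^esub>} = component f \<alpha> ` car A \<alpha>"
    using ex_cokernel[OF A B f] by blast
  then have "is_cokernel \<C> A B f Q q" by (intro is_cokernelI A B f) auto
  then show "\<exists>Q q. is_cokernel \<C> A B f Q q" by blast
next
  fix A B f assume A: "grchain A" and B: "grchain B" and m: "mono_arrow \<C> A B f"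
  then have f: "f \<in> maps A B" "\<And>\<alpha>. \<alpha> \<in> ON \<Longrightarrow> inj_on (component f \<alpha>) (car A \<alpha>)"
    unfolding mono_arrow_iff[OF A B] by blast+
  obtain Q q where Q: "grchain Q" "q \<in> maps B Q" "\<forall>\<alpha>\<in>ON.
    component q \<alpha> ` car B \<alpha> = car Q \<alpha> \<and>
    {x \<in> car B \<alpha>. component q \<alpha> x = \<zero>\<^bsub>vsp Q \<alpha>\<^esub>} = component f \<alpha> ` car A \<alpha>"
    using ex_cokernel[OF A B f(1)] by blast
  then have "is_kernel \<C> B Q q A f" by (intro is_kernelI A B f) auto
  then show "\<exists>D\<in>{V. grchain V}. \<exists>g\<in>maps B D. is_kernel \<C> B D g A f"
    using Q by blast
next
  fix A B f assume A: "grchain A" and B: "grchain B" and e: "epi_arrow \<C> A B f"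
  then have f: "f \<in> maps A B" unfolding epi_arrow_def Hom_grounded by blast
  note K = kernel_chain[OF A conjunct1[OF B] f]
  have "is_cokernel \<C> (kernel_chain A B f) A (kernel_map A B f) B f"
    by (rule is_cokernelI[OF K(1) A B K(2) f epi_arrow_surj[OF A B e]])
       (auto simp: component_kernel_map image_def carrier_kernel_chain)
  then show "\<exists>D\<in>{V. grchain V}. \<exists>g\<in>maps D A. is_cokernel \<C> D A g B f"
    using K by blast
qed

text \<open>From the universal properties: the kernel inclusion of f and the zero map both factor
  the zero map through f, hence agree; the kernel inclusion of g factors through f, giving exactness
  in the middle; uniqueness of factorisations through g gives surjectivity. The converse is
  \<open>is_kernelI\<close> and \<open>is_cokernelI\<close>.\<close>

lemma short_exact_iff:
  assumes A: "grchain A" and B: "grchain B" and D: "grchain D"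
    and f: "f \<in> maps A B" and g: "g \<in> maps B D"
  shows "short_exact \<C> A B D f g \<longleftrightarrow> (\<forall>\<alpha>\<in>ON.
    (\<forall>x\<in>car A \<alpha>. component f \<alpha> x = \<zero>\<^bsub>vsp B \<alpha>\<^esub> \<longrightarrow> x = \<zero>\<^bsub>vsp A \<alpha>\<^esub>) \<and>
    component f \<alpha> ` car A \<alpha> = {y \<in> car B \<alpha>. component g \<alpha> y = \<zero>\<^bsub>vsp D \<alpha>\<^esub>} \<and>
    component g \<alpha> ` car B \<alpha> = car D \<alpha>)"
proof -
  note Ac = conjunct1[OF A] and Bc = conjunct1[OF B] and Dc = conjunct1[OF D]
  show ?thesis
  proof (intro iffI ballI conjI impI)
    assume "short_exact \<C> A B D f g"
    then have gf: "g \<circ>\<^sub>c f = zero_map A D"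
      and ker: "\<And>T h. grchain T \<Longrightarrow> h \<in> maps T B \<Longrightarrow> g \<circ>\<^sub>c h = zero_map T D \<Longrightarrow>
        \<exists>!u. u \<in> maps T A \<and> f \<circ>\<^sub>c u = h"
      and coker: "\<And>T h. grchain T \<Longrightarrow> h \<in> maps B T \<Longrightarrow> h \<circ>\<^sub>c f = zero_map A T \<Longrightarrow>
        \<exists>!u. u \<in> maps D T \<and> u \<circ>\<^sub>c g = h"
      unfolding short_exact_def is_kernel_iff[OF B D] is_cokernel_iff[OF A B] by simp_all
    fix \<alpha> :: 'v assume \<alpha>: "\<alpha> \<in> ON"
    {
      fix x assume "x \<in> car A \<alpha>" "component f \<alpha> x = \<zero>\<^bsub>vsp B \<alpha>\<^esub>"
      then have x: "x \<in> car (kernel_chain A B f) \<alpha>" by (simp add: carrier_kernel_chain)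
      note K = kernel_chain[OF A Bc f]
      note Kc = conjunct1[OF K(1)]
      have "\<exists>!u. u \<in> maps (kernel_chain A B f) A \<and> f \<circ>\<^sub>c u = zero_map (kernel_chain A B f) B"
        by (rule ker[OF K(1) zero_map_in[OF Kc Bc] comp_zero_map[OF g Kc Bc Dc]])
      then have eq: "kernel_map A B f = zero_map (kernel_chain A B f) A"
        using K(2) zero_map_in[OF Kc Ac] comp_kernel_map[OF A Bc f] comp_zero_map[OF f Kc Ac Bc] by blast
      show "x = \<zero>\<^bsub>vsp A \<alpha>\<^esub>"
        using component_kernel_map[OF \<alpha> x] component_zero_map[OF \<alpha> x, of A] unfolding eq by simp
    }
    show "component f \<alpha> ` car A \<alpha> = {y \<in> car B \<alpha>. component g \<alpha> y = \<zero>\<^bsub>vsp D \<alpha>\<^esub>}"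
    proof (intro equalityI subsetI)
      fix y assume "y \<in> component f \<alpha> ` car A \<alpha>"
      then show "y \<in> {y \<in> car B \<alpha>. component g \<alpha> y = \<zero>\<^bsub>vsp D \<alpha>\<^esub>}"
        using gf[unfolded comp_eq_zero_iff[OF f g Ac Dc]] \<alpha> cm_closed[OF f \<alpha>] by blast
    next
      fix y assume "y \<in> {y \<in> car B \<alpha>. component g \<alpha> y = \<zero>\<^bsub>vsp D \<alpha>\<^esub>}"
      then have y: "y \<in> car (kernel_chain B D g) \<alpha>" by (simp add: carrier_kernel_chain)
      note K = kernel_chain[OF B Dc g]
      obtain u where u: "u \<in> maps (kernel_chain B D g) A" "f \<circ>\<^sub>c u = kernel_map B D g"
        using ker[OF K comp_kernel_map[OF B Dc g]] by blast
      have "component f \<alpha> (component u \<alpha> y) = y"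
        using component_comp[OF u(1) \<alpha> y, of f] component_kernel_map[OF \<alpha> y] unfolding u(2) by simp
      then show "y \<in> component f \<alpha> ` car A \<alpha>" using cm_closed[OF u(1) \<alpha> y] by (metis imageI)
    qed
    show "component g \<alpha> ` car B \<alpha> = car D \<alpha>"
    proof (rule surj_if_left_cancel_zero[OF B D g _ \<alpha>])
      fix T h assume T: "grchain T" and h: "h \<in> maps D T" "h \<circ>\<^sub>c g = zero_map B T"
      note Tc = conjunct1[OF T]
      have "\<exists>!u. u \<in> maps D T \<and> u \<circ>\<^sub>c g = zero_map B T"
        by (rule coker[OF T zero_map_in[OF Bc Tc] zero_map_comp[OF f Ac Bc Tc]])
      then show "h = zero_map D T" using h zero_map_in[OF Dc Tc] zero_map_comp[OF g Bc Dc Tc] by blast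
    qed
  next
    assume r: "\<forall>\<alpha>\<in>ON. (\<forall>x\<in>car A \<alpha>. component f \<alpha> x = \<zero>\<^bsub>vsp B \<alpha>\<^esub> \<longrightarrow> x = \<zero>\<^bsub>vsp A \<alpha>\<^esub>) \<and>
      component f \<alpha> ` car A \<alpha> = {y \<in> car B \<alpha>. component g \<alpha> y = \<zero>\<^bsub>vsp D \<alpha>\<^esub>} \<and>
      component g \<alpha> ` car B \<alpha> = car D \<alpha>"
    have inj: "inj_on (component f \<alpha>) (car A \<alpha>)" if "\<alpha> \<in> ON" for \<alpha>
      by (rule cm_inj_onI[OF f Ac Bc that]) (use r that in blast)
    have "is_kernel \<C> B D g A f"
      by (rule is_kernelI[OF A B D f g inj]) (use r in simp_all)
    moreover have "is_cokernel \<C> A B f D g"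
      by (rule is_cokernelI[OF A B D f g]) (use r in simp_all)
    ultimately show "short_exact \<C> A B D f g" unfolding short_exact_def by blast
  qed
qed

text \<open>A diagram chase at each stage: elements of the colimits come from some index, and an
  element that vanishes in the colimit vanishes after transport to another index, where exactness of
  the diagrams applies.\<close>

lemma exact_filtered_colimits_grounded_chains: "exact_filtered_colimits TYPE('v) \<C>"
  unfolding exact_filtered_colimits_def
proof (intro allI impI, elim conjE)
  fix J :: "('v, 'v) category" and F G H \<phi> \<psi> LF LG LH sF sG sH f g
  assume J: "small_category J" "filtered J"
    and dF: "is_diagram J \<C> F" and dG: "is_diagram J \<C> G"
    and dH: "is_diagram J \<C> H"
    and nt\<phi>: "is_nat_trans J \<C> F G \<phi>" and nt\<psi>: "is_nat_trans J \<C> G H \<psi>"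
    and se: "\<forall>i\<in>Ob J. short_exact \<C> (dob F i) (dob G i) (dob H i) (\<phi> i) (\<psi> i)"
    and cF: "is_colimit J \<C> F LF sF" and cG: "is_colimit J \<C> G LG sG"
    and cH: "is_colimit J \<C> H LH sH"
    and f: "f \<in> Hom \<C> LF LG" and fs: "\<forall>i\<in>Ob J. f \<circ>\<^sub>c sF i = sG i \<circ>\<^sub>c \<phi> i"
    and g: "g \<in> Hom \<C> LG LH" and gs: "\<forall>i\<in>Ob J. g \<circ>\<^sub>c sG i = sH i \<circ>\<^sub>c \<psi> i"
  interpret F: filtered_diagram k J F by standard (use J dF in auto)
  interpret G: filtered_diagram k J G by standard (use J dG in auto)
  interpret H: filtered_diagram k J H by standard (use J dH in auto)
  have f: "f \<in> maps LF LG" and g: "g \<in> maps LG LH" using f g by (auto simp: Hom_grounded)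
  have LF: "grchain LF" and sF: "\<And>i. i \<in> Ob J \<Longrightarrow> sF i \<in> maps (dob F i) LF"
    and LG: "grchain LG" and sG: "\<And>i. i \<in> Ob J \<Longrightarrow> sG i \<in> maps (dob G i) LG"
    and LH: "grchain LH" and sH: "\<And>i. i \<in> Ob J \<Longrightarrow> sH i \<in> maps (dob H i) LH"
    using cF cG cH unfolding is_colimit_def F.is_cocone_iff G.is_cocone_iff H.is_cocone_iff by blast+
  have sF_arr: "\<And>i j u. i \<in> Ob J \<Longrightarrow> j \<in> Ob J \<Longrightarrow> u \<in> Hom J i j \<Longrightarrow> sF j \<circ>\<^sub>c darr F u = sF i"
    and sG_arr: "\<And>i j u. i \<in> Ob J \<Longrightarrow> j \<in> Ob J \<Longrightarrow> u \<in> Hom J i j \<Longrightarrow> sG j \<circ>\<^sub>c darr G u = sG i"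
    using cF cG unfolding is_colimit_def is_cocone_def by blast+
  have \<phi>: "\<And>i. i \<in> Ob J \<Longrightarrow> \<phi> i \<in> maps (dob F i) (dob G i)"
    and \<psi>: "\<And>i. i \<in> Ob J \<Longrightarrow> \<psi> i \<in> maps (dob G i) (dob H i)"
    and \<phi>_nat: "\<And>i j u. i \<in> Ob J \<Longrightarrow> j \<in> Ob J \<Longrightarrow> u \<in> Hom J i j \<Longrightarrow> \<phi> j \<circ>\<^sub>c darr F u = darr G u \<circ>\<^sub>c \<phi> i"
    and \<psi>_nat: "\<And>i j u. i \<in> Ob J \<Longrightarrow> j \<in> Ob J \<Longrightarrow> u \<in> Hom J i j \<Longrightarrow> \<psi> j \<circ>\<^sub>c darr G u = darr H u \<circ>\<^sub>c \<psi> i"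
    using nt\<phi> nt\<psi> unfolding is_nat_trans_def Hom_grounded by blast+
  note LFc = conjunct1[OF LF] and LGc = conjunct1[OF LG] and LHc = conjunct1[OF LH]
  show "short_exact \<C> LF LG LH f g"
    unfolding short_exact_iff[OF LF LG LH f g]
  proof
    fix \<alpha> :: 'v assume \<alpha>: "\<alpha> \<in> ON"
    have ex_i: "\<And>x. x \<in> car (dob F i) \<alpha> \<Longrightarrow> component (\<phi> i) \<alpha> x = \<zero>\<^bsub>vsp (dob G i) \<alpha>\<^esub> \<Longrightarrow> x = \<zero>\<^bsub>vsp (dob F i) \<alpha>\<^esub>"
      "component (\<phi> i) \<alpha> ` car (dob F i) \<alpha> =
        {y \<in> car (dob G i) \<alpha>. component (\<psi> i) \<alpha> y = \<zero>\<^bsub>vsp (dob H i) \<alpha>\<^esub>}"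
      "component (\<psi> i) \<alpha> ` car (dob G i) \<alpha> = car (dob H i) \<alpha>" if i: "i \<in> Ob J" for i
      using bspec[OF se i] \<alpha>
      unfolding short_exact_iff[OF F.dob_grchain[OF i] G.dob_grchain[OF i] H.dob_grchain[OF i] \<phi>[OF i] \<psi>[OF i]]
      by blast+
    have fs': "component f \<alpha> (component (sF i) \<alpha> x) = component (sG i) \<alpha> (component (\<phi> i) \<alpha> x)"
      if "i \<in> Ob J" "x \<in> car (dob F i) \<alpha>" for i x
      using component_comp[OF sF[OF that(1)] \<alpha> that(2), of f] component_comp[OF \<phi>[OF that(1)] \<alpha> that(2), of "sG i"]
        fs that(1) by simp
    have gs': "component g \<alpha> (component (sG i) \<alpha> x) = component (sH i) \<alpha> (component (\<psi> i) \<alpha> x)"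
      if "i \<in> Ob J" "x \<in> car (dob G i) \<alpha>" for i x
      using component_comp[OF sG[OF that(1)] \<alpha> that(2), of g] component_comp[OF \<psi>[OF that(1)] \<alpha> that(2), of "sH i"]
        gs that(1) by simp
    have sF_u: "component (sF j) \<alpha> (component (darr F u) \<alpha> x) = component (sF i) \<alpha> x"
      if "i \<in> Ob J" "j \<in> Ob J" "u \<in> Hom J i j" "x \<in> car (dob F i) \<alpha>" for i j u x
      using component_comp[OF F.darr_in[OF that(1-3)] \<alpha> that(4), of "sF j"] sF_arr[OF that(1-3)] by simp
    have sG_u: "component (sG j) \<alpha> (component (darr G u) \<alpha> x) = component (sG i) \<alpha> x"
      if "i \<in> Ob J" "j \<in> Ob J" "u \<in> Hom J i j" "x \<in> car (dob G i) \<alpha>" for i j u x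
      using component_comp[OF G.darr_in[OF that(1-3)] \<alpha> that(4), of "sG j"] sG_arr[OF that(1-3)] by simp
    have \<phi>_u: "component (\<phi> j) \<alpha> (component (darr F u) \<alpha> x) = component (darr G u) \<alpha> (component (\<phi> i) \<alpha> x)"
      if "i \<in> Ob J" "j \<in> Ob J" "u \<in> Hom J i j" "x \<in> car (dob F i) \<alpha>" for i j u x
      using component_comp[OF F.darr_in[OF that(1-3)] \<alpha> that(4), of "\<phi> j"]
        component_comp[OF \<phi>[OF that(1)] \<alpha> that(4), of "darr G u"] \<phi>_nat[OF that(1-3)] by simp
    have \<psi>_u: "component (\<psi> j) \<alpha> (component (darr G u) \<alpha> x) = component (darr H u) \<alpha> (component (\<psi> i) \<alpha> x)"
      if "i \<in> Ob J" "j \<in> Ob J" "u \<in> Hom J i j" "x \<in> car (dob G i) \<alpha>" for i j u x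
      using component_comp[OF G.darr_in[OF that(1-3)] \<alpha> that(4), of "\<psi> j"]
        component_comp[OF \<psi>[OF that(1)] \<alpha> that(4), of "darr H u"] \<psi>_nat[OF that(1-3)] by simp
    show "(\<forall>x\<in>car LF \<alpha>. component f \<alpha> x = \<zero>\<^bsub>vsp LG \<alpha>\<^esub> \<longrightarrow> x = \<zero>\<^bsub>vsp LF \<alpha>\<^esub>) \<and>
      component f \<alpha> ` car LF \<alpha> = {y \<in> car LG \<alpha>. component g \<alpha> y = \<zero>\<^bsub>vsp LH \<alpha>\<^esub>} \<and>
      component g \<alpha> ` car LG \<alpha> = car LH \<alpha>"
    proof (intro conjI ballI impI)
      fix y assume y: "y \<in> car LF \<alpha>" "component f \<alpha> y = \<zero>\<^bsub>vsp LG \<alpha>\<^esub>"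
      obtain i x where i: "i \<in> Ob J" and x: "x \<in> car (dob F i) \<alpha>" "y = component (sF i) \<alpha> x"
        using F.colimit_elements(1)[OF cF \<alpha> y(1)] by blast
      have "component (sG i) \<alpha> (component (\<phi> i) \<alpha> x) = \<zero>\<^bsub>vsp LG \<alpha>\<^esub>" using fs'[OF i x(1)] x(2) y(2) by simp
      then obtain j u where j: "j \<in> Ob J" "u \<in> Hom J i j"
        "component (darr G u) \<alpha> (component (\<phi> i) \<alpha> x) = \<zero>\<^bsub>vsp (dob G j) \<alpha>\<^esub>"
        using G.colimit_elements(2)[OF cG \<alpha> i cm_closed[OF \<phi>[OF i] \<alpha> x(1)]] by blast
      have "component (darr F u) \<alpha> x = \<zero>\<^bsub>vsp (dob F j) \<alpha>\<^esub>"
        using ex_i(1)[OF j(1) cm_closed[OF F.darr_in[OF i j(1,2)] \<alpha> x(1)]] \<phi>_u[OF i j(1,2) x(1)] j(3) by simp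
      then show "y = \<zero>\<^bsub>vsp LF \<alpha>\<^esub>"
        using sF_u[OF i j(1,2) x(1)] cm_zero[OF sF[OF j(1)] F.D_chain[OF j(1)] LFc \<alpha>] x(2) by simp
    next
      show "component f \<alpha> ` car LF \<alpha> = {y \<in> car LG \<alpha>. component g \<alpha> y = \<zero>\<^bsub>vsp LH \<alpha>\<^esub>}"
      proof (intro equalityI subsetI)
        fix z assume "z \<in> component f \<alpha> ` car LF \<alpha>"
        then obtain y where y: "y \<in> car LF \<alpha>" "z = component f \<alpha> y" by blast
        obtain i x where i: "i \<in> Ob J" and x: "x \<in> car (dob F i) \<alpha>" "y = component (sF i) \<alpha> x"
          using F.colimit_elements(1)[OF cF \<alpha> y(1)] by blast
        have px: "component (\<phi> i) \<alpha> x \<in> car (dob G i) \<alpha>" using cm_closed[OF \<phi>[OF i] \<alpha> x(1)] .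
        have "component (\<psi> i) \<alpha> (component (\<phi> i) \<alpha> x) = \<zero>\<^bsub>vsp (dob H i) \<alpha>\<^esub>" using ex_i(2)[OF i] x(1) by blast
        then have "component g \<alpha> z = \<zero>\<^bsub>vsp LH \<alpha>\<^esub>"
          using gs'[OF i px] fs'[OF i x(1)] cm_zero[OF sH[OF i] H.D_chain[OF i] LHc \<alpha>] x(2) y(2) by simp
        then show "z \<in> {y \<in> car LG \<alpha>. component g \<alpha> y = \<zero>\<^bsub>vsp LH \<alpha>\<^esub>}"
          using cm_closed[OF f \<alpha> y(1)] y(2) by simp
      next
        fix z assume "z \<in> {y \<in> car LG \<alpha>. component g \<alpha> y = \<zero>\<^bsub>vsp LH \<alpha>\<^esub>}"
        then have z: "z \<in> car LG \<alpha>" "component g \<alpha> z = \<zero>\<^bsub>vsp LH \<alpha>\<^esub>" by auto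
        obtain i x where i: "i \<in> Ob J" and x: "x \<in> car (dob G i) \<alpha>" "z = component (sG i) \<alpha> x"
          using G.colimit_elements(1)[OF cG \<alpha> z(1)] by blast
        have "component (sH i) \<alpha> (component (\<psi> i) \<alpha> x) = \<zero>\<^bsub>vsp LH \<alpha>\<^esub>" using gs'[OF i x(1)] x(2) z(2) by simp
        then obtain j u where j: "j \<in> Ob J" "u \<in> Hom J i j"
          "component (darr H u) \<alpha> (component (\<psi> i) \<alpha> x) = \<zero>\<^bsub>vsp (dob H j) \<alpha>\<^esub>"
          using H.colimit_elements(2)[OF cH \<alpha> i cm_closed[OF \<psi>[OF i] \<alpha> x(1)]] by blast
        \<comment> \<open>x itself need not lie in the kernel of \<open>\<psi> i\<close>, but its
          transport to j lies in that of \<open>\<psi> j\<close>, hence comes from F.\<close>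
        let ?y = "component (darr G u) \<alpha> x"
        have "?y \<in> {y \<in> car (dob G j) \<alpha>. component (\<psi> j) \<alpha> y = \<zero>\<^bsub>vsp (dob H j) \<alpha>\<^esub>}"
          using cm_closed[OF G.darr_in[OF i j(1,2)] \<alpha> x(1)] \<psi>_u[OF i j(1,2) x(1)] j(3) by simp
        then obtain w where w: "w \<in> car (dob F j) \<alpha>" "?y = component (\<phi> j) \<alpha> w"
          using ex_i(2)[OF j(1)] by blast
        have "z = component f \<alpha> (component (sF j) \<alpha> w)"
          using fs'[OF j(1) w(1)] sG_u[OF i j(1,2) x(1)] w(2) x(2) by simp
        then show "z \<in> component f \<alpha> ` car LF \<alpha>" using cm_closed[OF sF[OF j(1)] \<alpha> w(1)] by simp
      qed
    next
      show "component g \<alpha> ` car LG \<alpha> = car LH \<alpha>"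
      proof (intro equalityI subsetI)
        fix z assume z: "z \<in> car LH \<alpha>"
        obtain i x where i: "i \<in> Ob J" and x: "x \<in> car (dob H i) \<alpha>" "z = component (sH i) \<alpha> x"
          using H.colimit_elements(1)[OF cH \<alpha> z] by blast
        obtain w where w: "w \<in> car (dob G i) \<alpha>" "x = component (\<psi> i) \<alpha> w"
          using ex_i(3)[OF i] x(1) by blast
        have "z = component g \<alpha> (component (sG i) \<alpha> w)" using gs'[OF i w(1)] x(2) w(2) by simp
        then show "z \<in> component g \<alpha> ` car LG \<alpha>" using cm_closed[OF sG[OF i] \<alpha> w(1)] by simp
      qed (use cm_closed[OF g \<alpha>] in blast)
    qed
  qed
qed

lemma AB5_grounded_chains: "AB5 TYPE('v) \<C>"
  unfolding AB5_def
  using abelian_grounded_chains cocomplete_grounded_chains exact_filtered_colimits_grounded_chains by blast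

section \<open>Injective objects\<close>

text \<open>The tower as a chain over itself: one-dimensional at every stage and generated by 1 at
  stage zero. It contains every truncation \<open>free_chain \<beta>\<close>, and it is the chain
  that will turn out to embed into no injective.\<close>

definition tower_chain where
  "tower_chain = \<lparr>vsp = \<lambda>\<alpha>. \<lparr>carrier = carrier (fld k \<alpha>), mult = undefined, one = undefined,
    zero = zero (fld k \<alpha>), add = add (fld k \<alpha>), smult = mult (fld k \<alpha>)\<rparr>, tmap = emb k\<rparr>"

lemma tower_chain_simps [simp]:
  "car tower_chain \<alpha> = carrier (fld k \<alpha>)" "\<zero>\<^bsub>vsp tower_chain \<alpha>\<^esub> = \<zero>\<^bsub>fld k \<alpha>\<^esub>"
  "x \<oplus>\<^bsub>vsp tower_chain \<alpha>\<^esub> y = x \<oplus>\<^bsub>fld k \<alpha>\<^esub> y" "x \<odot>\<^bsub>vsp tower_chain \<alpha>\<^esub> y = x \<otimes>\<^bsub>fld k \<alpha>\<^esub> y"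
  "tmap tower_chain = emb k"
  by (simp_all add: tower_chain_def)

lemma is_chain_tower_chain: "is_chain k tower_chain"
proof (rule is_chainI)
  fix \<alpha> :: 'v assume \<alpha>: "\<alpha> \<in> ON"
  interpret cring "fld k \<alpha>" by (rule fld_cring[OF \<alpha>])
  have "abelian_group (vsp tower_chain \<alpha>)"
  proof (rule abelian_groupI)
    show "\<exists>y\<in>car tower_chain \<alpha>. y \<oplus>\<^bsub>vsp tower_chain \<alpha>\<^esub> x = \<zero>\<^bsub>vsp tower_chain \<alpha>\<^esub>"
      if "x \<in> car tower_chain \<alpha>" for x
      using that by (intro bexI[of _ "\<ominus>\<^bsub>fld k \<alpha>\<^esub> x"]) (simp_all add: l_neg)
  qed (auto simp: a_ac)
  then show "module (fld k \<alpha>) (vsp tower_chain \<alpha>)"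
    by (intro moduleI is_cring) (auto simp: l_distr r_distr m_assoc)
  show "small (car tower_chain \<alpha>)" using small_fld[OF \<alpha>] by simp
qed (use emb_hom in \<open>auto simp: emb_closed emb_id emb_emb dest: ring_hom_add ring_hom_mult\<close>)

text \<open>Field embeddings send 1 to 1, and a submodule containing 1 is everything; so stage zero
  generates all stages.\<close>

lemma grounded_tower_chain: "grounded k tower_chain"
  unfolding grounded_def
proof
  show "vset {} \<in> (ON :: 'v set)" by (rule ON_vset_empty)
  show "grounded_at k (vset {}) tower_chain"
    unfolding grounded_at_iff[OF is_chain_tower_chain ON_vset_empty]
  proof (intro allI impI subsetI)
    fix \<beta> H x assume \<beta>: "ord_less (vset {}) \<beta>" and H: "submodule H (fld k \<beta>) (vsp tower_chain \<beta>)"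
      and im: "tmap tower_chain \<beta> (vset {}) ` car tower_chain (vset {}) \<subseteq> H"
      and x: "x \<in> car tower_chain \<beta>"
    interpret R: cring "fld k (vset {})" by (rule fld_cring[OF ON_vset_empty])
    interpret S: cring "fld k \<beta>" by (rule fld_cring[OF ord_less_ON(2)[OF \<beta>]])
    have "emb k \<beta> (vset {}) \<one>\<^bsub>fld k (vset {})\<^esub> \<in> H" using im by auto
    then have one: "\<one>\<^bsub>fld k \<beta>\<^esub> \<in> H" using ring_hom_one[OF emb_hom[OF ord_less_imp_le[OF \<beta>]]] by simp
    have "x \<odot>\<^bsub>vsp tower_chain \<beta>\<^esub> \<one>\<^bsub>fld k \<beta>\<^esub> \<in> H"
      by (rule submoduleD(4)[OF H _ one]) (use x in simp)
    then show "x \<in> H" using x by simp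
  qed
qed

text \<open>The truncation of the tower at \<open>\<beta>\<close> is free on one generator at stage \<open>\<beta>\<close>.\<close>

definition free_part where
  "free_part \<beta> \<gamma> = (if ord_le \<beta> \<gamma> then carrier (fld k \<gamma>) else {\<zero>\<^bsub>fld k \<gamma>\<^esub>})"

lemma closed_family_free_part: "closed_family tower_chain (free_part \<beta>)"
  unfolding closed_family_def
proof (intro conjI ballI allI impI)
  fix \<gamma> :: 'v assume \<gamma>: "\<gamma> \<in> ON"
  interpret module "fld k \<gamma>" "vsp tower_chain \<gamma>" by (rule chain_module[OF is_chain_tower_chain \<gamma>])
  show "submodule (free_part \<beta> \<gamma>) (fld k \<gamma>) (vsp tower_chain \<gamma>)"
    by (rule submoduleI') (auto simp: free_part_def)
next
  fix \<gamma> \<delta> :: 'v assume le: "ord_le \<gamma> \<delta>"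
  have "emb k \<delta> \<gamma> \<zero>\<^bsub>fld k \<gamma>\<^esub> = \<zero>\<^bsub>fld k \<delta>\<^esub>" using tmap_zero[OF is_chain_tower_chain le] by simp
  moreover interpret S: cring "fld k \<delta>" by (rule fld_cring[OF ord_le_ON(2)[OF le]])
  show "tmap tower_chain \<delta> \<gamma> ` free_part \<beta> \<gamma> \<subseteq> free_part \<beta> \<delta>"
    using calculation le emb_closed[OF le] ord_le_trans[OF _ le] by (auto simp: free_part_def)
qed

definition free_chain where "free_chain \<beta> = subchain tower_chain (free_part \<beta>)"

lemma grchain_free_chain: "grchain (free_chain \<beta>)"
  unfolding free_chain_def
  using is_chain_subchain grounded_subchain is_chain_tower_chain grounded_tower_chain closed_family_free_part by blast

lemma free_chain_simps [simp]:
  "car (free_chain \<beta>) \<alpha> = free_part \<beta> \<alpha>" "\<zero>\<^bsub>vsp (free_chain \<beta>) \<alpha>\<^esub> = \<zero>\<^bsub>fld k \<alpha>\<^esub>"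
  "x \<oplus>\<^bsub>vsp (free_chain \<beta>) \<alpha>\<^esub> y = x \<oplus>\<^bsub>fld k \<alpha>\<^esub> y" "x \<odot>\<^bsub>vsp (free_chain \<beta>) \<alpha>\<^esub> y = x \<otimes>\<^bsub>fld k \<alpha>\<^esub> y"
  "tmap (free_chain \<beta>) = emb k"
  by (simp_all add: free_chain_def subchain_def tower_chain_def)

text \<open>Freeness: the generator 1 at stage \<beta> goes to x, so a scalar at a later stage goes
  to that multiple of the transported x. At stages before \<beta> the source is zero.\<close>

lemma free_chain_map:
  assumes V: "is_chain k V" and \<beta>: "\<beta> \<in> ON" and x: "x \<in> car V \<beta>"
  shows "mk_map (free_chain \<beta>) V (\<lambda>\<gamma> a. if ord_le \<beta> \<gamma> then a \<odot>\<^bsub>vsp V \<gamma>\<^esub> tmap V \<gamma> \<beta> x else \<zero>\<^bsub>vsp V \<gamma>\<^esub>)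
    \<in> maps (free_chain \<beta>) V"
proof (rule mk_map_in)
  fix \<gamma> a b assume a: "\<gamma> \<in> ON" "a \<in> car (free_chain \<beta>) \<gamma>" "b \<in> car (free_chain \<beta>) \<gamma>"
  interpret module "fld k \<gamma>" "vsp V \<gamma>" by (rule chain_module[OF V a(1)])
  have tx: "ord_le \<beta> \<gamma> \<Longrightarrow> tmap V \<gamma> \<beta> x \<in> car V \<gamma>" using tmap_closed[OF V _ x] .
  let ?f = "\<lambda>a. if ord_le \<beta> \<gamma> then a \<odot>\<^bsub>vsp V \<gamma>\<^esub> tmap V \<gamma> \<beta> x else \<zero>\<^bsub>vsp V \<gamma>\<^esub>"
  show "?f a \<in> car V \<gamma>" using a tx by (auto simp: free_part_def)
  show "?f (a \<oplus>\<^bsub>vsp (free_chain \<beta>) \<gamma>\<^esub> b) = ?f a \<oplus>\<^bsub>vsp V \<gamma>\<^esub> ?f b"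
    using a tx by (auto simp: free_part_def smult_l_distr)
  show "?f (c \<odot>\<^bsub>vsp (free_chain \<beta>) \<gamma>\<^esub> a) = c \<odot>\<^bsub>vsp V \<gamma>\<^esub> ?f a" if "c \<in> carrier (fld k \<gamma>)" for c
    using a tx that by (auto simp: free_part_def smult_assoc1)
next
  fix \<gamma> \<delta> a assume le: "ord_le \<gamma> \<delta>" and a: "a \<in> car (free_chain \<beta>) \<gamma>"
  note o = ord_le_ON[OF le]
  interpret module "fld k \<delta>" "vsp V \<delta>" by (rule chain_module[OF V o(2)])
  show "(if ord_le \<beta> \<delta> then tmap (free_chain \<beta>) \<delta> \<gamma> a \<odot>\<^bsub>vsp V \<delta>\<^esub> tmap V \<delta> \<beta> x else \<zero>\<^bsub>vsp V \<delta>\<^esub>) =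
    tmap V \<delta> \<gamma> (if ord_le \<beta> \<gamma> then a \<odot>\<^bsub>vsp V \<gamma>\<^esub> tmap V \<gamma> \<beta> x else \<zero>\<^bsub>vsp V \<gamma>\<^esub>)"
  proof (cases "ord_le \<beta> \<gamma>")
    case True
    then show ?thesis
      using a ord_le_trans[OF True le] tmap_smult[OF V le _ tmap_closed[OF V True x]] tmap_tmap[OF V True le x]
      by (simp add: free_part_def)
  next
    case False
    \<comment> \<open>Here a is zero and stays so at \<delta>, whether or not \<delta> has reached
      \<beta>.\<close>
    then have "emb k \<delta> \<gamma> a = \<zero>\<^bsub>fld k \<delta>\<^esub>"
      using a tmap_zero[OF is_chain_tower_chain le] by (simp add: free_part_def)
    then show ?thesis using False tmap_zero[OF V le] tmap_closed[OF V _ x] by simp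
  qed
qed (use grchain_free_chain in blast)

text \<open>An element at stage \<open>\<beta>\<close> is a map from the free chain at \<open>\<beta>\<close>, to be extended to the free chain at stage 0.\<close>

lemma injective_tmap_surj:
  assumes I: "injective_object \<C> I" and \<beta>: "\<beta> \<in> ON" and x: "x \<in> car I \<beta>"
  shows "\<exists>y\<in>car I (vset {}). tmap I \<beta> (vset {}) y = x"
proof -
  have Ig: "grchain I" using I by (simp add: injective_object_def Ob_grounded)
  note Ic = conjunct1[OF Ig]
  let ?P = "free_chain \<beta>" and ?T = tower_chain and ?z = "vset {} :: 'v"
  have le: "ord_le ?z \<beta>" by (rule vset_empty_le[OF \<beta>])
  interpret R: cring "fld k ?z" by (rule fld_cring[OF ON_vset_empty])
  interpret S: cring "fld k \<beta>" by (rule fld_cring[OF \<beta>])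
  interpret M: module "fld k \<beta>" "vsp I \<beta>" by (rule chain_module[OF Ic \<beta>])
  define m where "m = mk_map ?P ?T (\<lambda>\<alpha> x. x)"
  define f where "f = mk_map ?P I (\<lambda>\<gamma> a. if ord_le \<beta> \<gamma> then a \<odot>\<^bsub>vsp I \<gamma>\<^esub> tmap I \<gamma> \<beta> x else \<zero>\<^bsub>vsp I \<gamma>\<^esub>)"
  have T: "grchain ?T" using is_chain_tower_chain grounded_tower_chain by blast
  have m: "m \<in> maps ?P ?T"
    unfolding m_def free_chain_def by (rule inclusion_in[OF is_chain_tower_chain closed_family_free_part])
  have "mono_arrow \<C> ?P ?T m"
    unfolding mono_arrow_iff[OF grchain_free_chain T] using m by (auto simp: m_def inj_on_def)
  moreover have f: "f \<in> maps ?P I" unfolding f_def by (rule free_chain_map[OF Ic \<beta> x])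
  ultimately obtain g where g: "g \<in> maps ?T I" "g \<circ>\<^sub>c m = f"
    using I T grchain_free_chain unfolding injective_object_def Ob_grounded Hom_grounded by blast
  have 1: "\<one>\<^bsub>fld k \<beta>\<^esub> \<in> carrier (vsp ?P \<beta>)" by (simp add: free_part_def ord_le_refl \<beta>)
  have "component g \<beta> \<one>\<^bsub>fld k \<beta>\<^esub> = component f \<beta> \<one>\<^bsub>fld k \<beta>\<^esub>"
    using component_comp[OF m \<beta> 1, of g] 1 \<beta> unfolding g(2) by (simp add: m_def)
  also have "\<dots> = x" using 1 \<beta> x tmap_id[OF Ic \<beta> x] by (simp add: f_def ord_le_refl)
  \<comment> \<open>The 1 of stage \<beta> is the image of the 1 of stage zero, where the extension
    g is also defined; hence x is the transition image of the value of g there.\<close>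
  also have "component g \<beta> \<one>\<^bsub>fld k \<beta>\<^esub> = tmap I \<beta> ?z (component g ?z \<one>\<^bsub>fld k ?z\<^esub>)"
    using cm_tmap[OF g(1) le, of "\<one>\<^bsub>fld k ?z\<^esub>"] ring_hom_one[OF emb_hom[OF le]] by simp
  finally show ?thesis using cm_closed[OF g(1) ON_vset_empty, of "\<one>\<^bsub>fld k ?z\<^esub>"] by auto
qed

text \<open>If the embedding were onto, the upper field would have dimension one over the image,
  against infinite degree.\<close>

lemma emb_not_surj:
  assumes "ord_less \<alpha> \<beta>"
  shows "\<exists>b\<in>carrier (fld k \<beta>). b \<notin> emb k \<beta> \<alpha> ` carrier (fld k \<alpha>)"
proof (rule ccontr)
  assume "\<not> ?thesis"
  then have eq: "emb k \<beta> \<alpha> ` carrier (fld k \<alpha>) = carrier (fld k \<beta>)"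
    using emb_closed[OF ord_less_imp_le[OF assms]] by blast
  interpret field "fld k \<beta>" using fld_field ord_less_ON assms by blast
  have "dimension 1 (carrier (fld k \<beta>)) (carrier (fld k \<beta>))"
    by (rule dimension_one[OF carrier_is_subfield])
  then show False using infinite_degree[OF assms] unfolding eq finite_dimension_def by blast
qed

lemma ord_le_vsucc: "ord_less \<beta> \<gamma> \<Longrightarrow> ord_le (vsucc \<beta>) \<gamma>"
  using ord_linear[of "vsucc \<beta>" \<gamma>] ON_vsucc[of \<beta>] not_in_elts_self ON_trans
  by (auto simp: ord_less_def ord_le_def)

text \<open>
  If the tower embeds into an injective chain \<open>I\<close>, then elements of successive differences of
  the tower have distinct preimages in the set \<open>I\<close> at stage 0, one for every ordinal.
\<close>

lemma not_enough_injectives: "\<not> enough_injectives \<C>"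
proof
  assume "enough_injectives \<C>"
  moreover have T: "grchain tower_chain" using is_chain_tower_chain grounded_tower_chain by blast
  ultimately obtain I m where I: "injective_object \<C> I"
    and mono: "mono_arrow \<C> tower_chain I m"
    unfolding enough_injectives_def Ob_grounded by blast
  have Ig: "grchain I" using I by (simp add: injective_object_def Ob_grounded)
  note Ic = conjunct1[OF Ig]
  have m: "m \<in> maps tower_chain I"
    and inj: "\<And>\<alpha>. \<alpha> \<in> ON \<Longrightarrow> inj_on (component m \<alpha>) (carrier (fld k \<alpha>))"
    using mono unfolding mono_arrow_iff[OF T Ig] by auto
  have "\<forall>\<beta>\<in>ON. \<exists>b. b \<in> carrier (fld k (vsucc \<beta>)) \<and> b \<notin> emb k (vsucc \<beta>) \<beta> ` carrier (fld k \<beta>)"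
    using emb_not_surj[OF ord_less_vsucc] by blast
  then obtain b where b: "\<And>\<beta>. \<beta> \<in> ON \<Longrightarrow> b \<beta> \<in> carrier (fld k (vsucc \<beta>))"
    "\<And>\<beta>. \<beta> \<in> ON \<Longrightarrow> b \<beta> \<notin> emb k (vsucc \<beta>) \<beta> ` carrier (fld k \<beta>)" by metis
  have mb: "component m (vsucc \<beta>) (b \<beta>) \<in> car I (vsucc \<beta>)" if "\<beta> \<in> ON" for \<beta>
    using cm_closed[OF m ON_vsucc[OF that], of "b \<beta>"] b(1)[OF that] by simp
  have "\<forall>\<beta>\<in>ON. \<exists>y. y \<in> car I (vset {}) \<and>
      tmap I (vsucc \<beta>) (vset {}) y = component m (vsucc \<beta>) (b \<beta>)"
    using injective_tmap_surj[OF I ON_vsucc mb] by blast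
  then obtain y where y: "\<And>\<beta>. \<beta> \<in> ON \<Longrightarrow> y \<beta> \<in> car I (vset {})"
    "\<And>\<beta>. \<beta> \<in> ON \<Longrightarrow> tmap I (vsucc \<beta>) (vset {}) (y \<beta>) = component m (vsucc \<beta>) (b \<beta>)" by metis
  have ne: "y \<beta> \<noteq> y \<gamma>" if lt: "ord_less \<beta> \<gamma>" for \<beta> \<gamma>
  proof
    assume eq: "y \<beta> = y \<gamma>"
    note o = ord_less_ON[OF lt]
    have s\<beta>: "vsucc \<beta> \<in> ON" and s\<gamma>: "vsucc \<gamma> \<in> ON" using o ON_vsucc by blast+
    \<comment> \<open>\<open>b \<beta>\<close> lives one stage after \<beta>, which is still at most
      \<gamma>. Its image one stage after \<gamma> thus passes through \<gamma>, whereas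
      \<open>b \<gamma>\<close> was chosen outside the image of \<gamma>.\<close>
    have le1: "ord_le (vsucc \<beta>) \<gamma>" by (rule ord_le_vsucc[OF lt])
    have le2: "ord_le \<gamma> (vsucc \<gamma>)" by (rule ord_less_imp_le[OF ord_less_vsucc[OF o(2)]])
    note le = ord_le_trans[OF le1 le2]
    let ?b = "emb k (vsucc \<gamma>) (vsucc \<beta>) (b \<beta>)"
    have bb: "b \<beta> \<in> carrier (fld k (vsucc \<beta>))" by (rule b(1)[OF o(1)])
    have "component m (vsucc \<gamma>) (b \<gamma>) = tmap I (vsucc \<gamma>) (vset {}) (y \<beta>)" using y(2)[OF o(2)] eq by simp
    also have "\<dots> = tmap I (vsucc \<gamma>) (vsucc \<beta>) (tmap I (vsucc \<beta>) (vset {}) (y \<beta>))"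
      using tmap_tmap[OF Ic vset_empty_le[OF s\<beta>] le y(1)[OF o(1)]] by simp
    also have "\<dots> = component m (vsucc \<gamma>) ?b"
      using cm_tmap[OF m le, of "b \<beta>"] bb y(2)[OF o(1)] by simp
    finally have "b \<gamma> = ?b"
      using inj_onD[OF inj[OF s\<gamma>]] b(1)[OF o(2)] emb_closed[OF le bb] by blast
    also have "?b = emb k (vsucc \<gamma>) \<gamma> (emb k \<gamma> (vsucc \<beta>) (b \<beta>))" using emb_emb[OF le1 le2 bb] by simp
    finally show False using b(2)[OF o(2)] emb_closed[OF le1 bb] by blast
  qed
  have "inj_on y ON"
  proof (rule inj_onI)
    fix \<beta> \<gamma> assume "\<beta> \<in> ON" "\<gamma> \<in> ON" "y \<beta> = y \<gamma>"
    then show "\<beta> = \<gamma>" using ord_linear ne by metis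
  qed
  moreover have "small (y ` ON)"
    by (rule small_subset[OF chain_small[OF Ic ON_vset_empty]]) (use y(1) in blast)
  \<comment> \<open>Replacement along the inverse of y would carry a subset of stage zero onto the
    class of all ordinals.\<close>
  ultimately have "small (ON :: 'v set)"
    using small_image[of "y ` ON" "inv_into ON y"] by simp
  then show False using not_small_ON by blast
qed

end

theorem theorem1p9:
  fixes k :: "'v::zfc tower"
  assumes "field_tower k"
  shows "AB5 TYPE('v) (grounded_chains k) \<and> \<not> enough_injectives (grounded_chains k)"
proof -
  interpret tower k by standard (rule assms)
  show ?thesis using AB5_grounded_chains not_enough_injectives by blast
qed

end
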